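(* Let $(M,g,\tau,P)$ be a Carrollian--Poisson bundle. Then Vaisman connections that are both metric-compatible and clock-compatible always exist on $(M,g,\tau,P)$.
   Context: All manifolds are real, finite-dimensional, Hausdorff, second countable and smooth. $\mathrm{Vect}(M)$ denotes vector fields on $M$. A Carrollian bundle $(M,g,\tau)$ consists of a principal $\mathbb{R}$-bundle $\pi:M\to\Sigma$ (structure group $(\mathbb{R},+)$), with vertical bundle $\mathsf{V}M=\ker d\pi$ and vertical vector fields $\mathrm{Vect}_{\mathsf V}(M)$; a degenerate metric (symmetric 2-tensor) $g$ with $\ker(g)=\mathrm{Vect}_{\mathsf V}(M)$, not necessarily invariant under the action; and a clock form $\tau\in\Omega^1(M)$, i.e. an Ehresmann connection form (not necessarily principal nor flat), with horizontal vector fields $\mathrm{Vect}_{\mathsf H}(M)=\ker(\tau)$, so that $\mathrm{Vect}(M)=\mathrm{Vect}_{\mathsf V}(M)\oplus\mathrm{Vect}_{\mathsf H}(M)$. It is assumed that $g$ is positive on non-zero horizontal vectors. The Carroll vector field $\kappa$ is the fundamental vector field of the principal action, a nowhere vanishing frame of $\mathrm{Vect}_{\mathsf V}(M)$ normalised by $\tau(\kappa)=1$. A Poisson structure is a bivector field $P$ with vanishing Schouten--Nijenhuis bracket $[\![P,P]\!]=0$; its anchor is $P^\#:\Omega^1(M)\to\mathrm{Vect}(M)$, $P^\#(\alpha)=P(\alpha,-)$, so $\beta(P^\#(\alpha))=P(\alpha,\beta)$. A Carrollian--Poisson bundle $(M,g,\tau,P)$ is a Carrollian bundle $(M,g,\tau)$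 with a Poisson structure $P$ such that $\ker_m(g)\subset\mathrm{Im}(P^\#_m)$ at every point $m\in M$ where the rank of $P^\#_m:T^*_mM\to T_mM$ is non-zero. A Vaisman (contravariant) connection on $(M,P)$ is an $\mathbb{R}$-bilinear map $D:\Omega^1(M)\times\Omega^1(M)\to\Omega^1(M)$ with $D_{f\alpha}\beta=fD_\alpha\beta$ and $D_\alpha(f\beta)=P^\#(\alpha)(f)\,\beta+fD_\alpha\beta$. It acts on vector fields by $\beta(D_\alpha X)=P^\#(\alpha)(\beta(X))-(D_\alpha\beta)(X)$, and on $g$ by $(D_\alpha g)(X,Y)=P^\#(\alpha)(g(X,Y))-g(D_\alpha X,Y)-g(X,D_\alpha Y)$. $D$ is metric-compatible if $D_\alpha g=0$ for all $\alpha$, and clock-compatible if $D_\alpha\tau=0$ for all $\alpha$. *)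

theory Defs
  imports "HOL-Analysis.Analysis" "HOL-Library.Function_Algebras"
begin

section \<open>Smooth maps between open subsets of finite-dimensional normed spaces\<close>

text \<open>For an open set \<open>S\<close> of a finite-dimensional space, \<open>Ck_on k S f\<close> says that \<open>f\<close> is of
  class \<open>C\<^sup>k\<close> on \<open>S\<close>: all iterated directional derivatives up to order \<open>k\<close> exist and are
  continuous. It is only ever used on open sets.\<close>

primrec Ck_on :: "nat \<Rightarrow> 'a::real_normed_vector set \<Rightarrow> ('a \<Rightarrow> 'b::real_normed_vector) \<Rightarrow> bool" where
  "Ck_on 0 S f \<longleftrightarrow> continuous_on S f"
| "Ck_on (Suc k) S f \<longleftrightarrow>
     (\<forall>x\<in>S. f differentiable (at x)) \<and>
     (\<forall>v. Ck_on k S (\<lambda>x. frechet_derivative f (at x) v))"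

definition smooth_on :: "'a::real_normed_vector set \<Rightarrow> ('a \<Rightarrow> 'b::real_normed_vector) \<Rightarrow> bool" where
  "smooth_on S f \<longleftrightarrow> (\<forall>k. Ck_on k S f)"


section \<open>Smooth manifolds\<close>

text \<open>The underlying space of a manifold is a Hausdorff, second countable type; its smooth
  structure is given by a smooth, not necessarily maximal, atlas of charts \<open>(U, \<phi>)\<close>, where only
  the values of \<open>\<phi>\<close> on \<open>U\<close> matter. The model space is any finite-dimensional normed space
  (\<open>real_normed_vector\<close> rather than \<open>euclidean_space\<close>, so that dimension 0 is permitted).\<close>

type_synonym ('m, 'e) atlas = "('m set \<times> ('m \<Rightarrow> 'e)) set"

definition smooth_manifold ::
  "('m::{t2_space,second_countable_topology}, 'e::real_normed_vector) atlas \<Rightarrow> bool" where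
  "smooth_manifold A \<longleftrightarrow>
     (\<exists>S::'e set. finite S \<and> span S = UNIV) \<and>
     (\<Union>(U,\<phi>)\<in>A. U) = UNIV \<and>
     (\<forall>(U,\<phi>)\<in>A. open U \<and> open (\<phi> ` U) \<and> homeomorphism U (\<phi> ` U) \<phi> (inv_into U \<phi>)) \<and>
     (\<forall>(U,\<phi>)\<in>A. \<forall>(V,\<psi>)\<in>A. smooth_on (\<phi> ` (U \<inter> V)) (\<psi> \<circ> inv_into U \<phi>))"

definition euclidean_atlas :: "('e, 'e::real_normed_vector) atlas" where
  "euclidean_atlas = {(UNIV, \<lambda>x. x)}"

definition prod_atlas :: "('m, 'e) atlas \<Rightarrow> ('n, 'f) atlas \<Rightarrow> ('m \<times> 'n, 'e \<times> 'f) atlas" where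
  "prod_atlas A B = {(U \<times> V, map_prod \<phi> \<psi>) | U \<phi> V \<psi>. (U,\<phi>) \<in> A \<and> (V,\<psi>) \<in> B}"

text \<open>Smoothness, with respect to the given atlases, of a map on an open subset \<open>S\<close> of a manifold.\<close>

definition smooth_map_on ::
  "('m::topological_space, 'e::real_normed_vector) atlas \<Rightarrow>
   ('n::topological_space, 'f::real_normed_vector) atlas \<Rightarrow> 'm set \<Rightarrow> ('m \<Rightarrow> 'n) \<Rightarrow> bool" where
  "smooth_map_on A B S F \<longleftrightarrow>
     continuous_on S F \<and>
     (\<forall>(U,\<phi>)\<in>A. \<forall>(V,\<psi>)\<in>B. smooth_on (\<phi> ` (U \<inter> S \<inter> F -` V)) (\<psi> \<circ> F \<circ> inv_into U \<phi>))"

definition diffeomorphism_on ::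
  "('m::topological_space, 'e::real_normed_vector) atlas \<Rightarrow>
   ('n::topological_space, 'f::real_normed_vector) atlas \<Rightarrow> 'm set \<Rightarrow> 'n set \<Rightarrow> ('m \<Rightarrow> 'n) \<Rightarrow> bool"
  where
  "diffeomorphism_on A B S T F \<longleftrightarrow>
     bij_betw F S T \<and> smooth_map_on A B S F \<and> smooth_map_on B A T (inv_into S F)"

definition smooth_functions ::
  "('m::topological_space, 'e::real_normed_vector) atlas \<Rightarrow> ('m \<Rightarrow> real) set" where
  "smooth_functions A = {f. smooth_map_on A euclidean_atlas UNIV f}"


section \<open>Tangent and cotangent vectors\<close>

text \<open>A tangent vector is the velocity of a smooth curve, regarded as the functional
  \<open>f \<mapsto> (f \<circ> \<gamma>)'(0)\<close> on smooth functions (set to 0 on functions that are not smooth, so that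
  equality of tangent vectors is equality of HOL functions). A cotangent vector is a linear
  functional on the tangent space, extended by 0 outside of it. Sums and zero of vectors and
  covectors are the pointwise ones of \<^theory>\<open>HOL-Library.Function_Algebras\<close>.\<close>

type_synonym 'm tvec = "('m \<Rightarrow> real) \<Rightarrow> real"
type_synonym 'm covec = "'m tvec \<Rightarrow> real"

definition scale :: "real \<Rightarrow> ('x \<Rightarrow> real) \<Rightarrow> 'x \<Rightarrow> real" where
  "scale c v = (\<lambda>x. c * v x)"

lemma vector_space_scale: "vector_space scale"
  by unfold_locales (auto simp: scale_def fun_eq_iff algebra_simps)

definition velocity ::
  "('m::topological_space, 'e::real_normed_vector) atlas \<Rightarrow> (real \<Rightarrow> 'm) \<Rightarrow> 'm tvec" where
  "velocity A \<gamma> = (\<lambda>f. if f \<in> smooth_functions A then deriv (\<lambda>t. f (\<gamma> t)) 0 else 0)"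

definition tangent_space ::
  "('m::topological_space, 'e::real_normed_vector) atlas \<Rightarrow> 'm \<Rightarrow> 'm tvec set" where
  "tangent_space A p =
     {velocity A \<gamma> | \<gamma> \<epsilon>. \<epsilon> > 0 \<and> smooth_map_on euclidean_atlas A {-\<epsilon><..<\<epsilon>} \<gamma> \<and> \<gamma> 0 = p}"

definition linear_functional_on :: "('x \<Rightarrow> real) set \<Rightarrow> (('x \<Rightarrow> real) \<Rightarrow> real) \<Rightarrow> bool" where
  "linear_functional_on V \<xi> \<longleftrightarrow>
     (\<forall>u\<in>V. \<forall>v\<in>V. \<xi> (u + v) = \<xi> u + \<xi> v) \<and> (\<forall>c. \<forall>v\<in>V. \<xi> (scale c v) = c * \<xi> v)"

definition bilinear_form_on ::
  "('x \<Rightarrow> real) set \<Rightarrow> (('x \<Rightarrow> real) \<Rightarrow> ('x \<Rightarrow> real) \<Rightarrow> real) \<Rightarrow> bool" where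
  "bilinear_form_on V b \<longleftrightarrow>
     (\<forall>u\<in>V. linear_functional_on V (\<lambda>v. b u v)) \<and> (\<forall>v\<in>V. linear_functional_on V (\<lambda>u. b u v))"

definition cotangent_space ::
  "('m::topological_space, 'e::real_normed_vector) atlas \<Rightarrow> 'm \<Rightarrow> 'm covec set" where
  "cotangent_space A p =
     {\<xi>. linear_functional_on (tangent_space A p) \<xi> \<and> (\<forall>v. v \<notin> tangent_space A p \<longrightarrow> \<xi> v = 0)}"


section \<open>Vector fields, one-forms and tensors\<close>

type_synonym 'm vfield = "'m \<Rightarrow> 'm tvec"
type_synonym 'm form = "'m \<Rightarrow> 'm covec"

definition fscale :: "('m \<Rightarrow> real) \<Rightarrow> ('m \<Rightarrow> 'x \<Rightarrow> real) \<Rightarrow> 'm \<Rightarrow> 'x \<Rightarrow> real" where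
  "fscale f s = (\<lambda>p. scale (f p) (s p))"

definition act_on :: "'m vfield \<Rightarrow> ('m \<Rightarrow> real) \<Rightarrow> 'm \<Rightarrow> real" where
  "act_on X f = (\<lambda>p. X p f)"

definition pairing :: "'m form \<Rightarrow> 'm vfield \<Rightarrow> 'm \<Rightarrow> real" where
  "pairing \<alpha> X = (\<lambda>p. \<alpha> p (X p))"

definition eval2 :: "('m \<Rightarrow> 'x \<Rightarrow> 'x \<Rightarrow> real) \<Rightarrow> ('m \<Rightarrow> 'x) \<Rightarrow> ('m \<Rightarrow> 'x) \<Rightarrow> 'm \<Rightarrow> real" where
  "eval2 b s t = (\<lambda>p. b p (s p) (t p))"

definition vector_fields ::
  "('m::topological_space, 'e::real_normed_vector) atlas \<Rightarrow> 'm vfield set" where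
  "vector_fields A =
     {X. (\<forall>p. X p \<in> tangent_space A p) \<and> (\<forall>f\<in>smooth_functions A. act_on X f \<in> smooth_functions A)}"

definition one_forms ::
  "('m::topological_space, 'e::real_normed_vector) atlas \<Rightarrow> 'm form set" where
  "one_forms A =
     {\<alpha>. (\<forall>p. \<alpha> p \<in> cotangent_space A p) \<and> (\<forall>X\<in>vector_fields A. pairing \<alpha> X \<in> smooth_functions A)}"

definition differential ::
  "('m::topological_space, 'e::real_normed_vector) atlas \<Rightarrow> ('m \<Rightarrow> real) \<Rightarrow> 'm form" where
  "differential A f = (\<lambda>p v. if v \<in> tangent_space A p then v f else 0)"

definition symmetric_tensor ::
  "('m::topological_space, 'e::real_normed_vector) atlas \<Rightarrow>
   ('m \<Rightarrow> 'm tvec \<Rightarrow> 'm tvec \<Rightarrow> real) \<Rightarrow> bool" where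
  "symmetric_tensor A g \<longleftrightarrow>
     (\<forall>p. bilinear_form_on (tangent_space A p) (g p) \<and>
          (\<forall>u\<in>tangent_space A p. \<forall>v\<in>tangent_space A p. g p u v = g p v u)) \<and>
     (\<forall>X\<in>vector_fields A. \<forall>Y\<in>vector_fields A. eval2 g X Y \<in> smooth_functions A)"

definition bivector_field ::
  "('m::topological_space, 'e::real_normed_vector) atlas \<Rightarrow>
   ('m \<Rightarrow> 'm covec \<Rightarrow> 'm covec \<Rightarrow> real) \<Rightarrow> bool" where
  "bivector_field A P \<longleftrightarrow>
     (\<forall>p. bilinear_form_on (cotangent_space A p) (P p) \<and>
          (\<forall>\<xi>\<in>cotangent_space A p. \<forall>\<eta>\<in>cotangent_space A p. P p \<xi> \<eta> = - P p \<eta> \<xi>)) \<and>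
     (\<forall>\<alpha>\<in>one_forms A. \<forall>\<beta>\<in>one_forms A. eval2 P \<alpha> \<beta> \<in> smooth_functions A)"


section \<open>Poisson structures\<close>

definition bivector_bracket ::
  "('m::topological_space, 'e::real_normed_vector) atlas \<Rightarrow>
   ('m \<Rightarrow> 'm covec \<Rightarrow> 'm covec \<Rightarrow> real) \<Rightarrow> ('m \<Rightarrow> real) \<Rightarrow> ('m \<Rightarrow> real) \<Rightarrow> 'm \<Rightarrow> real" where
  "bivector_bracket A P f h = eval2 P (differential A f) (differential A h)"

text \<open>The Schouten--Nijenhuis bracket of multivector fields, viewed as skew-symmetric
  multiderivations of the algebra of smooth functions, is
  \<open>[P, Q] = P \<circ> Q - (-1)^((p-1)(q-1)) Q \<circ> P\<close>, where \<open>P \<circ> Q\<close> inserts \<open>Q\<close> into the first slot of \<open>P\<close>,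
  summed with signs over all \<open>(q, p-1)\<close>-shuffles of the arguments. For two bivector fields the
  sign is \<open>+\<close>, and by skew-symmetry the signed sum over the \<open>(2,1)\<close>-shuffles is a cyclic sum.\<close>

definition bivector_insertion ::
  "('m::topological_space, 'e::real_normed_vector) atlas \<Rightarrow>
   ('m \<Rightarrow> 'm covec \<Rightarrow> 'm covec \<Rightarrow> real) \<Rightarrow> ('m \<Rightarrow> 'm covec \<Rightarrow> 'm covec \<Rightarrow> real) \<Rightarrow>
   ('m \<Rightarrow> real) \<Rightarrow> ('m \<Rightarrow> real) \<Rightarrow> ('m \<Rightarrow> real) \<Rightarrow> 'm \<Rightarrow> real" where
  "bivector_insertion A P Q f1 f2 f3 =
     bivector_bracket A P (bivector_bracket A Q f1 f2) f3 +
     bivector_bracket A P (bivector_bracket A Q f2 f3) f1 +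
     bivector_bracket A P (bivector_bracket A Q f3 f1) f2"

definition schouten_bracket ::
  "('m::topological_space, 'e::real_normed_vector) atlas \<Rightarrow>
   ('m \<Rightarrow> 'm covec \<Rightarrow> 'm covec \<Rightarrow> real) \<Rightarrow> ('m \<Rightarrow> 'm covec \<Rightarrow> 'm covec \<Rightarrow> real) \<Rightarrow>
   ('m \<Rightarrow> real) \<Rightarrow> ('m \<Rightarrow> real) \<Rightarrow> ('m \<Rightarrow> real) \<Rightarrow> 'm \<Rightarrow> real" where
  "schouten_bracket A P Q f1 f2 f3 =
     bivector_insertion A P Q f1 f2 f3 + bivector_insertion A Q P f1 f2 f3"

definition poisson_structure ::
  "('m::topological_space, 'e::real_normed_vector) atlas \<Rightarrow>
   ('m \<Rightarrow> 'm covec \<Rightarrow> 'm covec \<Rightarrow> real) \<Rightarrow> bool" where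
  "poisson_structure A P \<longleftrightarrow>
     bivector_field A P \<and>
     (\<forall>f1\<in>smooth_functions A. \<forall>f2\<in>smooth_functions A. \<forall>f3\<in>smooth_functions A.
        schouten_bracket A P P f1 f2 f3 = 0)"

text \<open>\<open>P\<^sup>#\<^sub>p(\<xi>) = P\<^sub>p(\<xi>, -)\<close>, an element of the bidual, identified with the tangent vector it
  represents.\<close>

definition anchor_at ::
  "('m::topological_space, 'e::real_normed_vector) atlas \<Rightarrow>
   ('m \<Rightarrow> 'm covec \<Rightarrow> 'm covec \<Rightarrow> real) \<Rightarrow> 'm \<Rightarrow> 'm covec \<Rightarrow> 'm tvec" where
  "anchor_at A P p \<xi> =
     (THE v. v \<in> tangent_space A p \<and> (\<forall>\<eta>\<in>cotangent_space A p. \<eta> v = P p \<xi> \<eta>))"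

definition anchor ::
  "('m::topological_space, 'e::real_normed_vector) atlas \<Rightarrow>
   ('m \<Rightarrow> 'm covec \<Rightarrow> 'm covec \<Rightarrow> real) \<Rightarrow> 'm form \<Rightarrow> 'm vfield" where
  "anchor A P \<alpha> = (\<lambda>p. anchor_at A P p (\<alpha> p))"

definition anchor_image ::
  "('m::topological_space, 'e::real_normed_vector) atlas \<Rightarrow>
   ('m \<Rightarrow> 'm covec \<Rightarrow> 'm covec \<Rightarrow> real) \<Rightarrow> 'm \<Rightarrow> 'm tvec set" where
  "anchor_image A P p = anchor_at A P p ` cotangent_space A p"

definition anchor_rank ::
  "('m::topological_space, 'e::real_normed_vector) atlas \<Rightarrow>
   ('m \<Rightarrow> 'm covec \<Rightarrow> 'm covec \<Rightarrow> real) \<Rightarrow> 'm \<Rightarrow> nat" where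
  "anchor_rank A P p = vector_space.dim scale (anchor_image A P p)"


section \<open>Principal \<open>\<real>\<close>-bundles\<close>

definition principal_R_bundle ::
  "('m::{t2_space,second_countable_topology}, 'e::real_normed_vector) atlas \<Rightarrow>
   ('b::{t2_space,second_countable_topology}, 'f::real_normed_vector) atlas \<Rightarrow>
   ('m \<Rightarrow> 'b) \<Rightarrow> (real \<Rightarrow> 'm \<Rightarrow> 'm) \<Rightarrow> bool" where
  "principal_R_bundle A B \<pi> act \<longleftrightarrow>
     smooth_manifold A \<and> smooth_manifold B \<and>
     smooth_map_on A B UNIV \<pi> \<and>
     smooth_map_on (prod_atlas euclidean_atlas A) A UNIV (\<lambda>(t, x). act t x) \<and>
     (\<forall>x. act 0 x = x) \<and> (\<forall>s t x. act (s + t) x = act s (act t x)) \<and>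
     (\<forall>t x. \<pi> (act t x) = \<pi> x) \<and>
     (\<forall>b. \<exists>W h. open W \<and> b \<in> W \<and>
        diffeomorphism_on A (prod_atlas B euclidean_atlas) (\<pi> -` W) (W \<times> UNIV) (\<lambda>x. (\<pi> x, h x)) \<and>
        (\<forall>x\<in>\<pi> -` W. \<forall>t. h (act t x) = h x + (t::real)))"

definition pushforward ::
  "('n::topological_space, 'f::real_normed_vector) atlas \<Rightarrow> ('m \<Rightarrow> 'n) \<Rightarrow> 'm tvec \<Rightarrow> 'n tvec" where
  "pushforward B F v = (\<lambda>h. if h \<in> smooth_functions B then v (h \<circ> F) else 0)"

definition vertical_space ::
  "('m::topological_space, 'e::real_normed_vector) atlas \<Rightarrow>
   ('b::topological_space, 'f::real_normed_vector) atlas \<Rightarrow> ('m \<Rightarrow> 'b) \<Rightarrow> 'm \<Rightarrow> 'm tvec set" where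
  "vertical_space A B \<pi> p = {v \<in> tangent_space A p. pushforward B \<pi> v = 0}"

definition vertical_vector_fields ::
  "('m::topological_space, 'e::real_normed_vector) atlas \<Rightarrow>
   ('b::topological_space, 'f::real_normed_vector) atlas \<Rightarrow> ('m \<Rightarrow> 'b) \<Rightarrow> 'm vfield set" where
  "vertical_vector_fields A B \<pi> = {X \<in> vector_fields A. \<forall>p. X p \<in> vertical_space A B \<pi> p}"

definition fundamental_vector_field ::
  "('m::topological_space, 'e::real_normed_vector) atlas \<Rightarrow> (real \<Rightarrow> 'm \<Rightarrow> 'm) \<Rightarrow> 'm vfield" where
  "fundamental_vector_field A act = (\<lambda>p. velocity A (\<lambda>t. act t p))"


section \<open>Carrollian and Carrollian--Poisson bundles\<close>

definition metric_kernel ::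
  "('m::topological_space, 'e::real_normed_vector) atlas \<Rightarrow>
   ('m \<Rightarrow> 'm tvec \<Rightarrow> 'm tvec \<Rightarrow> real) \<Rightarrow> 'm vfield set" where
  "metric_kernel A g = {X \<in> vector_fields A. \<forall>Y\<in>vector_fields A. eval2 g X Y = 0}"

definition metric_kernel_at ::
  "('m::topological_space, 'e::real_normed_vector) atlas \<Rightarrow>
   ('m \<Rightarrow> 'm tvec \<Rightarrow> 'm tvec \<Rightarrow> real) \<Rightarrow> 'm \<Rightarrow> 'm tvec set" where
  "metric_kernel_at A g p = {u \<in> tangent_space A p. \<forall>v\<in>tangent_space A p. g p u v = 0}"

text \<open>An Ehresmann connection on a bundle whose vertical bundle is framed by the Carroll vector
  field \<open>\<kappa>\<close> amounts to a one-form \<open>\<tau>\<close> with \<open>\<tau>(\<kappa>) = 1\<close>; the splitting of the tangent bundle into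
  \<open>ker d\<pi>\<close> and \<open>ker \<tau>\<close> is then automatic.\<close>

locale carrollian_bundle =
  fixes A :: "('m::{t2_space,second_countable_topology}, 'e::euclidean_space) atlas"
    and B :: "('b::{t2_space,second_countable_topology}, 'f::real_normed_vector) atlas"
    and \<pi> :: "'m \<Rightarrow> 'b"
    and act :: "real \<Rightarrow> 'm \<Rightarrow> 'm"
    and g :: "'m \<Rightarrow> 'm tvec \<Rightarrow> 'm tvec \<Rightarrow> real"
    and \<tau> :: "'m form"
  assumes principal_bundle: "principal_R_bundle A B \<pi> act"
    and metric: "symmetric_tensor A g"
    and metric_ker: "metric_kernel A g = vertical_vector_fields A B \<pi>"
    and clock: "\<tau> \<in> one_forms A"
    and clock_normalised: "pairing \<tau> (fundamental_vector_field A act) = 1"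
    and metric_pos: "\<And>p v. v \<in> tangent_space A p \<Longrightarrow> \<tau> p v = 0 \<Longrightarrow> v \<noteq> 0 \<Longrightarrow> g p v v > 0"

locale carrollian_poisson_bundle = carrollian_bundle A B \<pi> act g \<tau>
  for A :: "('m::{t2_space,second_countable_topology}, 'e::euclidean_space) atlas"
    and B :: "('b::{t2_space,second_countable_topology}, 'f::real_normed_vector) atlas"
    and \<pi> act g \<tau> +
  fixes P :: "'m \<Rightarrow> 'm covec \<Rightarrow> 'm covec \<Rightarrow> real"
  assumes poisson: "poisson_structure A P"
    and kernel_in_image:
      "\<And>p. anchor_rank A P p \<noteq> 0 \<Longrightarrow> metric_kernel_at A g p \<subseteq> anchor_image A P p"


section \<open>Vaisman connections\<close>

definition vaisman_connection ::
  "('m::topological_space, 'e::real_normed_vector) atlas \<Rightarrow>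
   ('m \<Rightarrow> 'm covec \<Rightarrow> 'm covec \<Rightarrow> real) \<Rightarrow> ('m form \<Rightarrow> 'm form \<Rightarrow> 'm form) \<Rightarrow> bool" where
  "vaisman_connection A P D \<longleftrightarrow>
     (\<forall>\<alpha>\<in>one_forms A. \<forall>\<beta>\<in>one_forms A. D \<alpha> \<beta> \<in> one_forms A) \<and>
     (\<forall>\<alpha>\<in>one_forms A. \<forall>\<alpha>'\<in>one_forms A. \<forall>\<beta>\<in>one_forms A. D (\<alpha> + \<alpha>') \<beta> = D \<alpha> \<beta> + D \<alpha>' \<beta>) \<and>
     (\<forall>\<alpha>\<in>one_forms A. \<forall>\<beta>\<in>one_forms A. \<forall>\<beta>'\<in>one_forms A. D \<alpha> (\<beta> + \<beta>') = D \<alpha> \<beta> + D \<alpha> \<beta>') \<and>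
     (\<forall>c. \<forall>\<alpha>\<in>one_forms A. \<forall>\<beta>\<in>one_forms A.
        D (fscale (\<lambda>_. c) \<alpha>) \<beta> = fscale (\<lambda>_. c) (D \<alpha> \<beta>) \<and>
        D \<alpha> (fscale (\<lambda>_. c) \<beta>) = fscale (\<lambda>_. c) (D \<alpha> \<beta>)) \<and>
     (\<forall>f\<in>smooth_functions A. \<forall>\<alpha>\<in>one_forms A. \<forall>\<beta>\<in>one_forms A.
        D (fscale f \<alpha>) \<beta> = fscale f (D \<alpha> \<beta>) \<and>
        D \<alpha> (fscale f \<beta>) = fscale (act_on (anchor A P \<alpha>) f) \<beta> + fscale f (D \<alpha> \<beta>))"

text \<open>\<open>D\<^sub>\<alpha>X\<close> is the vector field determined by its pairings with all one-forms.\<close>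

definition vaisman_on_vfield ::
  "('m::topological_space, 'e::real_normed_vector) atlas \<Rightarrow>
   ('m \<Rightarrow> 'm covec \<Rightarrow> 'm covec \<Rightarrow> real) \<Rightarrow> ('m form \<Rightarrow> 'm form \<Rightarrow> 'm form) \<Rightarrow>
   'm form \<Rightarrow> 'm vfield \<Rightarrow> 'm vfield" where
  "vaisman_on_vfield A P D \<alpha> X =
     (THE Y. Y \<in> vector_fields A \<and>
        (\<forall>\<beta>\<in>one_forms A.
           pairing \<beta> Y = act_on (anchor A P \<alpha>) (pairing \<beta> X) - pairing (D \<alpha> \<beta>) X))"

definition vaisman_on_metric ::
  "('m::topological_space, 'e::real_normed_vector) atlas \<Rightarrow>
   ('m \<Rightarrow> 'm covec \<Rightarrow> 'm covec \<Rightarrow> real) \<Rightarrow> ('m form \<Rightarrow> 'm form \<Rightarrow> 'm form) \<Rightarrow>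
   'm form \<Rightarrow> ('m \<Rightarrow> 'm tvec \<Rightarrow> 'm tvec \<Rightarrow> real) \<Rightarrow> 'm vfield \<Rightarrow> 'm vfield \<Rightarrow> 'm \<Rightarrow> real" where
  "vaisman_on_metric A P D \<alpha> g X Y =
     act_on (anchor A P \<alpha>) (eval2 g X Y)
     - eval2 g (vaisman_on_vfield A P D \<alpha> X) Y - eval2 g X (vaisman_on_vfield A P D \<alpha> Y)"

definition metric_compatible ::
  "('m::topological_space, 'e::real_normed_vector) atlas \<Rightarrow>
   ('m \<Rightarrow> 'm covec \<Rightarrow> 'm covec \<Rightarrow> real) \<Rightarrow> ('m \<Rightarrow> 'm tvec \<Rightarrow> 'm tvec \<Rightarrow> real) \<Rightarrow>
   ('m form \<Rightarrow> 'm form \<Rightarrow> 'm form) \<Rightarrow> bool" where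
  "metric_compatible A P g D \<longleftrightarrow>
     (\<forall>\<alpha>\<in>one_forms A. \<forall>X\<in>vector_fields A. \<forall>Y\<in>vector_fields A.
        vaisman_on_metric A P D \<alpha> g X Y = 0)"

definition clock_compatible ::
  "('m::topological_space, 'e::real_normed_vector) atlas \<Rightarrow> 'm form \<Rightarrow>
   ('m form \<Rightarrow> 'm form \<Rightarrow> 'm form) \<Rightarrow> bool" where
  "clock_compatible A \<tau> D \<longleftrightarrow> (\<forall>\<alpha>\<in>one_forms A. D \<alpha> \<tau> = 0)"

end

theory Submission
  imports Defs
begin

text \<open>The connection comes from a frame. Suppose that \<open>e i\<close> are horizontal vector fields, locally only
  finitely many of them nonzero, with \<open>v = \<Sum> g(e i, v) e i + \<tau>(v) \<kappa>\<close> for every tangent vector \<open>v\<close>. Such a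
  Parseval frame may be linearly dependent, and for this reason it can be global, which an orthonormal frame
  in general cannot. Define

    \<open>D\<^sub>\<alpha>\<beta> = \<Sum> P\<^sup>#(\<alpha>)(\<beta>(e i)) g(e i, -) + P\<^sup>#(\<alpha>)(\<beta>(\<kappa>)) \<tau>\<close>.

  The Leibniz rule is the expansion of \<open>\<beta>\<close> in the frame (\<open>frame_connection_leibniz\<close>). The components of
  \<open>\<tau>\<close> are the constants 0 and 1, so \<open>D\<^sub>\<alpha>\<tau> = 0\<close> (\<open>frame_connection_clock\<close>). On vector fields,
  \<open>D\<^sub>\<alpha>Z = \<Sum> P\<^sup>#(\<alpha>)(g(e i, Z)) e i + P\<^sup>#(\<alpha>)(\<tau>(Z)) \<kappa>\<close>; since \<open>\<kappa>\<close> is in the kernel of \<open>g\<close>, metric compatibility is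
  the product rule for \<open>g(Y, Z) = \<Sum> g(e i, Y) g(e i, Z)\<close> (\<open>frame_connection_metric\<close>).

  The frame is found in three steps. Gram-Schmidt for the Riemannian metric \<open>g + \<tau>\<^sup>2\<close> produces
  orthonormal fields near each point (\<open>gram_schmidt\<close>). They are glued by cut-off functions whose squares
  add up to 1; a Parseval identity survives this, orthonormality does not (\<open>parseval_frame\<close>). Finally the
  fields are projected along \<open>\<kappa>\<close> to the horizontal spaces (\<open>carroll_frame\<close>). The bundle enters through the
  fact that the fundamental field \<open>\<kappa>\<close> is smooth and vertical, and hence is annihilated by \<open>g\<close>
  (\<open>metric_carroll_field\<close>).\<close>

section \<open>Calculus of maps of class \<open>C\<^sup>k\<close>\<close>

lemma Ck_on_subset: "Ck_on k S f \<Longrightarrow> T \<subseteq> S \<Longrightarrow> Ck_on k T f"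
  by (induction k arbitrary: f) (auto intro: continuous_on_subset)

text \<open>Openness matters: the derivatives in \<open>Ck_on\<close> are taken in the whole space, so equality on
  \<open>S\<close> passes to them only because \<open>S\<close> is a neighbourhood of each of its points.\<close>

lemma Ck_on_cong:
  assumes "open S" "\<And>x. x \<in> S \<Longrightarrow> f x = f' x" "Ck_on k S f"
  shows "Ck_on k S f'"
  using assms(2,3)
proof (induction k arbitrary: f f')
  case 0
  then show ?case by (auto cong: continuous_on_cong)
next
  case (Suc k)
  have D: "(f' has_derivative frechet_derivative f (at x)) (at x)" if "x \<in> S" for x
  proof -
    have "(f has_derivative frechet_derivative f (at x)) (at x)"
      using Suc.prems(2) that by (simp add: frechet_derivative_works)
    then show ?thesis
      using has_derivative_transform_within_open[OF _ assms(1) that] Suc.prems(1) by blast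
  qed
  have "Ck_on k S (\<lambda>x. frechet_derivative f' (at x) v)" for v
  proof (rule Suc.IH)
    show "frechet_derivative f (at x) v = frechet_derivative f' (at x) v" if "x \<in> S" for x
      using frechet_derivative_at[OF D[OF that]] by simp
    show "Ck_on k S (\<lambda>x. frechet_derivative f (at x) v)"
      using Suc.prems(2) by simp
  qed
  moreover have "f' differentiable (at x)" if "x \<in> S" for x
    using D[OF that] by (auto simp: differentiable_def)
  ultimately show ?case by simp
qed

lemma Ck_on_local:
  assumes "\<And>x. x \<in> S \<Longrightarrow> \<exists>T. open T \<and> x \<in> T \<and> Ck_on k T f"
  shows "Ck_on k S f"
  using assms
proof (induction k arbitrary: f)
  case 0
  then show ?case
    by (simp add: continuous_on_eq_continuous_within)
      (meson continuous_at_imp_continuous_within continuous_on_eq_continuous_at continuous_on_eq_continuous_within)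
next
  case (Suc k)
  have "Ck_on k S (\<lambda>x. frechet_derivative f (at x) v)" for v
    by (rule Suc.IH) (use Suc.prems in fastforce)
  moreover have "f differentiable (at x)" if "x \<in> S" for x
    using Suc.prems[OF that] by auto
  ultimately show ?case by simp
qed

text \<open>Any explicit formula \<open>F\<close> for the derivative can replace the choice operator in
  \<open>frechet_derivative\<close>.\<close>

lemma Ck_on_SucI:
  assumes "open S" "\<And>x. x \<in> S \<Longrightarrow> (f has_derivative F x) (at x)"
    "\<And>v. Ck_on k S (\<lambda>x. F x v)"
  shows "Ck_on (Suc k) S f"
proof -
  have "Ck_on k S (\<lambda>x. frechet_derivative f (at x) v)" for v
    by (rule Ck_on_cong[OF assms(1) _ assms(3)]) (simp add: frechet_derivative_at[OF assms(2), symmetric])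
  then show ?thesis
    using assms(2) by (auto simp: differentiable_def)
qed

lemma Ck_on_SucD:
  assumes "Ck_on (Suc k) S f" "x \<in> S"
  shows "(f has_derivative frechet_derivative f (at x)) (at x)"
  using assms by (simp add: frechet_derivative_works)

lemma Ck_on_Suc_imp: "Ck_on (Suc k) S f \<Longrightarrow> Ck_on k S f"
proof (induction k arbitrary: f)
  case 0
  then show ?case
    by (simp add: continuous_at_imp_continuous_on differentiable_imp_continuous_within)
next
  case (Suc k)
  then show ?case by (metis Ck_on.simps(2))
qed

lemma Ck_on_const: "open S \<Longrightarrow> Ck_on k S (\<lambda>x. c)"
proof (induction k arbitrary: c)
  case (Suc k)
  show ?case
    by (rule Ck_on_SucI[where F = "\<lambda>x v. 0"]) (use Suc in auto)
qed simp

lemma Ck_on_bounded_linear: "open S \<Longrightarrow> bounded_linear L \<Longrightarrow> Ck_on k S L"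
proof (cases k)
  case (Suc n)
  assume "open S" "bounded_linear L"
  then show ?thesis unfolding Suc
    by (intro Ck_on_SucI[where F = "\<lambda>x v. L v"] Ck_on_const bounded_linear_imp_has_derivative)
qed (simp add: linear_continuous_on)

lemma Ck_on_add:
  assumes "open S" "Ck_on k S f" "Ck_on k S f'"
  shows "Ck_on k S (\<lambda>x. f x + f' x)"
  using assms(2,3)
proof (induction k arbitrary: f f')
  case (Suc k)
  show ?case
    by (rule Ck_on_SucI[where F = "\<lambda>x v. frechet_derivative f (at x) v + frechet_derivative f' (at x) v"])
      (use assms(1) Suc in \<open>auto intro!: has_derivative_add Ck_on_SucD\<close>)
qed (auto intro: continuous_on_add)

lemma Ck_on_sum:
  assumes "open S" "\<And>i. i \<in> I \<Longrightarrow> Ck_on k S (f i)"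
  shows "Ck_on k S (\<lambda>x. \<Sum>i\<in>I. f i x)"
  using assms(2) by (induction I rule: infinite_finite_induct) (auto intro!: Ck_on_const Ck_on_add assms(1))

lemma Ck_on_bilinear:
  assumes "bounded_bilinear m" "open S" "Ck_on k S f" "Ck_on k S f'"
  shows "Ck_on k S (\<lambda>x. m (f x) (f' x))"
  using assms(3,4)
proof (induction k arbitrary: f f')
  case 0
  then show ?case using bounded_bilinear.continuous_on[OF assms(1)] by simp
next
  case (Suc k)
  let ?F = "\<lambda>x v. m (f x) (frechet_derivative f' (at x) v) + m (frechet_derivative f (at x) v) (f' x)"
  show ?case
  proof (rule Ck_on_SucI[where F = ?F])
    show "((\<lambda>x. m (f x) (f' x)) has_derivative ?F x) (at x)" if "x \<in> S" for x
      by (rule bounded_bilinear.FDERIV[OF assms(1) Ck_on_SucD[OF Suc.prems(1) that] Ck_on_SucD[OF Suc.prems(2) that]])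
    show "Ck_on k S (\<lambda>x. ?F x v)" for v
      by (rule Ck_on_add[OF assms(2) Suc.IH[OF Ck_on_Suc_imp[OF Suc.prems(1)]]
            Suc.IH[OF _ Ck_on_Suc_imp[OF Suc.prems(2)]]])
        (use Suc.prems in simp_all)
  qed (rule assms(2))
qed

text \<open>The chain rule differentiates \<open>h\<close> in a direction that depends on the point; expanding that
  direction in a basis turns the derivative into a sum of products of maps of class \<open>C\<^sup>k\<close>.\<close>

lemma Ck_on_compose:
  fixes f :: "'a::real_normed_vector \<Rightarrow> 'b::euclidean_space"
  assumes "open S" "open T" "Ck_on k S f" "Ck_on k T h" "f ` S \<subseteq> T"
  shows "Ck_on k S (\<lambda>x. h (f x))"
  using assms(3,4)
proof (induction k arbitrary: h)
  case 0
  then show ?case using continuous_on_compose2 assms(5) by auto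
next
  case (Suc k)
  let ?F = "\<lambda>x v. frechet_derivative h (at (f x)) (frechet_derivative f (at x) v)"
  show ?case
  proof (rule Ck_on_SucI[where F = ?F])
    show "((\<lambda>x. h (f x)) has_derivative ?F x) (at x)" if "x \<in> S" for x
      by (rule has_derivative_compose[OF Ck_on_SucD[OF Suc.prems(1) that] Ck_on_SucD[OF Suc.prems(2)]])
        (use that assms(5) in auto)
    have exp: "(\<Sum>b\<in>Basis. (frechet_derivative f (at x) v \<bullet> b) *\<^sub>R frechet_derivative h (at (f x)) b) = ?F x v"
      if "x \<in> S" for x v
    proof -
      have "linear (frechet_derivative h (at (f x)))"
        using Ck_on_SucD[OF Suc.prems(2)] that assms(5) has_derivative_linear by blast
      then show ?thesis
        by (subst (2) euclidean_representation[symmetric]) (simp add: linear_sum linear_scale)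
    qed
    have "Ck_on k S (\<lambda>x. \<Sum>b\<in>Basis. (frechet_derivative f (at x) v \<bullet> b) *\<^sub>R frechet_derivative h (at (f x)) b)" for v
    proof (intro Ck_on_sum assms(1) Ck_on_bilinear[OF bounded_bilinear_scaleR])
      fix b
      show "Ck_on k S (\<lambda>x. frechet_derivative f (at x) v \<bullet> b)"
        by (rule Ck_on_bilinear[OF bounded_bilinear_inner assms(1)])
          (use Suc.prems(1) Ck_on_const[OF assms(1)] in auto)
      show "Ck_on k S (\<lambda>x. frechet_derivative h (at (f x)) b)"
        by (rule Suc.IH[OF Ck_on_Suc_imp[OF Suc.prems(1)]]) (use Suc.prems(2) in simp)
    qed
    from Ck_on_cong[OF assms(1) _ this] exp show "Ck_on k S (\<lambda>x. ?F x v)" for v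
      by simp
  qed (rule assms(1))
qed

lemma smooth_on_subset: "smooth_on S f \<Longrightarrow> T \<subseteq> S \<Longrightarrow> smooth_on T f"
  unfolding smooth_on_def by (rule allI, rule Ck_on_subset, erule spec)

lemma smooth_on_cong:
  assumes "open S" "\<And>x. x \<in> S \<Longrightarrow> f x = f' x" "smooth_on S f"
  shows "smooth_on S f'"
  unfolding smooth_on_def
proof
  show "Ck_on k S f'" for k
    by (rule Ck_on_cong[of S f]) (use assms in \<open>auto simp: smooth_on_def\<close>)
qed

lemma smooth_on_local:
  assumes "\<And>x. x \<in> S \<Longrightarrow> \<exists>T. open T \<and> x \<in> T \<and> smooth_on T f"
  shows "smooth_on S f"
  unfolding smooth_on_def
proof
  show "Ck_on k S f" for k
    by (rule Ck_on_local) (use assms in \<open>unfold smooth_on_def, blast\<close>)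
qed

lemma smooth_on_const: "open S \<Longrightarrow> smooth_on S (\<lambda>x. c)"
  by (simp add: smooth_on_def Ck_on_const)

lemma smooth_on_bounded_linear: "open S \<Longrightarrow> bounded_linear L \<Longrightarrow> smooth_on S L"
  by (simp add: smooth_on_def Ck_on_bounded_linear)

lemma smooth_on_add: "open S \<Longrightarrow> smooth_on S f \<Longrightarrow> smooth_on S f' \<Longrightarrow> smooth_on S (\<lambda>x. f x + f' x)"
  by (simp add: smooth_on_def Ck_on_add)

lemma smooth_on_bilinear:
  "bounded_bilinear m \<Longrightarrow> open S \<Longrightarrow> smooth_on S f \<Longrightarrow> smooth_on S f' \<Longrightarrow>
    smooth_on S (\<lambda>x. m (f x) (f' x))"
  by (simp add: smooth_on_def Ck_on_bilinear)

lemmas smooth_on_mult = smooth_on_bilinear[OF bounded_bilinear_mult]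

lemma smooth_on_compose:
  fixes f :: "'a::real_normed_vector \<Rightarrow> 'b::euclidean_space"
  assumes "open S" "open T" "smooth_on S f" "smooth_on T h" "f ` S \<subseteq> T"
  shows "smooth_on S (\<lambda>x. h (f x))"
  unfolding smooth_on_def
proof
  show "Ck_on k S (\<lambda>x. h (f x))" for k
    by (rule Ck_on_compose[OF assms(1,2) _ _ assms(5)]) (use assms(3,4) in \<open>auto simp: smooth_on_def\<close>)
qed

lemma smooth_on_has_derivative:
  assumes "smooth_on S f" "x \<in> S"
  shows "(f has_derivative frechet_derivative f (at x)) (at x)"
proof (rule Ck_on_SucD)
  show "Ck_on (Suc 0) S f" using assms(1) unfolding smooth_on_def by (rule spec)
qed fact

lemma smooth_on_frechet_derivative:
  assumes "smooth_on S f"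
  shows "smooth_on S (\<lambda>x. frechet_derivative f (at x) v)"
  unfolding smooth_on_def
proof
  fix k
  have "Ck_on (Suc k) S f" using assms unfolding smooth_on_def by (rule spec)
  then show "Ck_on k S (\<lambda>x. frechet_derivative f (at x) v)" by simp
qed

lemma smooth_on_continuous_on: "smooth_on S f \<Longrightarrow> continuous_on S f"
  using Ck_on.simps(1) unfolding smooth_on_def by metis

lemma Ck_on_SucI_real:
  fixes f :: "real \<Rightarrow> real"
  assumes "open S" "\<And>x. x \<in> S \<Longrightarrow> (f has_real_derivative f' x) (at x)" "Ck_on k S f'"
  shows "Ck_on (Suc k) S f"
proof (rule Ck_on_SucI[where F = "\<lambda>x v. f' x * v"])
  show "(f has_derivative (\<lambda>v. f' x * v)) (at x)" if "x \<in> S" for x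
    using assms(2)[OF that] by (simp add: has_field_derivative_def)
  show "Ck_on k S (\<lambda>x. f' x * v)" for v
    by (intro Ck_on_bilinear[OF bounded_bilinear_mult] assms Ck_on_const)
qed (rule assms(1))

text \<open>The derivative of a power is a multiple of another power, so the induction on the order runs over
  all exponents at once.\<close>

lemma smooth_on_powr: "smooth_on {0<..} (\<lambda>x::real. x powr a)"
proof -
  have "Ck_on k {0<..} (\<lambda>x::real. x powr a)" for k
  proof (induction k arbitrary: a)
    case 0
    then show ?case by (auto intro!: continuous_intros)
  next
    case (Suc k)
    show ?case
    proof (rule Ck_on_SucI_real)
      show "((\<lambda>x::real. x powr a) has_real_derivative a * x powr (a - 1)) (at x)" if "x \<in> {0<..}" for x
        using that by (auto intro!: derivative_eq_intros)
      show "Ck_on k {0<..} (\<lambda>x::real. a * x powr (a - 1))"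
        by (intro Ck_on_bilinear[OF bounded_bilinear_mult] Ck_on_const Suc) auto
    qed auto
  qed
  then show ?thesis by (simp add: smooth_on_def)
qed

lemma powr_minus_half_squared:
  fixes y :: real
  assumes "0 < y"
  shows "(y powr (-1/2)) ^ 2 * y = 1"
proof -
  have "(y powr (-1/2)) ^ 2 = y powr (-1)"
    unfolding power2_eq_square powr_add[symmetric] by simp
  then show ?thesis
    using assms by (simp add: powr_minus)
qed

section \<open>Cut-off functions on the real line\<close>

text \<open>The flat functions \<open>x\<^sup>-\<^sup>n exp (-1/x)\<close>, extended by zero: the derivative of
  each one is a combination of others, which gives smoothness for all of them at once.\<close>

definition flat :: "nat \<Rightarrow> real \<Rightarrow> real" where
  "flat n x = (if 0 < x then exp (- 1 / x) / x ^ n else 0)"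

text \<open>Differentiability at the origin: for positive \<open>x\<close> and \<open>y = 1/x\<close>, the quotient is \<open>y ^ (n + 1) / exp y\<close>, which tends to 0
  as \<open>y\<close> tends to infinity.\<close>

lemma flat_quotient_tendsto_0: "((\<lambda>x. flat n x / x) \<longlongrightarrow> 0) (at 0)"
proof -
  have R: "((\<lambda>x::real. exp (- 1 / x) / x ^ n / x) \<longlongrightarrow> 0) (at_right 0)"
  proof -
    have "((\<lambda>y::real. y ^ Suc n / exp y) \<longlongrightarrow> 0) at_top"
      by (rule tendsto_power_div_exp_0)
    then have "((\<lambda>x::real. inverse x ^ Suc n / exp (inverse x)) \<longlongrightarrow> 0) (at_right 0)"
      using filterlim_inverse_at_top_right filterlim_compose by blast
    then show ?thesis
      by (simp add: exp_minus field_simps)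
  qed
  have "((\<lambda>x. flat n x / x) \<longlongrightarrow> 0) (at_right 0)"
    by (rule Lim_transform_eventually[OF R])
      (auto simp: flat_def eventually_at_right_less intro: eventually_mono[OF eventually_at_right_less])
  moreover have "((\<lambda>x. flat n x / x) \<longlongrightarrow> 0) (at_left 0)"
    by (rule Lim_transform_eventually[OF tendsto_const])
      (auto simp: flat_def eventually_at_filter)
  ultimately show ?thesis
    by (simp add: filterlim_split_at)
qed

lemma flat_has_derivative:
  "(flat n has_real_derivative flat (n + 2) x - real n * flat (Suc n) x) (at x)"
proof -
  consider "x > 0" | "x < 0" | "x = 0" by linarith
  then show ?thesis
  proof cases
    case 1
    have "((\<lambda>x. exp (- 1 / x) / x ^ n) has_real_derivative
        (exp (- 1 / x) * (1 / x\<^sup>2) * x ^ n - exp (- 1 / x) * (real n * x ^ (n - 1))) / (x ^ n * x ^ n)) (at x)"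
      using 1 by (auto intro!: derivative_eq_intros simp: power2_eq_square)
    also have "(exp (- 1 / x) * (1 / x\<^sup>2) * x ^ n - exp (- 1 / x) * (real n * x ^ (n - 1))) / (x ^ n * x ^ n)
        = flat (n + 2) x - real n * flat (Suc n) x"
      using 1 by (cases n) (simp_all add: flat_def field_simps power2_eq_square)
    finally have "((\<lambda>x. exp (- 1 / x) / x ^ n) has_real_derivative
        flat (n + 2) x - real n * flat (Suc n) x) (at x)" .
    then show ?thesis
      by (rule has_field_derivative_transform_within_open[where S = "{0<..}"]) (use 1 in \<open>auto simp: flat_def\<close>)
  next
    case 2
    have "((\<lambda>x. 0) has_real_derivative flat (n + 2) x - real n * flat (Suc n) x) (at x)"
      using 2 by (simp add: flat_def)
    then show ?thesis
      by (rule has_field_derivative_transform_within_open[where S = "{..<0}"]) (use 2 in \<open>auto simp: flat_def\<close>)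
  next
    case 3
    then show ?thesis
      using flat_quotient_tendsto_0[of n] by (simp add: has_field_derivative_iff flat_def)
  qed
qed

lemma smooth_on_flat: "smooth_on UNIV (flat n)"
proof -
  have "Ck_on k UNIV (flat n)" for k
  proof (induction k arbitrary: n)
    case 0
    have "isCont (flat n) x" for x
      by (rule DERIV_isCont[OF flat_has_derivative])
    then show ?case
      by (auto intro: continuous_at_imp_continuous_on)
  next
    case (Suc k)
    have "Ck_on k UNIV (\<lambda>x. flat (n + 2) x + (- real n) * flat (Suc n) x)"
      by (intro Ck_on_add Ck_on_bilinear[OF bounded_bilinear_mult] Ck_on_const Suc) auto
    then show ?case
      by (intro Ck_on_SucI_real[OF _ flat_has_derivative]) auto
  qed
  then show ?thesis by (simp add: smooth_on_def)
qed

text \<open>Normalising \<open>(exp (-1/x), exp (-1/(1-x)))\<close> to length one gives a smooth path on the unit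
  circle that is constant for \<open>x \<le> 0\<close> and for \<open>x \<ge> 1\<close>. Cut-offs with \<open>u\<^sup>2 + w\<^sup>2 = 1\<close> are what a
  partition of unity by squares is built from.\<close>

lemma smooth_circle_cutoff:
  obtains u w :: "real \<Rightarrow> real" where "smooth_on UNIV u" "smooth_on UNIV w"
    "\<And>x. u x ^ 2 + w x ^ 2 = 1" "\<And>x. x \<le> 0 \<Longrightarrow> u x = 0" "\<And>x. x \<le> 0 \<Longrightarrow> w x = 1" "\<And>x. x \<ge> 1 \<Longrightarrow> w x = 0"
proof -
  let ?F = "flat 0" and ?G = "\<lambda>x. flat 0 (1 + (-1) * x)"
  let ?N = "\<lambda>x. ?F x * ?F x + ?G x * ?G x"
  have G: "smooth_on UNIV ?G"
    by (rule smooth_on_compose[OF _ _ _ smooth_on_flat], rule open_UNIV, rule open_UNIV,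
      rule smooth_on_add[OF _ smooth_on_const smooth_on_mult[OF _ smooth_on_const smooth_on_bounded_linear]])
      auto
  have "?N x > 0" for x
    by (cases "x > 0") (auto simp: flat_def add_pos_nonneg add_nonneg_pos)
  note pos = this
  have F2: "smooth_on UNIV (\<lambda>x. ?F x * ?F x)"
    by (rule smooth_on_mult[OF open_UNIV smooth_on_flat smooth_on_flat])
  have G2: "smooth_on UNIV (\<lambda>x. ?G x * ?G x)"
    by (rule smooth_on_mult[OF open_UNIV G G])
  have N1: "smooth_on UNIV ?N"
    by (rule smooth_on_add[OF open_UNIV F2 G2])
  have N: "smooth_on UNIV (\<lambda>x. ?N x powr (-1/2))"
    by (rule smooth_on_compose[OF open_UNIV open_greaterThan N1 smooth_on_powr]) (use pos in auto)
  have N2: "(?N x powr (-1/2)) ^ 2 * ?N x = 1" for x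
    by (rule powr_minus_half_squared[OF pos])
  show thesis
  proof
    show "smooth_on UNIV (\<lambda>x. ?F x * ?N x powr (-1/2))" "smooth_on UNIV (\<lambda>x. ?G x * ?N x powr (-1/2))"
      by (rule smooth_on_mult[OF open_UNIV smooth_on_flat N], rule smooth_on_mult[OF open_UNIV G N])
    show "(?F x * ?N x powr (-1/2))\<^sup>2 + (?G x * ?N x powr (-1/2))\<^sup>2 = 1" for x
      using N2[of x] by (simp add: power_mult_distrib algebra_simps power2_eq_square)
    show "?G x * ?N x powr (-1/2) = 1" if "x \<le> 0" for x
    proof -
      have "(?G x * ?N x powr (-1/2)) ^ 2 = 1"
        using N2[of x] that by (simp add: flat_def power_mult_distrib power2_eq_square mult_ac)
      moreover have "0 \<le> ?G x * ?N x powr (-1/2)"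
        by (simp add: flat_def)
      ultimately show ?thesis
        by (simp add: power2_eq_1_iff)
    qed
  qed (auto simp: flat_def)
qed

section \<open>Smooth functions on a manifold\<close>

locale manifold =
  fixes A :: "('m::{t2_space,second_countable_topology}, 'e::euclidean_space) atlas"
  assumes smooth_manifold: "smooth_manifold A"
begin

lemma chart_at: obtains U \<phi> where "(U, \<phi>) \<in> A" "p \<in> U"
proof -
  have "p \<in> (\<Union>(U,\<phi>)\<in>A. U)"
    using smooth_manifold by (simp add: smooth_manifold_def)
  then show thesis using that by blast
qed

lemma chart_homeomorphism:
  assumes "(U, \<phi>) \<in> A"
  shows "open U" "open (\<phi> ` U)" "homeomorphism U (\<phi> ` U) \<phi> (inv_into U \<phi>)"
  using smooth_manifold assms by (auto simp: smooth_manifold_def)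

lemma chart_transition:
  assumes "(U, \<phi>) \<in> A" "(V, \<psi>) \<in> A"
  shows "smooth_on (\<phi> ` (U \<inter> V)) (\<lambda>x. \<psi> (inv_into U \<phi> x))"
proof -
  have "smooth_on (\<phi> ` (U \<inter> V)) (\<psi> \<circ> inv_into U \<phi>)"
    using smooth_manifold assms by (auto simp: smooth_manifold_def)
  then show ?thesis by (simp add: comp_def)
qed

lemma chart_inv [simp]:
  assumes "(U, \<phi>) \<in> A" "q \<in> U"
  shows "inv_into U \<phi> (\<phi> q) = q"
  using homeomorphism_apply1[OF chart_homeomorphism(3)[OF assms(1)] assms(2)] .

lemma chart_continuous:
  assumes "(U, \<phi>) \<in> A"
  shows "continuous_on U \<phi>" "continuous_on (\<phi> ` U) (inv_into U \<phi>)"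
  using chart_homeomorphism(3)[OF assms] by (auto simp: homeomorphism_def)

lemma chart_open_image:
  assumes "(U, \<phi>) \<in> A" "open N" "N \<subseteq> U"
  shows "open (\<phi> ` N)"
proof -
  have "openin (top_of_set (\<phi> ` U)) (\<phi> ` N)"
    by (rule homeomorphism_imp_open_map[OF chart_homeomorphism(3)[OF assms(1)]])
      (use assms in \<open>auto intro: open_subset\<close>)
  then show ?thesis
    using chart_homeomorphism(2)[OF assms(1)] openin_open_trans by blast
qed

lemma smooth_functionsD:
  assumes "f \<in> smooth_functions A" "(U, \<phi>) \<in> A"
  shows "smooth_on (\<phi> ` U) (\<lambda>x. f (inv_into U \<phi> x))"
  using assms unfolding smooth_functions_def smooth_map_on_def euclidean_atlas_def
  by (fastforce simp: comp_def)

text \<open>One chart around each point suffices for smoothness, because transition maps are smooth.\<close>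

lemma smooth_functionsI:
  assumes "\<And>p. \<exists>U \<phi> N. (U, \<phi>) \<in> A \<and> open N \<and> p \<in> N \<and> N \<subseteq> U \<and>
    smooth_on (\<phi> ` N) (\<lambda>x. f (inv_into U \<phi> x))"
  shows "f \<in> smooth_functions A"
proof -
  have "continuous (at p) f" for p
  proof -
    obtain U \<phi> N where N: "(U, \<phi>) \<in> A" "open N" "p \<in> N" "N \<subseteq> U"
      "smooth_on (\<phi> ` N) (\<lambda>x. f (inv_into U \<phi> x))"
      using assms[of p] by blast
    have "continuous_on N (\<lambda>q. f (inv_into U \<phi> (\<phi> q)))"
      by (rule continuous_on_compose2[OF smooth_on_continuous_on[OF N(5)]])
        (use continuous_on_subset[OF chart_continuous(1)[OF N(1)] N(4)] in auto)
    moreover have "f (inv_into U \<phi> (\<phi> q)) = f q" if "q \<in> N" for q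
      using N that by auto
    ultimately have "continuous_on N f"
      by (simp cong: continuous_on_cong)
    then show ?thesis
      using N by (simp add: continuous_on_eq_continuous_at)
  qed
  moreover have "smooth_on (\<psi> ` V) (\<lambda>x. f (inv_into V \<psi> x))" if V: "(V, \<psi>) \<in> A" for V \<psi>
  proof (rule smooth_on_local)
    fix x assume "x \<in> \<psi> ` V"
    then obtain q where q: "q \<in> V" "x = \<psi> q" by blast
    obtain U \<phi> N where N: "(U, \<phi>) \<in> A" "open N" "q \<in> N" "N \<subseteq> U"
      "smooth_on (\<phi> ` N) (\<lambda>x. f (inv_into U \<phi> x))"
      using assms[of q] by blast
    let ?T = "\<psi> ` (N \<inter> V)"
    have T: "open ?T"
      using chart_open_image[OF V, of "N \<inter> V"] N chart_homeomorphism(1)[OF V] by auto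
    have "smooth_on ?T (\<lambda>x. f (inv_into U \<phi> (\<phi> (inv_into V \<psi> x))))"
    proof (rule smooth_on_compose[OF T _ _ N(5)])
      show "open (\<phi> ` N)" using chart_open_image N by blast
      show "smooth_on ?T (\<lambda>x. \<phi> (inv_into V \<psi> x))"
        by (rule smooth_on_subset[OF chart_transition[OF V N(1)]]) (use N in auto)
    qed (use V in auto)
    then have "smooth_on ?T (\<lambda>x. f (inv_into V \<psi> x))"
      by (rule smooth_on_cong[OF T, rotated]) (use N V in auto)
    then show "\<exists>T. open T \<and> x \<in> T \<and> smooth_on T (\<lambda>x. f (inv_into V \<psi> x))"
      using T q N by blast
  qed
  ultimately show ?thesis
    unfolding smooth_functions_def smooth_map_on_def euclidean_atlas_def
    by (auto simp: comp_def continuous_at_imp_continuous_on)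
qed

lemma smooth_functions_local:
  assumes "\<And>p. \<exists>N f'. open N \<and> p \<in> N \<and> f' \<in> smooth_functions A \<and> (\<forall>q\<in>N. f' q = f q)"
  shows "f \<in> smooth_functions A"
proof (rule smooth_functionsI)
  fix p
  obtain N f' where N: "open N" "p \<in> N" "f' \<in> smooth_functions A" "\<And>q. q \<in> N \<Longrightarrow> f' q = f q"
    using assms[of p] by blast
  obtain U \<phi> where U: "(U, \<phi>) \<in> A" "p \<in> U" by (rule chart_at)
  have UN: "open (U \<inter> N)" using chart_homeomorphism(1)[OF U(1)] N(1) by auto
  have "smooth_on (\<phi> ` (U \<inter> N)) (\<lambda>x. f' (inv_into U \<phi> x))"
    by (rule smooth_on_subset[OF smooth_functionsD[OF N(3) U(1)]]) auto
  then have "smooth_on (\<phi> ` (U \<inter> N)) (\<lambda>x. f (inv_into U \<phi> x))"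
    by (rule smooth_on_cong[OF chart_open_image[OF U(1) UN], rotated 2]) (use U N in auto)
  then show "\<exists>U \<phi> N. (U, \<phi>) \<in> A \<and> open N \<and> p \<in> N \<and> N \<subseteq> U \<and> smooth_on (\<phi> ` N) (\<lambda>x. f (inv_into U \<phi> x))"
    using U N UN by blast
qed

text \<open>Extension by zero: off the compact, hence closed, set \<open>K\<close> the function vanishes near every point.\<close>

lemma smooth_functions_chartI:
  assumes "(U, \<phi>) \<in> A" "compact K" "K \<subseteq> U" "\<And>q. q \<notin> K \<Longrightarrow> f q = 0"
    "smooth_on (\<phi> ` U) (\<lambda>x. f (inv_into U \<phi> x))"
  shows "f \<in> smooth_functions A"
proof (rule smooth_functionsI)
  fix p
  show "\<exists>U \<phi> N. (U, \<phi>) \<in> A \<and> open N \<and> p \<in> N \<and> N \<subseteq> U \<and> smooth_on (\<phi> ` N) (\<lambda>x. f (inv_into U \<phi> x))"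
  proof (cases "p \<in> U")
    case True
    then show ?thesis using assms chart_homeomorphism(1)[OF assms(1)] by blast
  next
    case False
    obtain V \<psi> where V: "(V, \<psi>) \<in> A" "p \<in> V" by (rule chart_at)
    have N: "open (V - K)"
      using chart_homeomorphism(1)[OF V(1)] compact_imp_closed[OF assms(2)] by (rule open_Diff)
    have "smooth_on (\<psi> ` (V - K)) (\<lambda>x. f (inv_into V \<psi> x))"
      by (rule smooth_on_cong[OF _ _ smooth_on_const])
        (use chart_open_image[OF V(1) N] V assms(4) in auto)
    then show ?thesis using V N False assms(3) by blast
  qed
qed

lemma smooth_functions_continuous:
  assumes "f \<in> smooth_functions A"
  shows "continuous_on UNIV f"
  using assms by (simp add: smooth_functions_def smooth_map_on_def)

lemma smooth_functions_all_charts: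
  assumes "\<And>U \<phi>. (U, \<phi>) \<in> A \<Longrightarrow> open (\<phi> ` U) \<Longrightarrow> smooth_on (\<phi> ` U) (\<lambda>x. f (inv_into U \<phi> x))"
  shows "f \<in> smooth_functions A"
proof (rule smooth_functionsI)
  fix p
  obtain U \<phi> where U: "(U, \<phi>) \<in> A" "p \<in> U" by (rule chart_at)
  then show "\<exists>U \<phi> N. (U, \<phi>) \<in> A \<and> open N \<and> p \<in> N \<and> N \<subseteq> U \<and> smooth_on (\<phi> ` N) (\<lambda>x. f (inv_into U \<phi> x))"
    using chart_homeomorphism(1,2)[OF U(1)] assms[OF U(1)] by blast
qed

lemma smooth_functions_const: "(\<lambda>p. c) \<in> smooth_functions A"
  by (rule smooth_functions_all_charts) (rule smooth_on_const)

lemma smooth_functions_add: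
  assumes "f \<in> smooth_functions A" "f' \<in> smooth_functions A"
  shows "(\<lambda>p. f p + f' p) \<in> smooth_functions A"
  by (rule smooth_functions_all_charts, rule smooth_on_add, assumption)
    (erule smooth_functionsD[OF assms(1)], erule smooth_functionsD[OF assms(2)])

lemma smooth_functions_mult:
  assumes "f \<in> smooth_functions A" "f' \<in> smooth_functions A"
  shows "(\<lambda>p. f p * f' p) \<in> smooth_functions A"
  by (rule smooth_functions_all_charts, rule smooth_on_mult, assumption)
    (erule smooth_functionsD[OF assms(1)], erule smooth_functionsD[OF assms(2)])

lemma smooth_functions_sum:
  assumes "\<And>i. i \<in> I \<Longrightarrow> f i \<in> smooth_functions A"
  shows "(\<lambda>p. \<Sum>i\<in>I. f i p) \<in> smooth_functions A"
  using assms
  by (induction I rule: infinite_finite_induct) (auto intro!: smooth_functions_const smooth_functions_add)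

lemma smooth_functions_prod:
  assumes "\<And>i. i \<in> I \<Longrightarrow> f i \<in> smooth_functions A"
  shows "(\<lambda>p. \<Prod>i\<in>I. f i p) \<in> smooth_functions A"
  using assms
  by (induction I rule: infinite_finite_induct) (auto intro!: smooth_functions_const smooth_functions_mult)

text \<open>In a chart, compose the path on the unit circle with \<open>s x = 2 - 2 \<bar>x - \<phi> p\<bar>\<^sup>2 / r\<^sup>2\<close>, which is at most 0
  outside the ball of radius \<open>r\<close> around \<open>\<phi> p\<close> and at least 1 on the ball of radius \<open>r/2\<close>. Outside the chart
  \<open>u\<close> is 0 and \<open>w\<close> is 1, so it is \<open>w - 1\<close> that is extended by zero.\<close>

lemma smooth_cutoff:
  assumes "open N" "p \<in> N"
  obtains u w K G where "u \<in> smooth_functions A" "w \<in> smooth_functions A" "compact K" "K \<subseteq> N"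
    "open G" "p \<in> G" "G \<subseteq> N" "\<And>q. u q ^ 2 + w q ^ 2 = 1" "\<And>q. q \<notin> K \<Longrightarrow> u q = 0" "\<And>q. q \<in> G \<Longrightarrow> w q = 0"
proof -
  obtain u0 w0 :: "real \<Rightarrow> real" where u0: "smooth_on UNIV u0" "smooth_on UNIV w0"
    "\<And>x. u0 x ^ 2 + w0 x ^ 2 = 1" "\<And>x. x \<le> 0 \<Longrightarrow> u0 x = 0" "\<And>x. x \<le> 0 \<Longrightarrow> w0 x = 1"
    "\<And>x. x \<ge> 1 \<Longrightarrow> w0 x = 0"
    using smooth_circle_cutoff by metis
  obtain U \<phi> where U: "(U, \<phi>) \<in> A" "p \<in> U" by (rule chart_at)
  have "open (U \<inter> N)" using chart_homeomorphism(1)[OF U(1)] assms(1) by auto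
  then have "open (\<phi> ` (U \<inter> N))" using chart_open_image[OF U(1)] by blast
  moreover have "\<phi> p \<in> \<phi> ` (U \<inter> N)" using U assms by blast
  ultimately obtain r where r: "r > 0" "cball (\<phi> p) r \<subseteq> \<phi> ` (U \<inter> N)"
    using open_contains_cball by metis
  define K where "K = inv_into U \<phi> ` cball (\<phi> p) r"
  have sub: "cball (\<phi> p) r \<subseteq> \<phi> ` U" using r by blast
  have K: "compact K" "K \<subseteq> U" "K \<subseteq> N"
  proof -
    show "compact K" unfolding K_def
      by (rule compact_continuous_image[OF continuous_on_subset[OF chart_continuous(2)[OF U(1)] sub]]) simp
    show "K \<subseteq> U" "K \<subseteq> N" using r U unfolding K_def by force+
  qed
  define s :: "'e \<Rightarrow> real" where "s x = 2 + (- 2 / r\<^sup>2) * ((x + (- \<phi> p)) \<bullet> (x + (- \<phi> p)))" for x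
  have s_le: "s x \<le> 0" if "x \<notin> cball (\<phi> p) r" for x
  proof -
    have "r\<^sup>2 \<le> (norm (x - \<phi> p))\<^sup>2"
      using that r(1) by (intro power_mono) (auto simp: dist_norm norm_minus_commute)
    then show ?thesis
      using r(1) by (simp add: s_def power2_norm_eq_inner[symmetric] field_simps)
  qed
  have s_ge: "s x \<ge> 1" if "x \<in> ball (\<phi> p) (r / 2)" for x
  proof -
    have "(norm (x - \<phi> p))\<^sup>2 \<le> (r / 2)\<^sup>2"
      using that r(1) by (intro power_mono) (auto simp: dist_norm norm_minus_commute)
    then have "2 * (norm (x - \<phi> p))\<^sup>2 \<le> r\<^sup>2"
      using r(1) by (simp add: power2_eq_square field_simps) (smt (verit) mult_pos_pos)
    then show ?thesis
      using r(1) by (simp add: s_def power2_norm_eq_inner[symmetric] field_simps)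
  qed
  have open_chart: "open (\<phi> ` U)" using chart_homeomorphism(2)[OF U(1)] .
  have smooth_id: "smooth_on (\<phi> ` U) (\<lambda>x. x)"
    by (rule smooth_on_bounded_linear[OF open_chart bounded_linear_ident])
  have smooth_diff: "smooth_on (\<phi> ` U) (\<lambda>x. x + (- \<phi> p))"
    by (rule smooth_on_add[OF open_chart smooth_id smooth_on_const[OF open_chart]])
  have smooth_s: "smooth_on (\<phi> ` U) s" unfolding s_def
    by (rule smooth_on_add[OF open_chart smooth_on_const[OF open_chart]
          smooth_on_mult[OF open_chart smooth_on_const[OF open_chart]
            smooth_on_bilinear[OF bounded_bilinear_inner open_chart smooth_diff smooth_diff]]])
  have off_K: "s (\<phi> q) \<le> 0" if "q \<in> U" "q \<notin> K" for q
  proof (rule s_le)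
    show "\<phi> q \<notin> cball (\<phi> p) r"
      using that U chart_inv[OF U(1) that(1)] unfolding K_def by (metis image_eqI)
  qed
  define u where "u q = (if q \<in> U then u0 (s (\<phi> q)) else 0)" for q
  define w where "w q = (if q \<in> U then w0 (s (\<phi> q)) + (- 1) else 0)" for q
  have u: "u \<in> smooth_functions A"
  proof (rule smooth_functions_chartI[OF U(1) K(1,2)])
    show "u q = 0" if "q \<notin> K" for q using off_K that u0(4) by (auto simp: u_def)
    have "smooth_on (\<phi> ` U) (\<lambda>x. u0 (s x))"
      by (rule smooth_on_compose[OF open_chart open_UNIV smooth_s u0(1)]) simp
    then show "smooth_on (\<phi> ` U) (\<lambda>x. u (inv_into U \<phi> x))"
      by (rule smooth_on_cong[OF open_chart, rotated]) (use U in \<open>auto simp: u_def\<close>)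
  qed
  have w: "w \<in> smooth_functions A"
  proof (rule smooth_functions_chartI[OF U(1) K(1,2)])
    show "w q = 0" if "q \<notin> K" for q using off_K that u0(5) by (auto simp: w_def)
    have "smooth_on (\<phi> ` U) (\<lambda>x. w0 (s x))"
      by (rule smooth_on_compose[OF open_chart open_UNIV smooth_s u0(2)]) simp
    then have "smooth_on (\<phi> ` U) (\<lambda>x. w0 (s x) + (- 1))"
      by (rule smooth_on_add[OF open_chart _ smooth_on_const[OF open_chart]])
    then show "smooth_on (\<phi> ` U) (\<lambda>x. w (inv_into U \<phi> x))"
      by (rule smooth_on_cong[OF open_chart, rotated]) (use U in \<open>auto simp: w_def\<close>)
  qed
  show thesis
  proof
    show "u \<in> smooth_functions A" "(\<lambda>q. w q + 1) \<in> smooth_functions A" "compact K" "K \<subseteq> N"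
      using u smooth_functions_add[OF w smooth_functions_const] K by auto
    let ?G = "(U \<inter> N) \<inter> \<phi> -` ball (\<phi> p) (r / 2)"
    show "open ?G"
      by (rule continuous_open_preimage[OF continuous_on_subset[OF chart_continuous(1)[OF U(1)]]])
        (use \<open>open (U \<inter> N)\<close> in auto)
    show "p \<in> ?G" "?G \<subseteq> N" using U assms r by auto
    show "u q ^ 2 + (w q + 1) ^ 2 = 1" for q using u0(3) by (simp add: u_def w_def)
    show "u q = 0" if "q \<notin> K" for q using off_K that u0(4) by (auto simp: u_def)
    show "w q + 1 = 0" if "q \<in> ?G" for q using s_ge u0(6) that by (simp add: w_def)
  qed
qed

text \<open>The factor \<open>\<theta>\<close> is what turns a nonvanishing vector field into one of unit length near \<open>p\<close>, when \<open>f\<close> is its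
  squared length. It is \<open>u f\<^sup>-\<^sup>1\<^sup>/\<^sup>2\<close>, where the cut-off \<open>u\<close> removes the region in which
  \<open>f\<close> fails to be positive.\<close>

lemma smooth_normaliser:
  assumes "f \<in> smooth_functions A" "f p > 0"
  obtains \<theta> G where "\<theta> \<in> smooth_functions A" "open G" "p \<in> G" "\<And>q. q \<in> G \<Longrightarrow> \<theta> q ^ 2 * f q = 1"
proof -
  have cont: "continuous_on UNIV f" by (rule smooth_functions_continuous[OF assms(1)])
  let ?N = "{q. f q > 0}"
  have N: "open ?N"
    using open_Collect_less[OF continuous_on_const cont] by simp
  obtain u w K G where u: "u \<in> smooth_functions A" "compact K" "K \<subseteq> ?N"
    "open G" "p \<in> G" "G \<subseteq> ?N" "\<And>q. u q ^ 2 + w q ^ 2 = 1" "\<And>q. q \<notin> K \<Longrightarrow> u q = 0" "\<And>q. q \<in> G \<Longrightarrow> w q = (0::real)"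
    by (rule smooth_cutoff[OF N, of p]) (use assms(2) in auto)
  define \<theta> where "\<theta> q = u q * f q powr (-1/2)" for q
  have "\<theta> \<in> smooth_functions A"
  proof (rule smooth_functionsI)
    fix p
    obtain U \<phi> where U: "(U, \<phi>) \<in> A" "p \<in> U" by (rule chart_at)
    show "\<exists>U \<phi> N. (U, \<phi>) \<in> A \<and> open N \<and> p \<in> N \<and> N \<subseteq> U \<and> smooth_on (\<phi> ` N) (\<lambda>x. \<theta> (inv_into U \<phi> x))"
    proof (cases "p \<in> K")
      case True
      let ?V = "U \<inter> ?N"
      have V: "open ?V" using N chart_homeomorphism(1)[OF U(1)] by auto
      have oV: "open (\<phi> ` ?V)" using chart_open_image[OF U(1) V] by simp
      have *: "smooth_on (\<phi> ` ?V) (\<lambda>x. f (inv_into U \<phi> x))" "smooth_on (\<phi> ` ?V) (\<lambda>x. u (inv_into U \<phi> x))"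
        by (rule smooth_on_subset[OF smooth_functionsD[OF _ U(1)]], use assms u in auto)+
      have "smooth_on (\<phi> ` ?V) (\<lambda>x. f (inv_into U \<phi> x) powr (-1/2))"
        by (rule smooth_on_compose[OF oV open_greaterThan *(1) smooth_on_powr]) (use U in auto)
      then have "smooth_on (\<phi> ` ?V) (\<lambda>x. \<theta> (inv_into U \<phi> x))"
        unfolding \<theta>_def by (rule smooth_on_mult[OF oV *(2)])
      then show ?thesis using U V True u by blast
    next
      case False
      have V: "open (U - K)"
        using chart_homeomorphism(1)[OF U(1)] compact_imp_closed[OF u(2)] by (rule open_Diff)
      have "smooth_on (\<phi> ` (U - K)) (\<lambda>x. \<theta> (inv_into U \<phi> x))"
        by (rule smooth_on_cong[OF _ _ smooth_on_const])
          (use chart_open_image[OF U(1) V] U u in \<open>auto simp: \<theta>_def\<close>)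
      then show ?thesis using U V False by blast
    qed
  qed
  moreover have "\<theta> q ^ 2 * f q = 1" if "q \<in> G" for q
    using powr_minus_half_squared[of "f q"] u(6,9) u(7)[of q] that
    by (auto simp: \<theta>_def power_mult_distrib)
  ultimately show thesis using that u by blast
qed

end

section \<open>Tangent vectors in a chart\<close>

interpretation scale: vector_space scale
  by (rule vector_space_scale)

text \<open>The tangent vector with coordinates \<open>x\<close> in the chart \<open>(U, \<phi>)\<close>, as a derivation.\<close>

definition chart_vector ::
  "('m::topological_space, 'e::real_normed_vector) atlas \<Rightarrow> 'm set \<Rightarrow> ('m \<Rightarrow> 'e) \<Rightarrow> 'm \<Rightarrow> 'e \<Rightarrow> 'm tvec" where
  "chart_vector A U \<phi> q x =
     (\<lambda>f. if f \<in> smooth_functions A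
          then frechet_derivative (\<lambda>y. f (inv_into U \<phi> y)) (at (\<phi> q)) x else 0)"

lemma inv_into_id [simp]: "inv_into UNIV (\<lambda>x. x) = (\<lambda>x. x)"
  by (rule ext, rule inv_into_f_f) simp_all

context manifold
begin

lemma chart_has_derivative:
  assumes "(U, \<phi>) \<in> A" "q \<in> U" "f \<in> smooth_functions A"
  shows "((\<lambda>y. f (inv_into U \<phi> y)) has_derivative (\<lambda>x. chart_vector A U \<phi> q x f)) (at (\<phi> q))"
  using smooth_on_has_derivative[OF smooth_functionsD[OF assms(3,1)], of "\<phi> q"] assms
  by (simp add: chart_vector_def)

text \<open>The chain rule in a chart: the velocity of a curve depends only on its coordinate velocity.\<close>

lemma velocity_eq_chart_vector:
  assumes U: "(U, \<phi>) \<in> A" "\<gamma> 0 \<in> U" and \<gamma>: "continuous_on {-\<epsilon><..<\<epsilon>} \<gamma>" "\<epsilon> > 0"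
    and x: "((\<lambda>t. \<phi> (\<gamma> t)) has_derivative (\<lambda>t. t *\<^sub>R x)) (at 0)"
  shows "velocity A \<gamma> = chart_vector A U \<phi> (\<gamma> 0) x"
proof
  fix f
  show "velocity A \<gamma> f = chart_vector A U \<phi> (\<gamma> 0) x f"
  proof (cases "f \<in> smooth_functions A")
    case True
    let ?S = "{-\<epsilon><..<\<epsilon>} \<inter> \<gamma> -` U"
    have S: "open ?S"
      by (rule continuous_open_preimage[OF \<gamma>(1) open_greaterThanLessThan chart_homeomorphism(1)[OF U(1)]])
    have "((\<lambda>t. f (inv_into U \<phi> (\<phi> (\<gamma> t)))) has_derivative (\<lambda>t. chart_vector A U \<phi> (\<gamma> 0) (t *\<^sub>R x) f)) (at 0)"
      by (rule has_derivative_compose[OF x chart_has_derivative[OF U True]])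
    then have "((\<lambda>t. f (\<gamma> t)) has_derivative (\<lambda>t. chart_vector A U \<phi> (\<gamma> 0) (t *\<^sub>R x) f)) (at 0)"
      by (rule has_derivative_transform_within_open[OF _ S]) (use U \<gamma> in auto)
    moreover have "chart_vector A U \<phi> (\<gamma> 0) (t *\<^sub>R x) f = chart_vector A U \<phi> (\<gamma> 0) x f * t" for t
      using linear_scale[OF has_derivative_linear[OF chart_has_derivative[OF U True]], of t x] by simp
    ultimately have "((\<lambda>t. f (\<gamma> t)) has_real_derivative chart_vector A U \<phi> (\<gamma> 0) x f) (at 0)"
      by (simp add: has_field_derivative_def)
    then show ?thesis
      using True by (simp add: velocity_def DERIV_imp_deriv)
  qed (simp add: velocity_def chart_vector_def)
qed

lemma smooth_curve_velocity:
  assumes U: "(U, \<phi>) \<in> A" "\<gamma> 0 \<in> U" and \<gamma>: "smooth_map_on euclidean_atlas A {-\<epsilon><..<\<epsilon>} \<gamma>" "\<epsilon> > 0"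
  shows "velocity A \<gamma> \<in> range (chart_vector A U \<phi> (\<gamma> 0))"
proof -
  have cont: "continuous_on {-\<epsilon><..<\<epsilon>} \<gamma>"
    using \<gamma> by (simp add: smooth_map_on_def)
  have "\<forall>(V,\<psi>)\<in>A. smooth_on ({-\<epsilon><..<\<epsilon>} \<inter> \<gamma> -` V) (\<psi> \<circ> \<gamma>)"
    using \<gamma>(1) by (simp add: smooth_map_on_def euclidean_atlas_def comp_def)
  from bspec[OF this U(1)] have "smooth_on ({-\<epsilon><..<\<epsilon>} \<inter> \<gamma> -` U) (\<lambda>t. \<phi> (\<gamma> t))"
    by (simp add: comp_def)
  then have D: "((\<lambda>t. \<phi> (\<gamma> t)) has_derivative frechet_derivative (\<lambda>t. \<phi> (\<gamma> t)) (at 0)) (at 0)"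
    by (rule smooth_on_has_derivative) (simp add: U(2) \<gamma>(2))
  have lin: "frechet_derivative (\<lambda>t. \<phi> (\<gamma> t)) (at 0) t = t *\<^sub>R frechet_derivative (\<lambda>t. \<phi> (\<gamma> t)) (at 0) 1" for t
    using linear_scale[OF has_derivative_linear[OF D], of t 1] by simp
  have "((\<lambda>t. \<phi> (\<gamma> t)) has_derivative (\<lambda>t. t *\<^sub>R frechet_derivative (\<lambda>t. \<phi> (\<gamma> t)) (at 0) 1)) (at 0)"
    by (rule has_derivative_eq_rhs[OF D], rule ext, rule lin)
  from velocity_eq_chart_vector[OF U cont \<gamma>(2) this] show ?thesis by blast
qed

text \<open>The coordinate straight line through \<open>q\<close> in direction \<open>x\<close> is a smooth curve as long as it stays in
  the chart, and its velocity is the given vector.\<close>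

lemma chart_vector_tangent:
  assumes U: "(U, \<phi>) \<in> A" "q \<in> U"
  shows "chart_vector A U \<phi> q x \<in> tangent_space A q"
proof -
  let ?l = "\<lambda>t::real. t *\<^sub>R x + \<phi> q"
  let ?\<gamma> = "\<lambda>t. inv_into U \<phi> (?l t)"
  have oU: "open (\<phi> ` U)" by (rule chart_homeomorphism(2)[OF U(1)])
  have l: "continuous_on UNIV ?l" by (intro continuous_intros)
  have "open (?l -` (\<phi> ` U))"
    using oU l by (rule open_vimage)
  moreover have "0 \<in> ?l -` (\<phi> ` U)" using U by simp
  ultimately obtain \<epsilon> where \<epsilon>: "\<epsilon> > 0" "ball 0 \<epsilon> \<subseteq> ?l -` (\<phi> ` U)"
    using open_contains_ball by metis
  have ball: "ball 0 \<epsilon> = {-\<epsilon><..<\<epsilon>}" by (auto simp: dist_real_def)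
  have in_chart: "?l t \<in> \<phi> ` U" if "t \<in> {-\<epsilon><..<\<epsilon>}" for t
    using \<epsilon>(2) that unfolding ball by blast
  have in_U: "?\<gamma> t \<in> U" if "t \<in> {-\<epsilon><..<\<epsilon>}" for t
    using inv_into_into[OF in_chart[OF that]] .
  have chart_\<gamma>: "\<phi> (?\<gamma> t) = ?l t" if "t \<in> {-\<epsilon><..<\<epsilon>}" for t
    using f_inv_into_f[OF in_chart[OF that]] .
  have cont: "continuous_on {-\<epsilon><..<\<epsilon>} ?\<gamma>"
    by (rule continuous_on_compose2[OF chart_continuous(2)[OF U(1)] continuous_on_subset[OF l]])
      (use in_chart in auto)
  have "smooth_on ({-\<epsilon><..<\<epsilon>} \<inter> ?\<gamma> -` V) (\<lambda>t. \<psi> (?\<gamma> t))" if V: "(V, \<psi>) \<in> A" for V \<psi>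
  proof -
    have S: "open ({-\<epsilon><..<\<epsilon>} \<inter> ?\<gamma> -` V)"
      by (rule continuous_open_preimage[OF cont open_greaterThanLessThan chart_homeomorphism(1)[OF V]])
    have T: "open (\<phi> ` (U \<inter> V))"
      using chart_open_image[OF U(1), of "U \<inter> V"] chart_homeomorphism(1)[OF U(1)]
        chart_homeomorphism(1)[OF V] by auto
    have smooth_l: "smooth_on ({-\<epsilon><..<\<epsilon>} \<inter> ?\<gamma> -` V) ?l"
      by (rule smooth_on_add[OF S smooth_on_bounded_linear[OF S] smooth_on_const[OF S]])
        (rule bounded_linear_scaleR_left)
    show ?thesis
    proof (rule smooth_on_compose[OF S T smooth_l chart_transition[OF U(1) V]])
      show "?l ` ({-\<epsilon><..<\<epsilon>} \<inter> ?\<gamma> -` V) \<subseteq> \<phi> ` (U \<inter> V)"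
      proof
        fix y assume "y \<in> ?l ` ({-\<epsilon><..<\<epsilon>} \<inter> ?\<gamma> -` V)"
        then obtain t where t: "t \<in> {-\<epsilon><..<\<epsilon>}" "?\<gamma> t \<in> V" "y = ?l t" by blast
        then have "y = \<phi> (?\<gamma> t)" "?\<gamma> t \<in> U \<inter> V" using chart_\<gamma> in_U by auto
        then show "y \<in> \<phi> ` (U \<inter> V)" by blast
      qed
    qed
  qed
  then have "smooth_map_on euclidean_atlas A {-\<epsilon><..<\<epsilon>} ?\<gamma>"
    unfolding smooth_map_on_def euclidean_atlas_def using cont by (auto simp: comp_def)
  moreover have \<gamma>0: "?\<gamma> 0 = q" using U by simp
  ultimately have "velocity A ?\<gamma> \<in> tangent_space A q"
    unfolding tangent_space_def using \<epsilon>(1) by blast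
  moreover have "velocity A ?\<gamma> = chart_vector A U \<phi> (?\<gamma> 0) x"
  proof (rule velocity_eq_chart_vector[OF U(1) _ cont \<epsilon>(1)])
    have "(?l has_derivative (\<lambda>t. t *\<^sub>R x)) (at 0)"
      by (auto intro!: derivative_eq_intros)
    then show "((\<lambda>t. \<phi> (?\<gamma> t)) has_derivative (\<lambda>t. t *\<^sub>R x)) (at 0)"
      by (rule has_derivative_transform_within_open[OF _ open_greaterThanLessThan[of "-\<epsilon>" \<epsilon>]])
        (use \<epsilon>(1) chart_\<gamma> in auto)
  qed (use U in simp)
  ultimately show ?thesis unfolding \<gamma>0 by simp
qed

text \<open>Coordinates carry the linear structure: a sum of velocities of curves becomes a sum of coordinate
  vectors, and so is again a velocity.\<close>

lemma tangent_space_chart: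
  assumes "(U, \<phi>) \<in> A" "q \<in> U"
  shows "tangent_space A q = range (chart_vector A U \<phi> q)"
proof
  show "tangent_space A q \<subseteq> range (chart_vector A U \<phi> q)"
    unfolding tangent_space_def using smooth_curve_velocity[OF assms(1)] assms(2) by blast
  show "range (chart_vector A U \<phi> q) \<subseteq> tangent_space A q"
    using chart_vector_tangent[OF assms] by blast
qed

lemma tangent_vector_chart:
  assumes "v \<in> tangent_space A q"
  obtains U \<phi> x where "(U, \<phi>) \<in> A" "q \<in> U" "v = chart_vector A U \<phi> q x"
  using chart_at[of q] tangent_space_chart assms by (metis imageE)

lemma chart_vector_add:
  assumes "(U, \<phi>) \<in> A" "q \<in> U"
  shows "chart_vector A U \<phi> q (x + y) = chart_vector A U \<phi> q x + chart_vector A U \<phi> q y"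
proof
  fix f
  show "chart_vector A U \<phi> q (x + y) f = (chart_vector A U \<phi> q x + chart_vector A U \<phi> q y) f"
  proof (cases "f \<in> smooth_functions A")
    case True
    then show ?thesis
      using linear_add[OF has_derivative_linear[OF chart_has_derivative[OF assms]]] by simp
  qed (simp add: chart_vector_def)
qed

lemma chart_vector_scale:
  assumes "(U, \<phi>) \<in> A" "q \<in> U"
  shows "chart_vector A U \<phi> q (c *\<^sub>R x) = scale c (chart_vector A U \<phi> q x)"
proof
  fix f
  show "chart_vector A U \<phi> q (c *\<^sub>R x) f = scale c (chart_vector A U \<phi> q x) f"
  proof (cases "f \<in> smooth_functions A")
    case True
    then show ?thesis
      using linear_scale[OF has_derivative_linear[OF chart_has_derivative[OF assms]]]
      by (simp add: scale_def)
  qed (simp add: chart_vector_def scale_def)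
qed

lemma chart_vector_sum:
  assumes "(U, \<phi>) \<in> A" "q \<in> U"
  shows "chart_vector A U \<phi> q (\<Sum>i\<in>I. x i) = (\<Sum>i\<in>I. chart_vector A U \<phi> q (x i))"
  using chart_vector_scale[OF assms, of 0 0]
  by (induction I rule: infinite_finite_induct) (auto simp: chart_vector_add[OF assms])

lemma tangent_space_add:
  assumes "u \<in> tangent_space A q" "v \<in> tangent_space A q"
  shows "u + v \<in> tangent_space A q"
proof -
  obtain U \<phi> where U: "(U, \<phi>) \<in> A" "q \<in> U" by (rule chart_at)
  then obtain x y where "u = chart_vector A U \<phi> q x" "v = chart_vector A U \<phi> q y"
    using assms tangent_space_chart by blast
  then show ?thesis
    using chart_vector_add[OF U] chart_vector_tangent[OF U] by metis
qed

lemma tangent_space_scale: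
  assumes "v \<in> tangent_space A q"
  shows "scale c v \<in> tangent_space A q"
proof -
  obtain U \<phi> where U: "(U, \<phi>) \<in> A" "q \<in> U" by (rule chart_at)
  then obtain x where "v = chart_vector A U \<phi> q x"
    using assms tangent_space_chart by blast
  then show ?thesis
    using chart_vector_scale[OF U] chart_vector_tangent[OF U] by metis
qed

lemma tangent_space_0: "0 \<in> tangent_space A q"
proof -
  obtain U \<phi> where U: "(U, \<phi>) \<in> A" "q \<in> U" by (rule chart_at)
  have "chart_vector A U \<phi> q (0 *\<^sub>R 0) = 0"
    unfolding chart_vector_scale[OF U] by (simp add: scale_def fun_eq_iff)
  then show ?thesis using chart_vector_tangent[OF U] by metis
qed

lemma tangent_space_sum:
  assumes "\<And>i. i \<in> I \<Longrightarrow> v i \<in> tangent_space A q"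
  shows "(\<Sum>i\<in>I. v i) \<in> tangent_space A q"
  using assms
  by (induction I rule: infinite_finite_induct) (auto intro: tangent_space_0 tangent_space_add)

lemma tangent_space_diff:
  assumes "u \<in> tangent_space A q" "v \<in> tangent_space A q"
  shows "u - v \<in> tangent_space A q"
proof -
  have "u - v = u + scale (- 1) v" by (simp add: fun_eq_iff scale_def)
  then show ?thesis using assms tangent_space_add tangent_space_scale by metis
qed

lemma tangent_vector_not_smooth:
  assumes "v \<in> tangent_space A q" "f \<notin> smooth_functions A"
  shows "v f = 0"
  using tangent_vector_chart[OF assms(1)] assms(2) by (metis chart_vector_def)

text \<open>Tangent vectors vanish on non-smooth functions by convention, so smooth ones decide equality.\<close>

lemma tangent_vector_eqI:
  assumes "u \<in> tangent_space A q" "v \<in> tangent_space A q"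
    "\<And>f. f \<in> smooth_functions A \<Longrightarrow> u f = v f"
  shows "u = v"
  using tangent_vector_not_smooth assms by (metis ext)

lemma tangent_vector_local:
  assumes "v \<in> tangent_space A q" "f \<in> smooth_functions A" "f' \<in> smooth_functions A"
    "open N" "q \<in> N" "\<And>p. p \<in> N \<Longrightarrow> f p = f' p"
  shows "v f = v f'"
proof -
  obtain U \<phi> x where U: "(U, \<phi>) \<in> A" "q \<in> U" "v = chart_vector A U \<phi> q x"
    by (rule tangent_vector_chart[OF assms(1)])
  let ?N = "\<phi> ` (U \<inter> N)"
  have "open ?N"
    using chart_open_image[OF U(1), of "U \<inter> N"] chart_homeomorphism(1)[OF U(1)] assms(4) by auto
  then have "((\<lambda>y. f' (inv_into U \<phi> y)) has_derivative (\<lambda>x. chart_vector A U \<phi> q x f)) (at (\<phi> q))"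
    by (rule has_derivative_transform_within_open[OF chart_has_derivative[OF U(1,2) assms(2)]])
      (use U assms in auto)
  then show ?thesis
    using has_derivative_unique[OF _ chart_has_derivative[OF U(1,2) assms(3)]] U(3) by metis
qed

lemma tangent_vector_const:
  assumes "v \<in> tangent_space A q"
  shows "v (\<lambda>p. c) = 0"
proof -
  obtain U \<phi> x where U: "(U, \<phi>) \<in> A" "q \<in> U" "v = chart_vector A U \<phi> q x"
    by (rule tangent_vector_chart[OF assms(1)])
  then show ?thesis by (simp add: chart_vector_def)
qed

lemma tangent_vector_add:
  assumes "v \<in> tangent_space A q" "f \<in> smooth_functions A" "f' \<in> smooth_functions A"
  shows "v (\<lambda>p. f p + f' p) = v f + v f'"
proof -
  obtain U \<phi> x where U: "(U, \<phi>) \<in> A" "q \<in> U" "v = chart_vector A U \<phi> q x"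
    by (rule tangent_vector_chart[OF assms(1)])
  have "(\<lambda>x. chart_vector A U \<phi> q x (\<lambda>p. f p + f' p)) = (\<lambda>x. chart_vector A U \<phi> q x f + chart_vector A U \<phi> q x f')"
    by (rule has_derivative_unique[OF chart_has_derivative[OF U(1,2) smooth_functions_add[OF assms(2,3)]]
          has_derivative_add[OF chart_has_derivative[OF U(1,2) assms(2)] chart_has_derivative[OF U(1,2) assms(3)]]])
  then show ?thesis unfolding U(3) by metis
qed

lemma tangent_vector_mult:
  assumes "v \<in> tangent_space A q" "f \<in> smooth_functions A" "f' \<in> smooth_functions A"
  shows "v (\<lambda>p. f p * f' p) = f q * v f' + v f * f' q"
proof -
  obtain U \<phi> x where U: "(U, \<phi>) \<in> A" "q \<in> U" "v = chart_vector A U \<phi> q x"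
    by (rule tangent_vector_chart[OF assms(1)])
  have "(\<lambda>x. chart_vector A U \<phi> q x (\<lambda>p. f p * f' p)) =
      (\<lambda>x. f (inv_into U \<phi> (\<phi> q)) * chart_vector A U \<phi> q x f' + chart_vector A U \<phi> q x f * f' (inv_into U \<phi> (\<phi> q)))"
    by (rule has_derivative_unique[OF chart_has_derivative[OF U(1,2) smooth_functions_mult[OF assms(2,3)]]
          has_derivative_mult[OF chart_has_derivative[OF U(1,2) assms(2)] chart_has_derivative[OF U(1,2) assms(3)]]])
  then show ?thesis unfolding U(3) using U by simp metis
qed

lemma tangent_vector_sum:
  assumes "v \<in> tangent_space A q" "\<And>i. i \<in> I \<Longrightarrow> f i \<in> smooth_functions A"
  shows "v (\<lambda>p. \<Sum>i\<in>I. f i p) = (\<Sum>i\<in>I. v (f i))"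
  using assms(2)
  by (induction I rule: infinite_finite_induct)
    (auto simp: tangent_vector_const[OF assms(1)] tangent_vector_add[OF assms(1)] smooth_functions_sum)

section \<open>Vector fields and one-forms\<close>

lemma vector_fieldsI:
  assumes "\<And>p. X p \<in> tangent_space A p"
    "\<And>f. f \<in> smooth_functions A \<Longrightarrow> (\<lambda>p. X p f) \<in> smooth_functions A"
  shows "X \<in> vector_fields A"
  using assms by (simp add: vector_fields_def act_on_def)

lemma vector_fields_tangent: "X \<in> vector_fields A \<Longrightarrow> X p \<in> tangent_space A p"
  by (simp add: vector_fields_def)

lemma vector_fields_smooth:
  "X \<in> vector_fields A \<Longrightarrow> f \<in> smooth_functions A \<Longrightarrow> (\<lambda>p. X p f) \<in> smooth_functions A"
  by (simp add: vector_fields_def act_on_def)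

lemma vector_fields_add:
  assumes "X \<in> vector_fields A" "Y \<in> vector_fields A"
  shows "(\<lambda>p. X p + Y p) \<in> vector_fields A"
  using assms by (intro vector_fieldsI)
    (auto simp: vector_fields_tangent tangent_space_add smooth_functions_add vector_fields_smooth)

lemma vector_fields_scale:
  assumes "f \<in> smooth_functions A" "X \<in> vector_fields A"
  shows "(\<lambda>p. scale (f p) (X p)) \<in> vector_fields A"
  by (rule vector_fieldsI)
    (use assms in \<open>auto simp: scale_def[of _ "_ :: _ tvec"] smooth_functions_mult vector_fields_smooth
      intro: tangent_space_scale[unfolded scale_def] vector_fields_tangent\<close>)

lemma vector_fields_0: "(\<lambda>p. 0) \<in> vector_fields A"
  by (rule vector_fieldsI) (auto simp: tangent_space_0 smooth_functions_const)

lemma vector_fields_sum: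
  assumes "\<And>i. i \<in> I \<Longrightarrow> X i \<in> vector_fields A"
  shows "(\<lambda>p. \<Sum>i\<in>I. X i p) \<in> vector_fields A"
  using assms
  by (induction I rule: infinite_finite_induct) (auto intro!: vector_fields_0 vector_fields_add)

lemma vector_fields_diff:
  assumes "X \<in> vector_fields A" "Y \<in> vector_fields A"
  shows "(\<lambda>p. X p - Y p) \<in> vector_fields A"
proof -
  have "(\<lambda>p. X p - Y p) = (\<lambda>p. X p + scale (- 1) (Y p))"
    by (simp add: fun_eq_iff scale_def)
  then show ?thesis
    using vector_fields_add[OF assms(1) vector_fields_scale[OF smooth_functions_const assms(2)]] by metis
qed

lemma vector_fields_local:
  assumes "\<And>p. \<exists>N X'. open N \<and> p \<in> N \<and> X' \<in> vector_fields A \<and> (\<forall>q\<in>N. X' q = X q)"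
  shows "X \<in> vector_fields A"
proof (rule vector_fieldsI)
  show "X p \<in> tangent_space A p" for p
    using assms[of p] vector_fields_tangent by metis
  show "(\<lambda>p. X p f) \<in> smooth_functions A" if "f \<in> smooth_functions A" for f
  proof (rule smooth_functions_local)
    fix p
    obtain N X' where "open N" "p \<in> N" "X' \<in> vector_fields A" "\<forall>q\<in>N. X' q = X q"
      using assms by blast
    then show "\<exists>N f'. open N \<and> p \<in> N \<and> f' \<in> smooth_functions A \<and> (\<forall>q\<in>N. f' q = X q f)"
      using vector_fields_smooth[OF _ that] by metis
  qed
qed

lemma one_formsI:
  assumes "\<And>p. \<alpha> p \<in> cotangent_space A p"
    "\<And>X. X \<in> vector_fields A \<Longrightarrow> (\<lambda>p. \<alpha> p (X p)) \<in> smooth_functions A"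
  shows "\<alpha> \<in> one_forms A"
  using assms by (simp add: one_forms_def pairing_def)

lemma one_forms_cotangent: "\<alpha> \<in> one_forms A \<Longrightarrow> \<alpha> p \<in> cotangent_space A p"
  by (simp add: one_forms_def)

lemma one_forms_smooth:
  "\<alpha> \<in> one_forms A \<Longrightarrow> X \<in> vector_fields A \<Longrightarrow> (\<lambda>p. \<alpha> p (X p)) \<in> smooth_functions A"
  by (simp add: one_forms_def pairing_def)

lemma differential_one_form:
  assumes "f \<in> smooth_functions A"
  shows "differential A f \<in> one_forms A"
proof (rule one_formsI)
  show "differential A f p \<in> cotangent_space A p" for p
    by (auto simp: differential_def cotangent_space_def linear_functional_on_def tangent_space_add
        tangent_space_scale scale_def tangent_space_scale[unfolded scale_def])
  show "(\<lambda>p. differential A f p (X p)) \<in> smooth_functions A" if "X \<in> vector_fields A" for X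
    using vector_fields_smooth[OF that assms] vector_fields_tangent[OF that] by (simp add: differential_def)
qed

text \<open>Testing against the coordinate function \<open>x \<bullet> \<phi>\<close>, cut off to become globally smooth, yields
  \<open>x \<bullet> x = 0\<close>.\<close>

lemma chart_vector_injective:
  assumes U: "(U, \<phi>) \<in> A" "p \<in> U" and 0: "chart_vector A U \<phi> p x = 0"
  shows "x = 0"
proof -
  obtain u w K G where u: "u \<in> smooth_functions A" "w \<in> smooth_functions A" "compact K" "K \<subseteq> U"
    "open G" "p \<in> G" "G \<subseteq> U" "\<And>q. u q ^ 2 + w q ^ 2 = 1" "\<And>q. q \<notin> K \<Longrightarrow> u q = 0" "\<And>q. q \<in> G \<Longrightarrow> w q = (0::real)"
    by (rule smooth_cutoff[OF chart_homeomorphism(1)[OF U(1)] U(2)]) auto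
  have oU: "open (\<phi> ` U)" by (rule chart_homeomorphism(2)[OF U(1)])
  define y where "y q = (if q \<in> U then u q * u q * (x \<bullet> \<phi> q) else 0)" for q
  have y: "y \<in> smooth_functions A"
  proof (rule smooth_functions_chartI[OF U(1) u(3,4)])
    show "y q = 0" if "q \<notin> K" for q using u(9)[OF that] by (simp add: y_def)
    have "smooth_on (\<phi> ` U) (\<lambda>z. u (inv_into U \<phi> z) * u (inv_into U \<phi> z) * (x \<bullet> z))"
      by (rule smooth_on_mult[OF oU smooth_on_mult[OF oU smooth_functionsD[OF u(1) U(1)] smooth_functionsD[OF u(1) U(1)]]
            smooth_on_bounded_linear[OF oU bounded_linear_inner_right]])
    then show "smooth_on (\<phi> ` U) (\<lambda>z. y (inv_into U \<phi> z))"
      by (rule smooth_on_cong[OF oU, rotated]) (use U in \<open>auto simp: y_def\<close>)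
  qed
  have oG: "open (\<phi> ` G)" by (rule chart_open_image[OF U(1) u(5,7)])
  have D: "((\<lambda>z. x \<bullet> z) has_derivative (\<lambda>z. x \<bullet> z)) (at (\<phi> p))"
    by (rule bounded_linear_imp_has_derivative[OF bounded_linear_inner_right])
  have "((\<lambda>z. y (inv_into U \<phi> z)) has_derivative (\<lambda>z. x \<bullet> z)) (at (\<phi> p))"
  proof (rule has_derivative_transform_within_open[OF D oG])
    show "\<phi> p \<in> \<phi> ` G" using u(6) by blast
    fix z assume "z \<in> \<phi> ` G"
    then obtain q where q: "q \<in> G" "z = \<phi> q" by blast
    then have "u q * u q = 1" using u(8)[of q] u(10) by (simp add: power2_eq_square)
    then show "x \<bullet> z = y (inv_into U \<phi> z)" using q u(7) U by (auto simp: y_def)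
  qed
  then have "(\<lambda>z. chart_vector A U \<phi> p z y) = (\<lambda>z. x \<bullet> z)"
    using has_derivative_unique[OF chart_has_derivative[OF U y]] by blast
  then have "x \<bullet> x = 0" using 0 by (metis zero_fun_apply)
  then show ?thesis by simp
qed

text \<open>The factor \<open>u\<^sup>2\<close> makes a coordinate field globally defined, and equals 1 where \<open>w\<close> vanishes, so nothing is
  lost near \<open>p\<close>.\<close>

lemma chart_vector_extension:
  assumes U: "(U, \<phi>) \<in> A" "p \<in> U"
  obtains G E where "open G" "p \<in> G" "G \<subseteq> U" "\<And>x. E x \<in> vector_fields A"
    "\<And>x q. q \<in> G \<Longrightarrow> E x q = chart_vector A U \<phi> q x"
proof -
  obtain u w K G where u: "u \<in> smooth_functions A" "w \<in> smooth_functions A" "compact K" "K \<subseteq> U"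
    "open G" "p \<in> G" "G \<subseteq> U" "\<And>q. u q ^ 2 + w q ^ 2 = 1" "\<And>q. q \<notin> K \<Longrightarrow> u q = 0" "\<And>q. q \<in> G \<Longrightarrow> w q = (0::real)"
    by (rule smooth_cutoff[OF chart_homeomorphism(1)[OF U(1)] U(2)]) auto
  have oU: "open (\<phi> ` U)" by (rule chart_homeomorphism(2)[OF U(1)])
  define E where "E x q = (if q \<in> U then scale (u q * u q) (chart_vector A U \<phi> q x) else 0)" for x q
  have fields: "E x \<in> vector_fields A" for x
  proof (rule vector_fieldsI)
    show "E x q \<in> tangent_space A q" for q
      by (simp add: E_def tangent_space_0 tangent_space_scale chart_vector_tangent[OF U(1)])
    fix f assume f: "f \<in> smooth_functions A"
    show "(\<lambda>q. E x q f) \<in> smooth_functions A"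
    proof (rule smooth_functions_chartI[OF U(1) u(3,4)])
      show "E x q f = 0" if "q \<notin> K" for q using u(9)[OF that] by (simp add: E_def scale_def)
      have "smooth_on (\<phi> ` U) (\<lambda>z. u (inv_into U \<phi> z) * u (inv_into U \<phi> z) *
          frechet_derivative (\<lambda>y. f (inv_into U \<phi> y)) (at z) x)"
        by (rule smooth_on_mult[OF oU smooth_on_mult[OF oU smooth_functionsD[OF u(1) U(1)] smooth_functionsD[OF u(1) U(1)]]
              smooth_on_frechet_derivative[OF smooth_functionsD[OF f U(1)]]])
      then show "smooth_on (\<phi> ` U) (\<lambda>z. E x (inv_into U \<phi> z) f)"
        by (rule smooth_on_cong[OF oU, rotated]) (use U f in \<open>auto simp: E_def scale_def chart_vector_def\<close>)
    qed
  qed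
  have "E x q = chart_vector A U \<phi> q x" if "q \<in> G" for x q
  proof -
    have "u q * u q = 1" using u(8)[of q] u(10)[OF that] by (simp add: power2_eq_square)
    then show ?thesis using that u(7) by (auto simp: E_def scale_def)
  qed
  with u(5,6,7) fields show thesis by (rule that)
qed

lemma tangent_vector_extension:
  assumes "v \<in> tangent_space A p"
  obtains X where "X \<in> vector_fields A" "X p = v"
proof -
  obtain U \<phi> x where U: "(U, \<phi>) \<in> A" "p \<in> U" "v = chart_vector A U \<phi> p x"
    by (rule tangent_vector_chart[OF assms])
  then show thesis using chart_vector_extension[OF U(1,2)] that by metis
qed

end

section \<open>Parseval frames of a Riemannian manifold\<close>

context manifold
begin

text \<open>Tensors and covectors are linear on the tangent space only, so their algebra is restated with
  membership premises.\<close>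

lemma symmetric_tensor_add:
  assumes "symmetric_tensor A b" "u \<in> tangent_space A p" "u' \<in> tangent_space A p" "v \<in> tangent_space A p"
  shows "b p (u + u') v = b p u v + b p u' v" "b p v (u + u') = b p v u + b p v u'"
  using assms by (auto simp: symmetric_tensor_def bilinear_form_on_def linear_functional_on_def)

lemma symmetric_tensor_scale:
  assumes "symmetric_tensor A b" "u \<in> tangent_space A p" "v \<in> tangent_space A p"
  shows "b p (scale c u) v = c * b p u v" "b p v (scale c u) = c * b p v u"
  using assms by (auto simp: symmetric_tensor_def bilinear_form_on_def linear_functional_on_def)

lemma symmetric_tensor_commute:
  assumes "symmetric_tensor A b" "u \<in> tangent_space A p" "v \<in> tangent_space A p"
  shows "b p u v = b p v u"
  using assms by (auto simp: symmetric_tensor_def)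

lemma symmetric_tensor_0:
  assumes "symmetric_tensor A b" "v \<in> tangent_space A p"
  shows "b p 0 v = 0" "b p v 0 = 0"
  using symmetric_tensor_scale[OF assms(1) assms(2) assms(2), of 0]
    symmetric_tensor_commute[OF assms(1) tangent_space_0 assms(2)]
    symmetric_tensor_scale[OF assms(1) tangent_space_0 assms(2), of 0] by simp_all

lemma symmetric_tensor_diff:
  assumes "symmetric_tensor A b" "u \<in> tangent_space A p" "u' \<in> tangent_space A p" "v \<in> tangent_space A p"
  shows "b p (u - u') v = b p u v - b p u' v" "b p v (u - u') = b p v u - b p v u'"
proof -
  have eq: "u - u' = u + scale (- 1) u'" by simp
  show "b p (u - u') v = b p u v - b p u' v" "b p v (u - u') = b p v u - b p v u'"
    unfolding eq symmetric_tensor_add[OF assms(1,2) tangent_space_scale[OF assms(3)] assms(4)]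
      symmetric_tensor_scale[OF assms(1,3,4)] by simp_all
qed

lemma symmetric_tensor_sum:
  assumes "symmetric_tensor A b" "v \<in> tangent_space A p" "\<And>i. i \<in> I \<Longrightarrow> u i \<in> tangent_space A p"
  shows "b p v (\<Sum>i\<in>I. u i) = (\<Sum>i\<in>I. b p v (u i))" "b p (\<Sum>i\<in>I. u i) v = (\<Sum>i\<in>I. b p (u i) v)"
  using assms(3)
  by (induction I rule: infinite_finite_induct)
    (auto simp: symmetric_tensor_0[OF assms(1,2)] symmetric_tensor_add[OF assms(1)] assms(2) tangent_space_sum)

lemma symmetric_tensor_smooth:
  assumes "symmetric_tensor A b" "X \<in> vector_fields A" "Y \<in> vector_fields A"
  shows "(\<lambda>p. b p (X p) (Y p)) \<in> smooth_functions A"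
  using assms by (auto simp: symmetric_tensor_def eval2_def)

end

locale riemannian_manifold = manifold A
  for A :: "('m::{t2_space,second_countable_topology}, 'e::euclidean_space) atlas" +
  fixes h :: "'m \<Rightarrow> 'm tvec \<Rightarrow> 'm tvec \<Rightarrow> real"
  assumes tensor: "symmetric_tensor A h"
    and positive: "\<And>p v. v \<in> tangent_space A p \<Longrightarrow> v \<noteq> 0 \<Longrightarrow> h p v v > 0"
begin

text \<open>The invariant consists of two halves. On the neighbourhood \<open>N\<close> the fields \<open>W b\<close> are orthonormal and
  expand the coordinate fields; at the point \<open>p\<close> alone they lie in the span of the directions already
  treated. The second half ensures that the next residual \<open>F\<close> is nonzero at \<open>p\<close>, hence can be normalised
  nearby.\<close>

lemma gram_schmidt:
  assumes U: "(U, \<phi>) \<in> A" "p \<in> U" and G: "open G" "p \<in> G" "G \<subseteq> U"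
    and E: "\<And>x. E x \<in> vector_fields A" "\<And>x q. q \<in> G \<Longrightarrow> E x q = chart_vector A U \<phi> q x"
    and S: "finite S" "S \<subseteq> Basis"
  shows "\<exists>N W. open N \<and> p \<in> N \<and> N \<subseteq> G \<and>
    (\<forall>b\<in>S. W b \<in> vector_fields A \<and> W b p \<in> chart_vector A U \<phi> p ` span S) \<and>
    (\<forall>q\<in>N. \<forall>b\<in>S. \<forall>c\<in>S. h q (W b q) (W c q) = (if b = c then 1 else 0)) \<and>
    (\<forall>q\<in>N. \<forall>a\<in>S. E a q = (\<Sum>b\<in>S. scale (h q (W b q) (E a q)) (W b q)))"
  using S
proof (induction S rule: finite_induct)
  case empty
  then show ?case using G by blast
next
  case (insert a S)
  have "S \<subseteq> Basis" using insert.prems by simp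
  from insert.IH[OF this] obtain N W where IH: "open N \<and> p \<in> N \<and> N \<subseteq> G \<and>
    (\<forall>b\<in>S. W b \<in> vector_fields A \<and> W b p \<in> chart_vector A U \<phi> p ` span S) \<and>
    (\<forall>q\<in>N. \<forall>b\<in>S. \<forall>c\<in>S. h q (W b q) (W c q) = (if b = c then 1 else 0)) \<and>
    (\<forall>q\<in>N. \<forall>a\<in>S. E a q = (\<Sum>b\<in>S. scale (h q (W b q) (E a q)) (W b q)))"
    by (elim exE) iprover
  then have N: "open N" "p \<in> N" "N \<subseteq> G"
    and W: "\<And>b. b \<in> S \<Longrightarrow> W b \<in> vector_fields A"
    and W_span: "\<forall>b\<in>S. \<exists>x. x \<in> span S \<and> W b p = chart_vector A U \<phi> p x"
    and orth: "\<And>q b c. q \<in> N \<Longrightarrow> b \<in> S \<Longrightarrow> c \<in> S \<Longrightarrow> h q (W b q) (W c q) = (if b = c then 1 else 0)"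
    and exp: "\<And>q a. q \<in> N \<Longrightarrow> a \<in> S \<Longrightarrow> E a q = (\<Sum>b\<in>S. scale (h q (W b q) (E a q)) (W b q))"
    by blast+
  from W_span obtain x where x: "\<forall>b\<in>S. x b \<in> span S \<and> W b p = chart_vector A U \<phi> p (x b)"
    unfolding bchoice_iff by blast
  note Wt = vector_fields_tangent[OF W]
  note Et = vector_fields_tangent[OF E(1)]
  define P where "P q = (\<Sum>b\<in>S. scale (h q (W b q) (E a q)) (W b q))" for q
  define F where "F q = E a q - P q" for q
  have P: "P \<in> vector_fields A" unfolding P_def
    by (rule vector_fields_sum, rule vector_fields_scale[OF symmetric_tensor_smooth[OF tensor W E(1)] W])
  have F: "F \<in> vector_fields A" unfolding F_def by (rule vector_fields_diff[OF E(1) P])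
  note Pt = vector_fields_tangent[OF P]
  note Ft = vector_fields_tangent[OF F]
  have WF: "h q (W b q) (F q) = 0" if "q \<in> N" "b \<in> S" for q b
  proof -
    have "h q (W b q) (P q) = (\<Sum>c\<in>S. h q (W c q) (E a q) * h q (W b q) (W c q))"
      unfolding P_def
      by (simp add: symmetric_tensor_sum(1)[OF tensor Wt[OF that(2)]] tangent_space_scale Wt
          symmetric_tensor_scale[OF tensor _ Wt[OF that(2)]])
    also have "\<dots> = (\<Sum>c\<in>S. if b = c then h q (W c q) (E a q) else 0)"
      by (rule sum.cong) (use orth that in auto)
    also have "\<dots> = h q (W b q) (E a q)" using that insert.hyps(1) by simp
    finally show ?thesis
      unfolding F_def symmetric_tensor_diff[OF tensor Et Pt Wt[OF that(2)]] by simp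
  qed
  define y where "y = (\<Sum>b\<in>S. h p (W b p) (E a p) *\<^sub>R x b)"
  have y: "y \<in> span S" unfolding y_def using x by (intro span_sum span_scale) auto
  have Fp: "F p = chart_vector A U \<phi> p (a - y)"
  proof -
    have "chart_vector A U \<phi> p y = P p"
      unfolding y_def P_def chart_vector_sum[OF U] using x by (intro sum.cong) (auto simp: chart_vector_scale[OF U])
    moreover have "chart_vector A U \<phi> p a = chart_vector A U \<phi> p (a - y) + chart_vector A U \<phi> p y"
      unfolding chart_vector_add[OF U, symmetric] by simp
    ultimately show ?thesis
      unfolding F_def E(2)[OF G(2)] by simp
  qed
  have "F p \<noteq> 0"
  proof
    \<comment> \<open>otherwise \<open>a\<close> would lie in the span of the other basis vectors\<close>
    assume "F p = 0"
    then have "a - y = 0" using chart_vector_injective[OF U] Fp by metis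
    then have "a \<in> span S" using y by simp
    moreover have "S \<subseteq> Basis - {a}" "a \<in> Basis" using insert.hyps insert.prems by auto
    ultimately have "a \<in> span (Basis - {a})" using span_mono by blast
    then show False using independent_Basis \<open>a \<in> Basis\<close> unfolding dependent_def by blast
  qed
  then have pos: "h p (F p) (F p) > 0" by (rule positive[OF Ft])
  obtain \<theta> H where \<theta>: "\<theta> \<in> smooth_functions A" and H: "open H" "p \<in> H"
    and \<theta>F: "\<And>q. q \<in> H \<Longrightarrow> \<theta> q ^ 2 * h q (F q) (F q) = 1"
    by (rule smooth_normaliser[OF symmetric_tensor_smooth[OF tensor F F], of p]) (use pos in auto)
  define V where "V = W(a := (\<lambda>q. scale (\<theta> q) (F q)))"
  have Va: "V a = (\<lambda>q. scale (\<theta> q) (F q))" by (simp add: V_def)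
  have VS: "V b = W b" if "b \<in> S" for b using that insert.hyps by (auto simp: V_def)
  have VaW: "h q (V a q) (W b q) = 0" "h q (W b q) (V a q) = 0" if "q \<in> N" "b \<in> S" for q b
    unfolding Va symmetric_tensor_scale[OF tensor Ft Wt[OF that(2)]]
      symmetric_tensor_commute[OF tensor Ft Wt[OF that(2)]] using WF[OF that] by simp_all
  have PF: "h q (F q) (P q) = 0" if "q \<in> N" for q
    unfolding P_def using WF[OF that]
    by (simp add: symmetric_tensor_sum(1)[OF tensor Ft] tangent_space_scale Wt
        symmetric_tensor_scale[OF tensor _ Ft] symmetric_tensor_commute[OF tensor Ft Wt])
  have "V b \<in> vector_fields A \<and> V b p \<in> chart_vector A U \<phi> p ` span (insert a S)"
    if b: "b \<in> insert a S" for b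
  proof (cases "b = a")
    case True
    have "V a \<in> vector_fields A" unfolding Va by (rule vector_fields_scale[OF \<theta> F])
    moreover have "V a p = chart_vector A U \<phi> p (\<theta> p *\<^sub>R (a - y))"
      unfolding Va Fp chart_vector_scale[OF U] ..
    moreover have "\<theta> p *\<^sub>R (a - y) \<in> span (insert a S)"
      using span_mono[of S "insert a S"] y by (intro span_scale span_diff[OF span_base]) auto
    ultimately show ?thesis using True by blast
  next
    case False
    then have "b \<in> S" using b by simp
    then show ?thesis using W VS x span_mono[of S "insert a S"] by fastforce
  qed
  moreover have "h q (V b q) (V c q) = (if b = c then 1 else 0)"
    if q: "q \<in> N \<inter> H" and "b \<in> insert a S" "c \<in> insert a S" for q b c
  proof -
    have "h q (V a q) (V a q) = \<theta> q * (\<theta> q * h q (F q) (F q))"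
      unfolding Va by (simp add: symmetric_tensor_scale[OF tensor] Ft tangent_space_scale)
    also have "\<dots> = 1" using \<theta>F[of q] q by (simp add: power2_eq_square mult.assoc)
    finally show ?thesis
      using that orth[of q b c] VaW[of q] VS insert.hyps(2) by auto
  qed
  moreover have "E c q = (\<Sum>b\<in>insert a S. scale (h q (V b q) (E c q)) (V b q))"
    if q: "q \<in> N \<inter> H" and c: "c \<in> insert a S" for q c
  proof -
    have split: "(\<Sum>b\<in>insert a S. scale (h q (V b q) (E c q)) (V b q)) =
        scale (h q (V a q) (E c q)) (V a q) + (\<Sum>b\<in>S. scale (h q (W b q) (E c q)) (W b q))"
      using insert.hyps VS by simp
    show ?thesis
    proof (cases "c = a")
      case True
      have EFP: "E a q = F q + P q" by (simp add: F_def)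
      then have "h q (F q) (E a q) = h q (F q) (F q)"
        using PF q by (simp add: symmetric_tensor_add[OF tensor Ft Pt Ft])
      then have "h q (V a q) (E a q) = \<theta> q * h q (F q) (F q)"
        unfolding Va by (simp add: symmetric_tensor_scale[OF tensor Ft Et])
      then have VF: "scale (h q (V a q) (E a q)) (V a q) = F q"
        using \<theta>F[of q] q by (simp add: Va power2_eq_square mult_ac)
      show ?thesis unfolding True split[unfolded True] VF P_def[symmetric] by (rule EFP)
    next
      case False
      then have c': "c \<in> S" using c by simp
      have V_tangent: "V a q \<in> tangent_space A q" unfolding Va by (rule tangent_space_scale[OF Ft])
      have "h q (V a q) (E c q) = h q (V a q) (\<Sum>b\<in>S. scale (h q (W b q) (E c q)) (W b q))"
        by (rule arg_cong[OF exp]) (use q c' in auto)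
      also have "\<dots> = (\<Sum>b\<in>S. h q (W b q) (E c q) * h q (V a q) (W b q))"
        by (simp add: symmetric_tensor_sum(1)[OF tensor V_tangent] tangent_space_scale Wt
            symmetric_tensor_scale[OF tensor _ V_tangent])
      also have "\<dots> = 0" using VaW q by simp
      finally show ?thesis unfolding split using exp[of q c, symmetric] q c' by simp
    qed
  qed
  ultimately have "(\<forall>b\<in>insert a S. V b \<in> vector_fields A \<and> V b p \<in> chart_vector A U \<phi> p ` span (insert a S)) \<and>
    (\<forall>q\<in>N \<inter> H. \<forall>b\<in>insert a S. \<forall>c\<in>insert a S. h q (V b q) (V c q) = (if b = c then 1 else 0)) \<and>
    (\<forall>q\<in>N \<inter> H. \<forall>c\<in>insert a S. E c q = (\<Sum>b\<in>insert a S. scale (h q (V b q) (E c q)) (V b q)))"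
    by simp
  moreover have "open (N \<inter> H)" "p \<in> N \<inter> H" "N \<inter> H \<subseteq> G" using N H by auto
  ultimately show ?case by (intro exI[of _ "N \<inter> H"] exI[of _ V] conjI) (elim conjE, assumption)+
qed

text \<open>Every tangent vector is a combination of coordinate fields, and the expansion is linear in the
  vector.\<close>

lemma local_parseval_frame:
  obtains N W where "open N" "p \<in> N" "\<And>b. b \<in> Basis \<Longrightarrow> W b \<in> vector_fields A"
    "\<And>q v. q \<in> N \<Longrightarrow> v \<in> tangent_space A q \<Longrightarrow> (\<Sum>b\<in>(Basis :: 'e set). scale (h q (W b q) v) (W b q)) = v"
proof -
  obtain U \<phi> where U: "(U, \<phi>) \<in> A" "p \<in> U" by (rule chart_at)
  obtain G E where G: "open G" "p \<in> G" "G \<subseteq> U" and E: "\<And>x. E x \<in> vector_fields A"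
    "\<And>x q. q \<in> G \<Longrightarrow> E x q = chart_vector A U \<phi> q x"
    by (rule chart_vector_extension[OF U]) auto
  have "\<exists>N W. open N \<and> p \<in> N \<and> N \<subseteq> G \<and>
    (\<forall>b\<in>(Basis :: 'e set). W b \<in> vector_fields A \<and> W b p \<in> chart_vector A U \<phi> p ` span Basis) \<and>
    (\<forall>q\<in>N. \<forall>b\<in>Basis. \<forall>c\<in>Basis. h q (W b q) (W c q) = (if b = c then 1 else 0)) \<and>
    (\<forall>q\<in>N. \<forall>a\<in>Basis. E a q = (\<Sum>b\<in>Basis. scale (h q (W b q) (E a q)) (W b q)))"
    (is "\<exists>N W. ?Q N W")
    by (rule gram_schmidt[of U \<phi> p G E Basis, OF U G E(1) E(2) finite_Basis order.refl])
  then obtain N W where N: "?Q N W" by (elim exE) iprover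
  have W: "W b \<in> vector_fields A" if "b \<in> Basis" for b using N that by blast
  note Wt = vector_fields_tangent[OF W]
  have "(\<Sum>b\<in>(Basis :: 'e set). scale (h q (W b q) v) (W b q)) = v" (is "?T v = v")
    if q: "q \<in> N" and v: "v \<in> tangent_space A q" for q v
  proof -
    have T0: "?T 0 = 0"
      by (intro sum.neutral ballI) (simp only: symmetric_tensor_0(2)[OF tensor Wt] scale.scale_zero_left)
    have Tadd: "?T (u + v) = ?T u + ?T v" if "u \<in> tangent_space A q" "v \<in> tangent_space A q" for u v
      unfolding sum.distrib[symmetric]
      by (intro sum.cong refl) (simp only: symmetric_tensor_add(2)[OF tensor that Wt] scale.scale_left_distrib)
    have Tscale: "?T (scale c u) = scale c (?T u)" if "u \<in> tangent_space A q" for c u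
      unfolding scale.scale_sum_right
      by (intro sum.cong refl) (simp only: symmetric_tensor_scale(2)[OF tensor that Wt] scale.scale_scale)
    have "q \<in> U" "q \<in> G" using q N G by blast+
    obtain x where x: "v = chart_vector A U \<phi> q x"
      using v tangent_space_chart[OF U(1) \<open>q \<in> U\<close>] by blast
    have "v = chart_vector A U \<phi> q (\<Sum>b\<in>Basis. (x \<bullet> b) *\<^sub>R b)"
      unfolding x euclidean_representation ..
    also have "\<dots> = (\<Sum>b\<in>Basis. scale (x \<bullet> b) (E b q))"
      by (simp add: chart_vector_sum[OF U(1) \<open>q \<in> U\<close>] chart_vector_scale[OF U(1) \<open>q \<in> U\<close>] E(2)[OF \<open>q \<in> G\<close>])
    finally have v_eq: "v = (\<Sum>b\<in>Basis. scale (x \<bullet> b) (E b q))" .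
    have "?T (\<Sum>b\<in>B. scale (x \<bullet> b) (E b q)) = (\<Sum>b\<in>B. scale (x \<bullet> b) (E b q))" if "B \<subseteq> Basis" for B
      using finite_subset[OF that finite_Basis] that
    proof (induction B rule: finite_induct)
      case empty
      then show ?case using T0 by simp
    next
      case (insert b B)
      have tan: "E b q \<in> tangent_space A q" for b by (rule vector_fields_tangent[OF E(1)])
      have "?T (E b q) = E b q" using N q insert.prems by auto
      moreover have "?T (\<Sum>b\<in>B. scale (x \<bullet> b) (E b q)) = (\<Sum>b\<in>B. scale (x \<bullet> b) (E b q))"
        using insert by blast
      ultimately show ?case
        unfolding sum.insert[OF insert.hyps]
          Tadd[OF tangent_space_scale[OF tan] tangent_space_sum[OF tangent_space_scale[OF tan]]] Tscale[OF tan]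
        by (simp only:)
    qed
    then show ?thesis unfolding v_eq by blast
  qed
  then show thesis using that N W by blast
qed


text \<open>Gluing without a locally finite refinement: enumerate countably many of the neighbourhoods
  on which a cut-off \<open>w\<close> vanishes, and weight the \<open>n\<close>-th local frame with \<open>u n * (\<Prod>j<n. w j)\<close>. On
  the \<open>n\<close>-th neighbourhood all later weights vanish, and \<open>u\<^sup>2 + w\<^sup>2 = 1\<close> makes the sum of the
  squared weights telescope to 1. Squares are what is wanted, because each frame vector occurs twice
  in the expansion of a tangent vector.\<close>

lemma parseval_frame:
  obtains I :: "'m \<Rightarrow> (nat \<times> 'e) set" and e :: "nat \<times> 'e \<Rightarrow> 'm vfield"
  where "\<And>i. e i \<in> vector_fields A" "\<And>p. finite (I p)"
    "\<And>p. \<exists>N. open N \<and> p \<in> N \<and> (\<forall>q\<in>N. \<forall>i. i \<notin> I p \<longrightarrow> e i q = 0)"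
    "\<And>p v. v \<in> tangent_space A p \<Longrightarrow> (\<Sum>i\<in>I p. scale (h p (e i p) v) (e i p)) = v"
proof -
  define Q where "Q p u w G W \<longleftrightarrow> u \<in> smooth_functions A \<and> w \<in> smooth_functions A \<and> open G \<and> p \<in> G \<and>
      (\<forall>q. u q * u q + w q * w q = 1) \<and> (\<forall>q\<in>G. w q = 0) \<and> (\<forall>b\<in>Basis. W b \<in> vector_fields A) \<and>
      (\<forall>q v. u q \<noteq> 0 \<longrightarrow> v \<in> tangent_space A q \<longrightarrow> (\<Sum>b\<in>Basis. scale (h q (W b q) v) (W b q)) = v)"
    for p u w G and W :: "'e \<Rightarrow> 'm vfield"
  have "\<exists>u w G W. Q p u w G W" for p
  proof -
    obtain N W where N: "open N" "p \<in> N" and W: "\<And>b. b \<in> Basis \<Longrightarrow> W b \<in> vector_fields A"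
      "\<And>q v. q \<in> N \<Longrightarrow> v \<in> tangent_space A q \<Longrightarrow> (\<Sum>b\<in>(Basis :: 'e set). scale (h q (W b q) v) (W b q)) = v"
      by (rule local_parseval_frame[of p]) auto
    obtain u w K G where u: "u \<in> smooth_functions A" "w \<in> smooth_functions A" "compact K" "K \<subseteq> N"
      "open G" "p \<in> G" "G \<subseteq> N" "\<And>q. u q ^ 2 + w q ^ 2 = 1" "\<And>q. q \<notin> K \<Longrightarrow> u q = 0"
      "\<And>q. q \<in> G \<Longrightarrow> w q = (0::real)"
      by (rule smooth_cutoff[OF N]) auto
    have "q \<in> N" if "u q \<noteq> 0" for q using u(4,9) that by blast
    then have "Q p u w G W" unfolding Q_def
      using u W by (auto simp: power2_eq_square)
    then show ?thesis by (intro exI)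
  qed
  then obtain u w G W where Q: "\<And>p. Q p (u p) (w p) (G p) (W p)" by metis
  have u: "u p \<in> smooth_functions A" and w: "w p \<in> smooth_functions A" and G: "open (G p)" "p \<in> G p"
    and uw: "u p q * u p q + w p q * w p q = 1" and wG: "q \<in> G p \<Longrightarrow> w p q = 0"
    and W: "b \<in> Basis \<Longrightarrow> W p b \<in> vector_fields A"
    and parseval: "u p q \<noteq> 0 \<Longrightarrow> v \<in> tangent_space A q \<Longrightarrow>
      (\<Sum>b\<in>Basis. scale (h q (W p b q) v) (W p b q)) = v" for p q b v
    using Q[of p] unfolding Q_def by auto
  obtain F where F: "F \<subseteq> range G" "countable F" "\<Union>F = \<Union>(range G)"
    by (rule Lindelof[of "range G"]) (use G in auto)
  then obtain C where C: "countable C" "F = G ` C"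
    by (metis countable_subset_image)
  have "\<Union>(range G) = UNIV" using G(2) by auto
  then have cover: "\<Union>(G ` C) = UNIV" using F(3) C(2) by simp
  then have "C \<noteq> {}" by auto
  define s where "s = from_nat_into C"
  have "range s = C" unfolding s_def by (rule range_from_nat_into[OF \<open>C \<noteq> {}\<close> C(1)])
  then have "\<forall>q. \<exists>n. q \<in> G (s n)" using cover by (metis UN_E UNIV_I imageE)
  then obtain k where k: "\<And>q. q \<in> G (s (k q))" by metis
  define \<beta> where "\<beta> n q = (\<Prod>j<n. w (s j) q)" for n q
  have \<beta>: "\<beta> n \<in> smooth_functions A" for n
    unfolding \<beta>_def by (rule smooth_functions_prod) (rule w)
  have \<beta>_0: "\<beta> n q = 0" if "q \<in> G (s (k p))" "n > k p" for n q p
    unfolding \<beta>_def by (rule prod_zero) (use wG that in auto)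
  define e where "e = (\<lambda>(n, b). if b \<in> Basis then (\<lambda>q. scale (\<beta> n q * u (s n) q) (W (s n) b q)) else (\<lambda>q. 0))"
  define I where "I q = {..k q} \<times> (Basis :: 'e set)" for q
  show thesis
  proof
    show "e i \<in> vector_fields A" for i
      unfolding e_def
      by (cases i) (simp add: vector_fields_0 vector_fields_scale[OF smooth_functions_mult[OF \<beta> u] W])
    show "finite (I p)" for p by (simp add: I_def)
    show "\<exists>N. open N \<and> p \<in> N \<and> (\<forall>q\<in>N. \<forall>i. i \<notin> I p \<longrightarrow> e i q = 0)" for p
    proof (intro exI conjI ballI allI impI)
      show "open (G (s (k p)))" "p \<in> G (s (k p))" using G k by auto
      show "e i q = 0" if "q \<in> G (s (k p))" "i \<notin> I p" for q i
        using that \<beta>_0[OF that(1), of "fst i"] by (cases i) (auto simp: e_def I_def)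
    qed
    show "(\<Sum>i\<in>I p. scale (h p (e i p) v) (e i p)) = v" if v: "v \<in> tangent_space A p" for p v
    proof -
      have summand: "(\<Sum>b\<in>Basis. scale (h p (e (n, b) p) v) (e (n, b) p)) =
          scale (\<beta> n p * \<beta> n p - \<beta> (Suc n) p * \<beta> (Suc n) p) v" for n
      proof -
        let ?c = "\<beta> n p * u (s n) p"
        have "(\<Sum>b\<in>Basis. scale (h p (e (n, b) p) v) (e (n, b) p)) =
            (\<Sum>b\<in>Basis. scale (?c * ?c) (scale (h p (W (s n) b p) v) (W (s n) b p)))"
        proof (rule sum.cong)
          fix b :: 'e assume "b \<in> Basis"
          then show "scale (h p (e (n, b) p) v) (e (n, b) p) =
              scale (?c * ?c) (scale (h p (W (s n) b p) v) (W (s n) b p))"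
            using symmetric_tensor_scale(1)[OF tensor vector_fields_tangent[OF W] v]
            by (simp add: e_def mult_ac)
        qed simp
        also have "\<dots> = scale (?c * ?c) v"
          unfolding scale.scale_sum_right[symmetric] using parseval[OF _ v] by (cases "u (s n) p = 0") auto
        also have "?c * ?c = \<beta> n p * \<beta> n p * (1 - w (s n) p * w (s n) p)"
          unfolding uw[of "s n" p, symmetric] by (simp add: mult_ac)
        also have "\<dots> = \<beta> n p * \<beta> n p - \<beta> (Suc n) p * \<beta> (Suc n) p"
          by (simp add: \<beta>_def algebra_simps)
        finally show ?thesis .
      qed
      have "(\<Sum>i\<in>I p. scale (h p (e i p) v) (e i p)) =
          (\<Sum>n<Suc (k p). \<Sum>b\<in>Basis. scale (h p (e (n, b) p) v) (e (n, b) p))"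
        unfolding I_def lessThan_Suc_atMost by (simp add: sum.cartesian_product)
      also have "\<dots> = (\<Sum>n<Suc (k p). scale (\<beta> n p * \<beta> n p - \<beta> (Suc n) p * \<beta> (Suc n) p) v)"
        by (rule sum.cong) (simp_all only: summand)
      also have "\<dots> = scale (\<Sum>n<Suc (k p). \<beta> n p * \<beta> n p - \<beta> (Suc n) p * \<beta> (Suc n) p) v"
        by (rule scale.scale_sum_left[symmetric])
      also have "(\<Sum>n<Suc (k p). \<beta> n p * \<beta> n p - \<beta> (Suc n) p * \<beta> (Suc n) p) = 1"
        using sum_lessThan_telescope'[of "\<lambda>n. \<beta> n p * \<beta> n p" "Suc (k p)"] \<beta>_0[OF k lessI, of p]
        by (simp only:) (simp add: \<beta>_def[of 0])
      finally show ?thesis by simp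
    qed
  qed
qed

end

section \<open>Covectors\<close>

lemma sum_fun_apply: "(\<Sum>i\<in>J. F i) x = (\<Sum>i\<in>J. F i x)"
  by (induction J rule: infinite_finite_induct) auto

context manifold
begin

lemma cotangent_linear:
  assumes "\<xi> \<in> cotangent_space A p" "u \<in> tangent_space A p"
  shows "v \<in> tangent_space A p \<Longrightarrow> \<xi> (u + v) = \<xi> u + \<xi> v" "\<xi> (scale c u) = c * \<xi> u"
  using assms by (auto simp: cotangent_space_def linear_functional_on_def)

lemma cotangent_outside: "\<xi> \<in> cotangent_space A p \<Longrightarrow> v \<notin> tangent_space A p \<Longrightarrow> \<xi> v = 0"
  by (simp add: cotangent_space_def)

lemma cotangent_0: "\<xi> \<in> cotangent_space A p \<Longrightarrow> \<xi> 0 = 0"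
  using cotangent_linear(2)[OF _ tangent_space_0, of \<xi> p 0] by simp

lemma cotangent_diff:
  assumes "\<xi> \<in> cotangent_space A p" "u \<in> tangent_space A p" "v \<in> tangent_space A p"
  shows "\<xi> (u - v) = \<xi> u - \<xi> v"
proof -
  have "\<xi> (u + scale (- 1) v) = \<xi> u + - 1 * \<xi> v"
    unfolding cotangent_linear(1)[OF assms(1,2) tangent_space_scale[OF assms(3)]]
      cotangent_linear(2)[OF assms(1,3)] ..
  then show ?thesis by simp
qed

lemma cotangent_sum:
  assumes "\<xi> \<in> cotangent_space A p" "\<And>i. i \<in> I \<Longrightarrow> u i \<in> tangent_space A p"
  shows "\<xi> (\<Sum>i\<in>I. u i) = (\<Sum>i\<in>I. \<xi> (u i))"
  using assms(2)
  by (induction I rule: infinite_finite_induct)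
    (simp_all only: sum.infinite sum.empty sum.insert cotangent_0[OF assms(1)] simp_thms
      cotangent_linear(1)[OF assms(1)] tangent_space_sum insert_iff)

lemma cotangent_space_add:
  assumes "\<xi> \<in> cotangent_space A p" "\<eta> \<in> cotangent_space A p"
  shows "\<xi> + \<eta> \<in> cotangent_space A p"
  using assms by (auto simp: cotangent_space_def linear_functional_on_def algebra_simps)

lemma cotangent_space_scale:
  assumes "\<xi> \<in> cotangent_space A p"
  shows "scale c \<xi> \<in> cotangent_space A p"
  using assms by (auto simp: cotangent_space_def linear_functional_on_def scale_def[of c] algebra_simps)

lemma cotangent_space_0: "0 \<in> cotangent_space A p"
  by (auto simp: cotangent_space_def linear_functional_on_def)

lemma cotangent_space_sum:
  assumes "\<And>i. i \<in> I \<Longrightarrow> \<xi> i \<in> cotangent_space A p"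
  shows "(\<Sum>i\<in>I. \<xi> i) \<in> cotangent_space A p"
  using assms
  by (induction I rule: infinite_finite_induct) (auto intro: cotangent_space_0 cotangent_space_add)

lemma differential_apply: "v \<in> tangent_space A p \<Longrightarrow> differential A f p v = v f"
  by (simp add: differential_def)

text \<open>Differentials of smooth functions already separate tangent vectors.\<close>

lemma one_forms_separate:
  assumes "u \<in> tangent_space A p" "v \<in> tangent_space A p"
    "\<And>\<beta>. \<beta> \<in> one_forms A \<Longrightarrow> \<beta> p u = \<beta> p v"
  shows "u = v"
proof (rule tangent_vector_eqI[OF assms(1,2)])
  show "u f = v f" if "f \<in> smooth_functions A" for f
    using assms(3)[OF differential_one_form[OF that]] by (simp add: differential_apply assms)
qed

end

section \<open>The Carroll vector field and horizontal frames\<close>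

sublocale carrollian_bundle \<subseteq> manifold A
  using principal_bundle by unfold_locales (simp add: principal_R_bundle_def)

context carrollian_bundle
begin

abbreviation \<kappa> where "\<kappa> \<equiv> fundamental_vector_field A act"

lemma act_0: "act 0 x = x"
  using principal_bundle by (simp add: principal_R_bundle_def)

lemma act_continuous: "continuous_on UNIV (\<lambda>z. act (fst z) (snd z))"
  using principal_bundle by (simp add: principal_R_bundle_def smooth_map_on_def case_prod_unfold)

text \<open>The action in charts. The inverse of a product chart is the product of the inverses, which brings the
  smoothness of the action into the form of a function of time and coordinates.\<close>

lemma act_chart:
  assumes U: "(U, \<phi>) \<in> A" and V: "(V, \<psi>) \<in> A"
  defines "Z \<equiv> (UNIV \<times> \<phi> ` U) \<inter> (\<lambda>z. act (fst z) (inv_into U \<phi> (snd z))) -` V"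
  shows "open Z" "smooth_on Z (\<lambda>z. \<psi> (act (fst z) (inv_into U \<phi> (snd z))))"
proof -
  have "continuous_on (UNIV \<times> \<phi> ` U) (\<lambda>z. (fst z, inv_into U \<phi> (snd z)))"
    by (intro continuous_on_Pair continuous_on_fst continuous_on_id
        continuous_on_compose2[OF chart_continuous(2)[OF U] continuous_on_snd]) auto
  then have cont: "continuous_on (UNIV \<times> \<phi> ` U) (\<lambda>z. act (fst z) (inv_into U \<phi> (snd z)))"
    using continuous_on_compose2[OF act_continuous] by fastforce
  show Z: "open Z" unfolding Z_def
    by (rule continuous_open_preimage[OF cont open_Times[OF open_UNIV chart_homeomorphism(2)[OF U]]
          chart_homeomorphism(1)[OF V]])
  let ?c = "map_prod (\<lambda>t::real. t) \<phi>"
  have inj: "inj_on ?c (UNIV \<times> U)"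
    using U by (auto intro!: inj_onI) (metis chart_inv)
  have inv: "inv_into (UNIV \<times> U) ?c (t, x) = (t, inv_into U \<phi> x)" if "x \<in> \<phi> ` U" for t x
  proof -
    have "(t, x) = ?c (t, inv_into U \<phi> x)" using f_inv_into_f[OF that] by simp
    then show ?thesis using inv_into_f_f[OF inj] inv_into_into[OF that] by (metis SigmaI UNIV_I)
  qed
  have "(UNIV \<times> U, ?c) \<in> prod_atlas euclidean_atlas A"
    unfolding prod_atlas_def euclidean_atlas_def using U by blast
  then have "smooth_on (?c ` (UNIV \<times> U \<inter> UNIV \<inter> (\<lambda>(t, x). act t x) -` V))
      (\<psi> \<circ> (\<lambda>(t, x). act t x) \<circ> inv_into (UNIV \<times> U) ?c)"
    using principal_bundle V unfolding principal_R_bundle_def smooth_map_on_def by fastforce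
  moreover have "?c ` (UNIV \<times> U \<inter> UNIV \<inter> (\<lambda>(t, x). act t x) -` V) = Z"
  proof (intro set_eqI iffI)
    fix z assume "z \<in> ?c ` (UNIV \<times> U \<inter> UNIV \<inter> (\<lambda>(t, x). act t x) -` V)"
    then show "z \<in> Z" unfolding Z_def using U by auto
  next
    fix z assume z: "z \<in> Z"
    then have "snd z \<in> \<phi> ` U" by (auto simp: Z_def)
    then have "z = ?c (fst z, inv_into U \<phi> (snd z))" "inv_into U \<phi> (snd z) \<in> U"
      by (auto simp: f_inv_into_f inv_into_into prod_eq_iff)
    moreover have "act (fst z) (inv_into U \<phi> (snd z)) \<in> V" using z by (auto simp: Z_def)
    ultimately show "z \<in> ?c ` (UNIV \<times> U \<inter> UNIV \<inter> (\<lambda>(t, x). act t x) -` V)"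
      by (intro image_eqI) auto
  qed
  ultimately have "smooth_on Z (\<psi> \<circ> (\<lambda>(t, x). act t x) \<circ> inv_into (UNIV \<times> U) ?c)"
    by simp
  then show "smooth_on Z (\<lambda>z. \<psi> (act (fst z) (inv_into U \<phi> (snd z))))"
    by (rule smooth_on_cong[OF Z, rotated]) (auto simp: Z_def inv)
qed

lemma carroll_field_tangent: "\<kappa> p \<in> tangent_space A p"
proof -
  have cont: "continuous_on {-1<..<1} (\<lambda>t. act t p)"
    using continuous_on_compose2[OF act_continuous, of "{-1<..<1}" "\<lambda>t. (t, p)"]
    by (simp add: continuous_on_Pair continuous_on_id continuous_on_const)
  obtain U \<phi> where U: "(U, \<phi>) \<in> A" "p \<in> U" by (rule chart_at)
  have "smooth_on ({-1<..<1} \<inter> (\<lambda>t. act t p) -` V) (\<lambda>t. \<psi> (act t p))" if V: "(V, \<psi>) \<in> A" for V \<psi>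
  proof -
    have S: "open ({-1<..<1} \<inter> (\<lambda>t. act t p) -` V)"
      by (rule continuous_open_preimage[OF cont open_greaterThanLessThan chart_homeomorphism(1)[OF V]])
    have "bounded_linear (\<lambda>t::real. (t, 0 :: 'e))"
      by (intro bounded_linear_Pair bounded_linear_ident bounded_linear_zero)
    then have "smooth_on ({-1<..<1} \<inter> (\<lambda>t. act t p) -` V) (\<lambda>t. (t, 0) + (0, \<phi> p))"
      by (rule smooth_on_add[OF S smooth_on_bounded_linear[OF S] smooth_on_const[OF S]])
    from smooth_on_compose[OF S act_chart(1)[OF U(1) V] this act_chart(2)[OF U(1) V]]
    show ?thesis using U by (simp add: image_subset_iff)
  qed
  then have "smooth_map_on euclidean_atlas A {-1<..<1} (\<lambda>t. act t p)"
    unfolding smooth_map_on_def euclidean_atlas_def using cont by (auto simp: comp_def)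
  then show ?thesis
    unfolding tangent_space_def fundamental_vector_field_def using act_0[of p]
    by (intro CollectI exI[of _ "\<lambda>t. act t p"] exI[of _ 1]) auto
qed

text \<open>In a chart, the derivative along the Carroll field is the partial derivative in the time
  direction, at time zero, of a function that is smooth in time and position jointly.\<close>

lemma carroll_field: "\<kappa> \<in> vector_fields A"
proof (rule vector_fieldsI[OF carroll_field_tangent])
  fix f assume f: "f \<in> smooth_functions A"
  show "(\<lambda>p. \<kappa> p f) \<in> smooth_functions A"
  proof (rule smooth_functions_all_charts)
    fix U \<phi> assume U: "(U, \<phi>) \<in> A" and oU: "open (\<phi> ` U)"
    let ?Z = "(UNIV \<times> \<phi> ` U) \<inter> (\<lambda>z. act (fst z) (inv_into U \<phi> (snd z))) -` U"
    let ?H = "\<lambda>z. f (act (fst z) (inv_into U \<phi> (snd z)))"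
    have Z0: "(0, x) \<in> ?Z" if "x \<in> \<phi> ` U" for x
      using that act_0 inv_into_into[OF that] by auto
    have Z: "open ?Z" by (rule act_chart(1)[OF U U])
    have "smooth_on ?Z (\<lambda>z. f (inv_into U \<phi> (\<phi> (act (fst z) (inv_into U \<phi> (snd z))))))"
      by (rule smooth_on_compose[OF Z oU act_chart(2)[OF U U] smooth_functionsD[OF f U]]) auto
    then have H: "smooth_on ?Z ?H"
      by (rule smooth_on_cong[OF Z, rotated]) (simp add: chart_inv[OF U])
    have L: "bounded_linear (\<lambda>x::'e. (0::real, x))"
      by (intro bounded_linear_Pair bounded_linear_ident bounded_linear_zero)
    have "smooth_on (\<phi> ` U) (\<lambda>x. frechet_derivative ?H (at (0, x)) (1, 0))"
      by (rule smooth_on_compose[OF oU Z smooth_on_bounded_linear[OF oU L]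
            smooth_on_frechet_derivative[OF H]]) (use Z0 in auto)
    moreover have "frechet_derivative ?H (at (0, x)) (1, 0) = \<kappa> (inv_into U \<phi> x) f" if x: "x \<in> \<phi> ` U" for x
    proof -
      have D: "(?H has_derivative frechet_derivative ?H (at (0, x))) (at (0, x))"
        by (rule smooth_on_has_derivative[OF H Z0[OF x]])
      have "((\<lambda>t::real. (t, x)) has_derivative (\<lambda>t. (t, 0))) (at 0)"
        by (intro has_derivative_Pair has_derivative_ident has_derivative_const)
      from has_derivative_compose[OF this D]
      have 1: "((\<lambda>t. f (act t (inv_into U \<phi> x))) has_derivative
          (\<lambda>t. frechet_derivative ?H (at (0, x)) (t, 0))) (at 0)"
        by simp
      have lin: "frechet_derivative ?H (at (0, x)) (t, 0) = frechet_derivative ?H (at (0, x)) (1, 0) * t" for t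
        using linear_scale[OF has_derivative_linear[OF D], of t "(1, 0)"] by simp
      have "((\<lambda>t. f (act t (inv_into U \<phi> x))) has_real_derivative
          frechet_derivative ?H (at (0, x)) (1, 0)) (at 0)"
        unfolding has_field_derivative_def by (rule has_derivative_eq_rhs[OF 1], rule ext, rule lin)
      then show ?thesis
        using f by (simp add: fundamental_vector_field_def velocity_def DERIV_imp_deriv)
    qed
    ultimately show "smooth_on (\<phi> ` U) (\<lambda>x. \<kappa> (inv_into U \<phi> x) f)"
      by (rule smooth_on_cong[OF oU, rotated])
  qed
qed

text \<open>The kernel condition concerns vector fields; it becomes pointwise because \<open>\<kappa>\<close> is a smooth vertical field
  and every tangent vector extends to a vector field.\<close>

lemma metric_carroll_field:
  assumes "v \<in> tangent_space A p"
  shows "g p (\<kappa> p) v = 0"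
proof -
  have fib: "\<pi> (act t x) = \<pi> x" for t x
    using principal_bundle by (simp add: principal_R_bundle_def)
  have "pushforward B \<pi> (\<kappa> q) = 0" for q
    by (auto simp: pushforward_def fundamental_vector_field_def velocity_def fib fun_eq_iff)
  then have "\<kappa> \<in> metric_kernel A g"
    unfolding metric_ker vertical_vector_fields_def vertical_space_def
    using carroll_field carroll_field_tangent by auto
  moreover obtain X where X: "X \<in> vector_fields A" "X p = v"
    by (rule tangent_vector_extension[OF assms])
  ultimately have "eval2 g \<kappa> X = 0" by (simp add: metric_kernel_def)
  then have "eval2 g \<kappa> X p = 0" by simp
  then show ?thesis using X(2) by (simp add: eval2_def)
qed

lemma clock_carroll_field: "\<tau> p (\<kappa> p) = 1"
proof -
  have "pairing \<tau> \<kappa> p = 1" unfolding clock_normalised by simp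
  then show ?thesis by (simp add: pairing_def)
qed

definition horizontal :: "'m \<Rightarrow> 'm tvec \<Rightarrow> 'm tvec" where
  "horizontal p v = v - scale (\<tau> p v) (\<kappa> p)"

lemmas clock_linear = cotangent_linear[OF one_forms_cotangent[OF clock]]

lemma horizontal_tangent: "v \<in> tangent_space A p \<Longrightarrow> horizontal p v \<in> tangent_space A p"
  by (simp only: horizontal_def tangent_space_diff tangent_space_scale carroll_field_tangent)

lemma clock_horizontal:
  assumes "v \<in> tangent_space A p"
  shows "\<tau> p (horizontal p v) = 0"
  unfolding horizontal_def
    cotangent_diff[OF one_forms_cotangent[OF clock] assms tangent_space_scale[OF carroll_field_tangent]]
    clock_linear(2)[OF carroll_field_tangent] clock_carroll_field by simp

lemma metric_horizontal:
  assumes "u \<in> tangent_space A p" "v \<in> tangent_space A p"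
  shows "g p (horizontal p u) v = g p u v" "g p v (horizontal p u) = g p v u"
proof -
  show 1: "g p (horizontal p u) v = g p u v"
    unfolding horizontal_def
      symmetric_tensor_diff(1)[OF metric assms(1) tangent_space_scale[OF carroll_field_tangent] assms(2)]
      symmetric_tensor_scale(1)[OF metric carroll_field_tangent assms(2)] metric_carroll_field[OF assms(2)]
    by simp
  show "g p v (horizontal p u) = g p v u"
    using 1 symmetric_tensor_commute[OF metric assms(2) horizontal_tangent[OF assms(1)]]
      symmetric_tensor_commute[OF metric assms(2,1)] by simp
qed

lemma horizontal_linear:
  assumes "u \<in> tangent_space A p"
  shows "v \<in> tangent_space A p \<Longrightarrow> horizontal p (u + v) = horizontal p u + horizontal p v"
    "horizontal p (scale c u) = scale c (horizontal p u)"
  unfolding horizontal_def clock_linear(2)[OF assms]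
  by (simp_all only: clock_linear(1)[OF assms] scale.scale_left_distrib scale.scale_right_diff_distrib
      scale.scale_scale) (simp add: fun_eq_iff)

lemma horizontal_sum:
  assumes "\<And>i. i \<in> I \<Longrightarrow> u i \<in> tangent_space A p"
  shows "horizontal p (\<Sum>i\<in>I. u i) = (\<Sum>i\<in>I. horizontal p (u i))"
proof -
  have "horizontal p (scale 0 0) = 0"
    unfolding horizontal_linear(2)[OF tangent_space_0] by (rule scale.scale_zero_left)
  then have 0: "horizontal p 0 = 0" unfolding scale.scale_zero_left .
  show ?thesis using assms
    by (induction I rule: infinite_finite_induct)
      (simp_all only: sum.infinite sum.empty sum.insert 0 simp_thms horizontal_linear(1) tangent_space_sum insert_iff)
qed

lemma horizontal_horizontal:
  assumes "v \<in> tangent_space A p"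
  shows "horizontal p (horizontal p v) = horizontal p v"
  unfolding horizontal_def[of p "horizontal p v"] clock_horizontal[OF assms]
  by (simp only: scale.scale_zero_left diff_zero)

lemma horizontal_field:
  assumes "X \<in> vector_fields A"
  shows "(\<lambda>p. horizontal p (X p)) \<in> vector_fields A"
  unfolding horizontal_def
  by (rule vector_fields_diff[OF assms vector_fields_scale[OF one_forms_smooth[OF clock assms] carroll_field]])

text \<open>Adding the square of the clock form completes the degenerate metric to a Riemannian metric for
  which \<open>\<kappa>\<close> is the unit normal of the horizontal spaces.\<close>

lemma riemannian_completion: "riemannian_manifold A (\<lambda>p u v. g p u v + \<tau> p u * \<tau> p v)"
proof unfold_locales
  show "symmetric_tensor A (\<lambda>p u v. g p u v + \<tau> p u * \<tau> p v)"
    unfolding symmetric_tensor_def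
  proof (intro conjI allI ballI)
    show "bilinear_form_on (tangent_space A p) (\<lambda>u v. g p u v + \<tau> p u * \<tau> p v)" for p
      unfolding bilinear_form_on_def linear_functional_on_def
      by (auto simp only: symmetric_tensor_add[OF metric] symmetric_tensor_scale[OF metric]
          clock_linear) (simp_all add: algebra_simps)
    show "g p u v + \<tau> p u * \<tau> p v = g p v u + \<tau> p v * \<tau> p u"
      if "u \<in> tangent_space A p" "v \<in> tangent_space A p" for p u v
      using symmetric_tensor_commute[OF metric that] by simp
    show "eval2 (\<lambda>p u v. g p u v + \<tau> p u * \<tau> p v) X Y \<in> smooth_functions A"
      if "X \<in> vector_fields A" "Y \<in> vector_fields A" for X Y
      unfolding eval2_def using that
      by (simp add: smooth_functions_add symmetric_tensor_smooth[OF metric] smooth_functions_mult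
          one_forms_smooth[OF clock])
  qed
  show "g p v v + \<tau> p v * \<tau> p v > 0" if v: "v \<in> tangent_space A p" "v \<noteq> 0" for p v
  proof (cases "horizontal p v = 0")
    case True
    then have v_eq: "v = scale (\<tau> p v) (\<kappa> p)" by (simp add: horizontal_def)
    then have "\<tau> p v \<noteq> 0" using v(2) by (metis scale.scale_zero_left)
    moreover have "g p v v = 0"
      using metric_horizontal(1)[OF v(1,1)] True symmetric_tensor_0(1)[OF metric v(1)] by simp
    ultimately show ?thesis using not_real_square_gt_zero by (metis add_0)
  next
    case False
    then have "g p (horizontal p v) (horizontal p v) > 0"
      using metric_pos horizontal_tangent clock_horizontal v(1) by blast
    then have "g p v v > 0"
      using metric_horizontal[OF v(1)] horizontal_tangent[OF v(1)] v(1) by metis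
    then show ?thesis by (simp add: add_pos_nonneg)
  qed
qed

text \<open>Project a Parseval frame \<open>e\<close> of \<open>g + \<tau>\<^sup>2\<close> along \<open>\<kappa>\<close>. For horizontal \<open>v\<close> the
  coefficients in the expansion of \<open>v\<close> are \<open>g(e i, v)\<close>, since \<open>\<tau>(v) = 0\<close>, and the projection leaves them
  unchanged, since \<open>g(\<kappa>, -) = 0\<close>.\<close>

lemma carroll_frame:
  obtains I :: "'m \<Rightarrow> (nat \<times> 'e) set" and e :: "nat \<times> 'e \<Rightarrow> 'm vfield"
  where "\<And>i. e i \<in> vector_fields A" "\<And>i p. \<tau> p (e i p) = 0" "\<And>p. finite (I p)"
    "\<And>p. \<exists>N. open N \<and> p \<in> N \<and> (\<forall>q\<in>N. \<forall>i. i \<notin> I p \<longrightarrow> e i q = 0)"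
    "\<And>p v. v \<in> tangent_space A p \<Longrightarrow>
      (\<Sum>i\<in>I p. scale (g p (e i p) v) (e i p)) + scale (\<tau> p v) (\<kappa> p) = v"
proof -
  obtain I :: "'m \<Rightarrow> (nat \<times> 'e) set" and e :: "nat \<times> 'e \<Rightarrow> 'm vfield"
    where e: "\<And>i. e i \<in> vector_fields A" and I: "\<And>p. finite (I p)"
    and loc: "\<And>p. \<exists>N. open N \<and> p \<in> N \<and> (\<forall>q\<in>N. \<forall>i. i \<notin> I p \<longrightarrow> e i q = 0)"
    and exp: "\<And>p v. v \<in> tangent_space A p \<Longrightarrow>
      (\<Sum>i\<in>I p. scale (g p (e i p) v + \<tau> p (e i p) * \<tau> p v) (e i p)) = v"
    by (rule riemannian_manifold.parseval_frame[OF riemannian_completion]) auto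
  note et = vector_fields_tangent[OF e]
  show thesis
  proof
    show "(\<lambda>p. horizontal p (e i p)) \<in> vector_fields A" for i by (rule horizontal_field[OF e])
    show "\<tau> p (horizontal p (e i p)) = 0" for i p by (rule clock_horizontal[OF et])
    show "finite (I p)" for p by (rule I)
    have 0: "horizontal p 0 = 0" for p using horizontal_sum[of "{}" "\<lambda>_. 0" p] by simp
    show "\<exists>N. open N \<and> p \<in> N \<and> (\<forall>q\<in>N. \<forall>i. i \<notin> I p \<longrightarrow> horizontal q (e i q) = 0)" for p
      using loc[of p] 0 by metis
    show "(\<Sum>i\<in>I p. scale (g p (horizontal p (e i p)) v) (horizontal p (e i p))) + scale (\<tau> p v) (\<kappa> p) = v"
      if v: "v \<in> tangent_space A p" for p v
    proof -
      note hv = horizontal_tangent[OF v]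
      have "horizontal p (horizontal p v) = horizontal p (\<Sum>i\<in>I p. scale (g p (e i p) (horizontal p v)
          + \<tau> p (e i p) * \<tau> p (horizontal p v)) (e i p))"
        by (rule arg_cong[OF exp[OF hv, symmetric]])
      also have "\<dots> = (\<Sum>i\<in>I p. scale (g p (horizontal p (e i p)) v) (horizontal p (e i p)))"
        by (subst horizontal_sum)
          (simp_all only: tangent_space_scale et horizontal_linear(2) clock_horizontal[OF v] mult_zero_right
            add_0_right metric_horizontal[OF et v] metric_horizontal[OF v et])
      finally have "horizontal p v = (\<Sum>i\<in>I p. scale (g p (horizontal p (e i p)) v) (horizontal p (e i p)))"
        unfolding horizontal_horizontal[OF v] .
      then show ?thesis unfolding horizontal_def[of p v] by (simp only: diff_eq_eq)
    qed
  qed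
qed

end

section \<open>The connection defined by a horizontal frame\<close>

text \<open>The frame is assumed here, so that everything below is a calculation with its expansion formula. The
  fields with index outside \<open>I p\<close> vanish on a common neighbourhood of \<open>p\<close>.\<close>

locale carrollian_frame = carrollian_bundle A B \<pi> act g \<tau>
  for A :: "('m::{t2_space,second_countable_topology}, 'e::euclidean_space) atlas"
    and B :: "('b::{t2_space,second_countable_topology}, 'f::real_normed_vector) atlas"
    and \<pi> act g \<tau> +
  fixes P :: "'m \<Rightarrow> 'm covec \<Rightarrow> 'm covec \<Rightarrow> real"
    and I :: "'m \<Rightarrow> 'i set" and e :: "'i \<Rightarrow> 'm vfield"
  assumes bivector: "bivector_field A P"
    and frame: "\<And>i. e i \<in> vector_fields A"
    and frame_horizontal: "\<And>i p. \<tau> p (e i p) = 0"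
    and finite_indices: "\<And>p. finite (I p)"
    and locally_finite: "\<And>p. \<exists>N. open N \<and> p \<in> N \<and> (\<forall>q\<in>N. \<forall>i. i \<notin> I p \<longrightarrow> e i q = 0)"
    and frame_expansion: "\<And>p v. v \<in> tangent_space A p \<Longrightarrow>
      (\<Sum>i\<in>I p. scale (g p (e i p) v) (e i p)) + scale (\<tau> p v) (\<kappa> p) = v"
begin

lemmas frame_tangent = vector_fields_tangent[OF frame]
lemmas clock_cotangent = one_forms_cotangent[OF clock]

text \<open>Near a point, a sum over the moving index set is a sum over a fixed finite one.\<close>

lemma frame_sum_local:
  obtains N where "open N" "p \<in> N"
    "\<And>q F. q \<in> N \<Longrightarrow> (\<And>i. e i q = 0 \<Longrightarrow> F i = (0::'z::comm_monoid_add)) \<Longrightarrow>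
      (\<Sum>i\<in>I p. F i) = (\<Sum>i\<in>I q. F i)"
proof -
  obtain N where N: "open N" "p \<in> N" "\<forall>q\<in>N. \<forall>i. i \<notin> I p \<longrightarrow> e i q = 0"
    using locally_finite by blast
  show thesis
  proof
    fix q and F :: "'i \<Rightarrow> 'z" assume q: "q \<in> N" and F: "\<And>i. e i q = 0 \<Longrightarrow> F i = 0"
    have "e i q = 0" if "i \<notin> I q" for i using locally_finite[of q] that by blast
    then have "(\<Sum>i\<in>I q. F i) = (\<Sum>i\<in>I p \<union> I q. F i)"
      by (intro sum.mono_neutral_left) (auto simp: finite_indices F)
    moreover have "(\<Sum>i\<in>I p. F i) = (\<Sum>i\<in>I p \<union> I q. F i)"
      using N(3) q by (intro sum.mono_neutral_left) (auto simp: finite_indices F)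
    ultimately show "(\<Sum>i\<in>I p. F i) = (\<Sum>i\<in>I q. F i)" by simp
  qed (use N in auto)
qed

lemma frame_sum_smooth:
  assumes "\<And>i. F i \<in> smooth_functions A" "\<And>i q. e i q = 0 \<Longrightarrow> F i q = 0"
  shows "(\<lambda>q. \<Sum>i\<in>I q. F i q) \<in> smooth_functions A"
proof (rule smooth_functions_local)
  fix p
  obtain N where "open N" "p \<in> N"
    "\<And>q F. q \<in> N \<Longrightarrow> (\<And>i. e i q = 0 \<Longrightarrow> F i = (0::real)) \<Longrightarrow> (\<Sum>i\<in>I p. F i) = (\<Sum>i\<in>I q. F i)"
    by (rule frame_sum_local[of p]) auto
  then show "\<exists>N f'. open N \<and> p \<in> N \<and> f' \<in> smooth_functions A \<and> (\<forall>q\<in>N. f' q = (\<Sum>i\<in>I q. F i q))"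
    using smooth_functions_sum[of "I p" F] assms by (intro exI[of _ N] exI[of _ "\<lambda>q. \<Sum>i\<in>I p. F i q"]) auto
qed

lemma tangent_vector_frame_sum:
  assumes v: "v \<in> tangent_space A p"
    and F: "\<And>i. F i \<in> smooth_functions A" "\<And>i q. e i q = 0 \<Longrightarrow> F i q = 0"
  shows "v (\<lambda>q. \<Sum>i\<in>I q. F i q) = (\<Sum>i\<in>I p. v (F i))"
proof -
  obtain N where N: "open N" "p \<in> N"
    "\<And>q F. q \<in> N \<Longrightarrow> (\<And>i. e i q = 0 \<Longrightarrow> F i = (0::real)) \<Longrightarrow> (\<Sum>i\<in>I p. F i) = (\<Sum>i\<in>I q. F i)"
    by (rule frame_sum_local[of p]) auto
  have "v (\<lambda>q. \<Sum>i\<in>I q. F i q) = v (\<lambda>q. \<Sum>i\<in>I p. F i q)"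
    by (rule tangent_vector_local[OF v frame_sum_smooth[OF F] smooth_functions_sum[OF F(1)] N(1,2)])
      (use N(3) F(2) in auto)
  then show ?thesis using tangent_vector_sum[OF v F(1)] by simp
qed

lemma frame_sum_field:
  assumes "\<And>i. F i \<in> smooth_functions A"
  shows "(\<lambda>q. \<Sum>i\<in>I q. scale (F i q) (e i q)) \<in> vector_fields A"
proof (rule vector_fields_local)
  fix p
  obtain N where N: "open N" "p \<in> N"
    "\<And>q F. q \<in> N \<Longrightarrow> (\<And>i. e i q = 0 \<Longrightarrow> F i = (0::'m tvec)) \<Longrightarrow> (\<Sum>i\<in>I p. F i) = (\<Sum>i\<in>I q. F i)"
    by (rule frame_sum_local[of p]) auto
  show "\<exists>N X'. open N \<and> p \<in> N \<and> X' \<in> vector_fields A \<and>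
      (\<forall>q\<in>N. X' q = (\<Sum>i\<in>I q. scale (F i q) (e i q)))"
  proof (intro exI conjI ballI)
    show "(\<lambda>q. \<Sum>i\<in>I p. scale (F i q) (e i q)) \<in> vector_fields A"
      by (intro vector_fields_sum vector_fields_scale assms frame)
    show "(\<Sum>i\<in>I p. scale (F i q) (e i q)) = (\<Sum>i\<in>I q. scale (F i q) (e i q))" if "q \<in> N" for q
      by (rule N(3)[OF that]) (simp only: scale.scale_zero_right)
  qed (use N in auto)
qed

definition coframe :: "'i \<Rightarrow> 'm form" where
  "coframe i p = (\<lambda>v. if v \<in> tangent_space A p then g p (e i p) v else 0)"

lemma coframe_apply: "v \<in> tangent_space A p \<Longrightarrow> coframe i p v = g p (e i p) v"
  by (simp add: coframe_def)

lemma coframe_form: "coframe i \<in> one_forms A"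
proof (rule one_formsI)
  show "coframe i p \<in> cotangent_space A p" for p
    unfolding cotangent_space_def linear_functional_on_def
    by (auto simp only: coframe_def tangent_space_add tangent_space_scale if_True
        symmetric_tensor_add[OF metric _ _ frame_tangent] symmetric_tensor_scale[OF metric _ frame_tangent])
      simp
  show "(\<lambda>p. coframe i p (X p)) \<in> smooth_functions A" if "X \<in> vector_fields A" for X
    using symmetric_tensor_smooth[OF metric frame that] vector_fields_tangent[OF that]
    by (simp add: coframe_apply)
qed

lemmas coframe_cotangent = one_forms_cotangent[OF coframe_form]

lemma cotangent_pairing_expansion:
  assumes "\<xi> \<in> cotangent_space A p" "v \<in> tangent_space A p"
  shows "\<xi> v = (\<Sum>i\<in>I p. \<xi> (e i p) * g p (e i p) v) + \<xi> (\<kappa> p) * \<tau> p v"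
proof -
  have "\<xi> v = \<xi> ((\<Sum>i\<in>I p. scale (g p (e i p) v) (e i p)) + scale (\<tau> p v) (\<kappa> p))"
    by (rule arg_cong[OF frame_expansion[OF assms(2), symmetric]])
  also have "\<dots> = (\<Sum>i\<in>I p. \<xi> (e i p) * g p (e i p) v) + \<xi> (\<kappa> p) * \<tau> p v"
    by (simp only: cotangent_linear(1)[OF assms(1)] cotangent_linear(2)[OF assms(1)] cotangent_sum[OF assms(1)]
        tangent_space_sum tangent_space_scale frame_tangent carroll_field_tangent mult.commute)
  finally show ?thesis .
qed

text \<open>The expansion of a tangent vector, read on covectors.\<close>

lemma cotangent_expansion:
  assumes "\<xi> \<in> cotangent_space A p"
  shows "(\<Sum>i\<in>I p. scale (\<xi> (e i p)) (coframe i p)) + scale (\<xi> (\<kappa> p)) (\<tau> p) = \<xi>" (is "?s = \<xi>")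
proof
  fix v
  have s: "?s v = (\<Sum>i\<in>I p. \<xi> (e i p) * coframe i p v) + \<xi> (\<kappa> p) * \<tau> p v"
    by (simp add: scale_def sum_fun_apply)
  show "?s v = \<xi> v"
  proof (cases "v \<in> tangent_space A p")
    case True
    then show ?thesis
      unfolding s cotangent_pairing_expansion[OF assms True] by (simp add: coframe_apply)
  next
    case False
    then show ?thesis
      unfolding s using cotangent_outside[OF clock_cotangent] cotangent_outside[OF assms]
      by (simp add: coframe_def)
  qed
qed

subsection \<open>The anchor\<close>

lemma bivector_linear:
  assumes "\<xi> \<in> cotangent_space A p" "\<eta> \<in> cotangent_space A p"
  shows "\<zeta> \<in> cotangent_space A p \<Longrightarrow> P p (\<xi> + \<zeta>) \<eta> = P p \<xi> \<eta> + P p \<zeta> \<eta>"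
    "P p (scale c \<xi>) \<eta> = c * P p \<xi> \<eta>"
    "\<zeta> \<in> cotangent_space A p \<Longrightarrow> P p \<xi> (\<eta> + \<zeta>) = P p \<xi> \<eta> + P p \<xi> \<zeta>"
    "P p \<xi> (scale c \<eta>) = c * P p \<xi> \<eta>"
proof -
  have "bilinear_form_on (cotangent_space A p) (P p)"
    using bivector by (simp add: bivector_field_def)
  then have L: "linear_functional_on (cotangent_space A p) (\<lambda>\<xi>. P p \<xi> \<eta>)"
    and R: "linear_functional_on (cotangent_space A p) (P p \<xi>)"
    using assms by (simp_all add: bilinear_form_on_def)
  show "\<zeta> \<in> cotangent_space A p \<Longrightarrow> P p (\<xi> + \<zeta>) \<eta> = P p \<xi> \<eta> + P p \<zeta> \<eta>"
    "P p (scale c \<xi>) \<eta> = c * P p \<xi> \<eta>"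
    using L assms(1) by (simp_all add: linear_functional_on_def)
  show "\<zeta> \<in> cotangent_space A p \<Longrightarrow> P p \<xi> (\<eta> + \<zeta>) = P p \<xi> \<eta> + P p \<xi> \<zeta>"
    "P p \<xi> (scale c \<eta>) = c * P p \<xi> \<eta>"
    using R assms(2) by (simp_all add: linear_functional_on_def)
qed

lemma bivector_sum:
  assumes \<xi>: "\<xi> \<in> cotangent_space A p" and "\<And>i. i \<in> J \<Longrightarrow> \<eta> i \<in> cotangent_space A p"
  shows "P p \<xi> (\<Sum>i\<in>J. \<eta> i) = (\<Sum>i\<in>J. P p \<xi> (\<eta> i))"
proof -
  have 0: "P p \<xi> 0 = 0"
    using bivector_linear(4)[OF \<xi> cotangent_space_0, of 0] by (simp only: scale.scale_zero_left mult_zero_left)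
  show ?thesis using assms(2)
    by (induction J rule: infinite_finite_induct)
      (simp_all only: sum.infinite sum.empty sum.insert 0 simp_thms bivector_linear(3)[OF \<xi>]
        cotangent_space_sum insert_iff)
qed

text \<open>The definite description in \<open>anchor_at\<close> needs the bidual to be the tangent space; with a frame at hand
  the vector representing \<open>P(\<xi>, -)\<close> can be written down.\<close>

lemma anchor_at_spec:
  assumes \<xi>: "\<xi> \<in> cotangent_space A p"
  shows "anchor_at A P p \<xi> \<in> tangent_space A p"
    "\<And>\<eta>. \<eta> \<in> cotangent_space A p \<Longrightarrow> \<eta> (anchor_at A P p \<xi>) = P p \<xi> \<eta>"
proof -
  let ?R = "\<lambda>v. v \<in> tangent_space A p \<and> (\<forall>\<eta>\<in>cotangent_space A p. \<eta> v = P p \<xi> \<eta>)"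
  have "\<exists>!v. ?R v"
  proof -
    let ?v = "(\<Sum>i\<in>I p. scale (P p \<xi> (coframe i p)) (e i p)) + scale (P p \<xi> (\<tau> p)) (\<kappa> p)"
    have v1: "\<eta> ?v = P p \<xi> \<eta>" if \<eta>: "\<eta> \<in> cotangent_space A p" for \<eta>
    proof -
      have "\<eta> ?v = (\<Sum>i\<in>I p. P p \<xi> (coframe i p) * \<eta> (e i p)) + P p \<xi> (\<tau> p) * \<eta> (\<kappa> p)"
        by (simp only: cotangent_linear(1)[OF \<eta>] cotangent_linear(2)[OF \<eta>] cotangent_sum[OF \<eta>]
            tangent_space_sum tangent_space_scale frame_tangent carroll_field_tangent)
      also have "\<dots> = P p \<xi> ((\<Sum>i\<in>I p. scale (\<eta> (e i p)) (coframe i p)) + scale (\<eta> (\<kappa> p)) (\<tau> p))"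
        by (simp only: bivector_linear(3)[OF \<xi>] bivector_linear(4)[OF \<xi>] bivector_sum[OF \<xi>]
            cotangent_space_sum cotangent_space_scale coframe_cotangent clock_cotangent mult.commute)
      finally show ?thesis unfolding cotangent_expansion[OF \<eta>] .
    qed
    have v2: "?v \<in> tangent_space A p"
      by (intro tangent_space_add tangent_space_sum tangent_space_scale frame_tangent carroll_field_tangent)
    show ?thesis
    proof (rule ex1I[of _ ?v])
      show "?R ?v" using v1 v2 by blast
      show "u = ?v" if u: "?R u" for u
      proof (rule one_forms_separate[OF _ v2])
        show "u \<in> tangent_space A p" using u by blast
        show "\<beta> p u = \<beta> p ?v" if "\<beta> \<in> one_forms A" for \<beta>
          using bspec[OF conjunct2[OF u] one_forms_cotangent[OF that]] v1[OF one_forms_cotangent[OF that]]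
          by (rule trans[OF _ sym])
      qed
    qed
  qed
  from theI'[OF this] have "?R (anchor_at A P p \<xi>)"
    unfolding anchor_at_def .
  then show "anchor_at A P p \<xi> \<in> tangent_space A p"
    "\<And>\<eta>. \<eta> \<in> cotangent_space A p \<Longrightarrow> \<eta> (anchor_at A P p \<xi>) = P p \<xi> \<eta>" by blast+
qed

lemma anchor_tangent: "\<alpha> \<in> one_forms A \<Longrightarrow> anchor A P \<alpha> p \<in> tangent_space A p"
  unfolding anchor_def by (rule anchor_at_spec(1)[OF one_forms_cotangent])

lemma anchor_apply:
  assumes "\<alpha> \<in> one_forms A" "f \<in> smooth_functions A"
  shows "anchor A P \<alpha> p f = P p (\<alpha> p) (differential A f p)"
  using anchor_at_spec(2)[OF one_forms_cotangent[OF assms(1)] one_forms_cotangent[OF differential_one_form[OF assms(2)]]]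
    differential_apply[OF anchor_tangent[OF assms(1)]]
  unfolding anchor_def by metis

lemma anchor_field:
  assumes "\<alpha> \<in> one_forms A"
  shows "anchor A P \<alpha> \<in> vector_fields A"
proof (rule vector_fieldsI[OF anchor_tangent[OF assms]])
  show "(\<lambda>p. anchor A P \<alpha> p f) \<in> smooth_functions A" if f: "f \<in> smooth_functions A" for f
    unfolding anchor_apply[OF assms f]
    using bivector assms differential_one_form[OF f] by (auto simp: bivector_field_def eval2_def)
qed

lemma anchor_linear:
  assumes "\<alpha> \<in> one_forms A" "\<alpha>' \<in> one_forms A" "f \<in> smooth_functions A"
  shows "\<alpha> + \<alpha>' \<in> one_forms A \<Longrightarrow> anchor A P (\<alpha> + \<alpha>') p f = anchor A P \<alpha> p f + anchor A P \<alpha>' p f"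
    "fscale k \<alpha> \<in> one_forms A \<Longrightarrow> anchor A P (fscale k \<alpha>) p f = k p * anchor A P \<alpha> p f"
  using bivector_linear(1,2)[OF one_forms_cotangent[OF assms(1)] one_forms_cotangent[OF differential_one_form[OF assms(3)]]]
    one_forms_cotangent[OF assms(2)]
  by (simp_all add: anchor_apply assms fscale_def)

lemma one_forms_add: "\<alpha> \<in> one_forms A \<Longrightarrow> \<alpha>' \<in> one_forms A \<Longrightarrow> \<alpha> + \<alpha>' \<in> one_forms A"
  by (rule one_formsI) (auto simp: cotangent_space_add one_forms_cotangent smooth_functions_add one_forms_smooth)

lemma one_forms_fscale: "k \<in> smooth_functions A \<Longrightarrow> \<alpha> \<in> one_forms A \<Longrightarrow> fscale k \<alpha> \<in> one_forms A"
  by (rule one_formsI)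
    (simp_all add: fscale_def cotangent_space_scale one_forms_cotangent,
      simp add: scale_def smooth_functions_mult one_forms_smooth)

subsection \<open>The connection\<close>

text \<open>The frame embeds the cotangent bundle into a trivial bundle by \<open>\<beta> \<mapsto> (\<beta>(e i), \<beta>(\<kappa>))\<close>, and this is the
  trivial connection there, projected back.\<close>

definition frame_connection :: "'m form \<Rightarrow> 'm form \<Rightarrow> 'm form" where
  "frame_connection \<alpha> \<beta> p =
     (\<Sum>i\<in>I p. scale (anchor A P \<alpha> p (pairing \<beta> (e i))) (coframe i p))
     + scale (anchor A P \<alpha> p (pairing \<beta> \<kappa>)) (\<tau> p)"

lemma pairing_smooth: "\<beta> \<in> one_forms A \<Longrightarrow> X \<in> vector_fields A \<Longrightarrow> pairing \<beta> X \<in> smooth_functions A"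
  by (simp add: one_forms_def)

lemma frame_connection_apply:
  assumes "v \<in> tangent_space A p"
  shows "frame_connection \<alpha> \<beta> p v =
    (\<Sum>i\<in>I p. anchor A P \<alpha> p (pairing \<beta> (e i)) * g p (e i p) v) + anchor A P \<alpha> p (pairing \<beta> \<kappa>) * \<tau> p v"
  by (simp add: frame_connection_def scale_def[of _ "_ :: _ covec"] sum_fun_apply coframe_apply assms)

lemma frame_connection_form:
  assumes "\<alpha> \<in> one_forms A" "\<beta> \<in> one_forms A"
  shows "frame_connection \<alpha> \<beta> \<in> one_forms A"
proof (rule one_formsI)
  show "frame_connection \<alpha> \<beta> p \<in> cotangent_space A p" for p
    unfolding frame_connection_def
    by (intro cotangent_space_add cotangent_space_sum cotangent_space_scale coframe_cotangent clock_cotangent)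
  fix Y assume Y: "Y \<in> vector_fields A"
  note sm = vector_fields_smooth[OF anchor_field[OF assms(1)] pairing_smooth[OF assms(2)]]
  have "(\<lambda>p. \<Sum>i\<in>I p. anchor A P \<alpha> p (pairing \<beta> (e i)) * g p (e i p) (Y p)) \<in> smooth_functions A"
    by (rule frame_sum_smooth)
      (simp_all add: smooth_functions_mult sm frame symmetric_tensor_smooth[OF metric frame Y]
        symmetric_tensor_0[OF metric vector_fields_tangent[OF Y]])
  then show "(\<lambda>p. frame_connection \<alpha> \<beta> p (Y p)) \<in> smooth_functions A"
    unfolding frame_connection_apply[OF vector_fields_tangent[OF Y]]
    by (rule smooth_functions_add) (rule smooth_functions_mult[OF sm[OF carroll_field] one_forms_smooth[OF clock Y]])
qed

lemma frame_connection_add_left: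
  assumes "\<alpha> \<in> one_forms A" "\<alpha>' \<in> one_forms A" "\<beta> \<in> one_forms A"
  shows "frame_connection (\<alpha> + \<alpha>') \<beta> = frame_connection \<alpha> \<beta> + frame_connection \<alpha>' \<beta>"
proof
  show "frame_connection (\<alpha> + \<alpha>') \<beta> p = (frame_connection \<alpha> \<beta> + frame_connection \<alpha>' \<beta>) p" for p
    unfolding plus_fun_apply[of "frame_connection \<alpha> \<beta>"] frame_connection_def
      anchor_linear(1)[OF assms(1,2) pairing_smooth[OF assms(3) frame] one_forms_add[OF assms(1,2)]]
      anchor_linear(1)[OF assms(1,2) pairing_smooth[OF assms(3) carroll_field] one_forms_add[OF assms(1,2)]]
    by (simp only: scale.scale_left_distrib sum.distrib ac_simps)
qed

lemma frame_connection_fscale_left: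
  assumes "k \<in> smooth_functions A" "\<alpha> \<in> one_forms A" "\<beta> \<in> one_forms A"
  shows "frame_connection (fscale k \<alpha>) \<beta> = fscale k (frame_connection \<alpha> \<beta>)"
proof
  show "frame_connection (fscale k \<alpha>) \<beta> p = fscale k (frame_connection \<alpha> \<beta>) p" for p
    unfolding fscale_def[of k "frame_connection \<alpha> \<beta>"] frame_connection_def
      anchor_linear(2)[OF assms(2,2) pairing_smooth[OF assms(3) frame] one_forms_fscale[OF assms(1,2)]]
      anchor_linear(2)[OF assms(2,2) pairing_smooth[OF assms(3) carroll_field] one_forms_fscale[OF assms(1,2)]]
    by (simp only: scale.scale_right_distrib scale.scale_sum_right scale.scale_scale)
qed

lemma frame_connection_add_right:
  assumes "\<alpha> \<in> one_forms A" "\<beta> \<in> one_forms A" "\<beta>' \<in> one_forms A"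
  shows "frame_connection \<alpha> (\<beta> + \<beta>') = frame_connection \<alpha> \<beta> + frame_connection \<alpha> \<beta>'"
proof
  fix p
  have *: "anchor A P \<alpha> p (pairing (\<beta> + \<beta>') X) = anchor A P \<alpha> p (pairing \<beta> X) + anchor A P \<alpha> p (pairing \<beta>' X)"
    if "X \<in> vector_fields A" for X
    using tangent_vector_add[OF anchor_tangent[OF assms(1)] pairing_smooth[OF assms(2) that] pairing_smooth[OF assms(3) that]]
    by (simp add: pairing_def)
  show "frame_connection \<alpha> (\<beta> + \<beta>') p = (frame_connection \<alpha> \<beta> + frame_connection \<alpha> \<beta>') p"
    unfolding plus_fun_apply[of "frame_connection \<alpha> \<beta>"] frame_connection_def *[OF frame] *[OF carroll_field]
    by (simp only: scale.scale_left_distrib sum.distrib ac_simps)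
qed

text \<open>The product rule for \<open>P\<^sup>#(\<alpha>)\<close> leaves, beside \<open>k D\<^sub>\<alpha>\<beta>\<close>, exactly the frame expansion
  of \<open>\<beta>\<close> multiplied by \<open>P\<^sup>#(\<alpha>)(k)\<close>.\<close>

lemma frame_connection_leibniz:
  assumes "k \<in> smooth_functions A" "\<alpha> \<in> one_forms A" "\<beta> \<in> one_forms A"
  shows "frame_connection \<alpha> (fscale k \<beta>) =
    fscale (act_on (anchor A P \<alpha>) k) \<beta> + fscale k (frame_connection \<alpha> \<beta>)"
proof
  fix p
  have *: "anchor A P \<alpha> p (pairing (fscale k \<beta>) X) =
      anchor A P \<alpha> p k * \<beta> p (X p) + k p * anchor A P \<alpha> p (pairing \<beta> X)"
    if "X \<in> vector_fields A" for X
    using tangent_vector_mult[OF anchor_tangent[OF assms(2)] assms(1) pairing_smooth[OF assms(3) that]]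
    by (simp add: pairing_def fscale_def scale_def)
  have "frame_connection \<alpha> (fscale k \<beta>) p =
      scale (anchor A P \<alpha> p k) ((\<Sum>i\<in>I p. scale (\<beta> p (e i p)) (coframe i p)) + scale (\<beta> p (\<kappa> p)) (\<tau> p)) +
      scale (k p) (frame_connection \<alpha> \<beta> p)"
    unfolding frame_connection_def *[OF frame] *[OF carroll_field]
    by (simp only: scale.scale_left_distrib scale.scale_right_distrib scale.scale_sum_right scale.scale_scale
        sum.distrib ac_simps)
  then show "frame_connection \<alpha> (fscale k \<beta>) p =
      (fscale (act_on (anchor A P \<alpha>) k) \<beta> + fscale k (frame_connection \<alpha> \<beta>)) p"
    unfolding cotangent_expansion[OF one_forms_cotangent[OF assms(3)]]
    by (simp add: fscale_def act_on_def)
qed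

lemma frame_connection_vaisman: "vaisman_connection A P frame_connection"
proof -
  have const: "frame_connection \<alpha> (fscale (\<lambda>_. c) \<beta>) = fscale (\<lambda>_. c) (frame_connection \<alpha> \<beta>)"
    if "\<alpha> \<in> one_forms A" "\<beta> \<in> one_forms A" for \<alpha> \<beta> c
  proof -
    have "act_on (anchor A P \<alpha>) (\<lambda>_. c) = (\<lambda>_. 0)"
      unfolding act_on_def tangent_vector_const[OF anchor_tangent[OF that(1)]] ..
    then show ?thesis
      unfolding frame_connection_leibniz[OF smooth_functions_const that]
      by (simp add: fscale_def scale_def fun_eq_iff)
  qed
  show ?thesis
    unfolding vaisman_connection_def
    by (intro conjI ballI allI frame_connection_form frame_connection_add_left frame_connection_add_right
        frame_connection_fscale_left frame_connection_leibniz const smooth_functions_const) auto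
qed

text \<open>The components of \<open>\<tau>\<close> are the constants 0 (along the frame) and 1 (along \<open>\<kappa>\<close>).\<close>

lemma frame_connection_clock: "clock_compatible A \<tau> frame_connection"
  unfolding clock_compatible_def
proof
  fix \<alpha> assume \<alpha>: "\<alpha> \<in> one_forms A"
  have "pairing \<tau> (e i) = (\<lambda>_. 0)" for i by (simp add: pairing_def frame_horizontal)
  moreover have "pairing \<tau> \<kappa> = (\<lambda>_. 1)" by (simp add: pairing_def clock_carroll_field)
  ultimately have "frame_connection \<alpha> \<tau> p = 0" for p
    unfolding frame_connection_def
    by (simp only: tangent_vector_const[OF anchor_tangent[OF \<alpha>]] scale.scale_zero_left sum.neutral_const add_0_left)
  then show "frame_connection \<alpha> \<tau> = 0" by (simp add: fun_eq_iff)
qed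

text \<open>The dual connection on vector fields, which \<open>vaisman_on_vfield\<close> only characterises.\<close>

definition field_connection :: "'m form \<Rightarrow> 'm vfield \<Rightarrow> 'm vfield" where
  "field_connection \<alpha> Z p =
     (\<Sum>i\<in>I p. scale (anchor A P \<alpha> p (eval2 g (e i) Z)) (e i p))
     + scale (anchor A P \<alpha> p (pairing \<tau> Z)) (\<kappa> p)"

lemma eval2_smooth: "Y \<in> vector_fields A \<Longrightarrow> Z \<in> vector_fields A \<Longrightarrow> eval2 g Y Z \<in> smooth_functions A"
  using metric by (simp add: symmetric_tensor_def)

lemma field_connection_field:
  assumes "\<alpha> \<in> one_forms A" "Z \<in> vector_fields A"
  shows "field_connection \<alpha> Z \<in> vector_fields A"
  unfolding field_connection_def
  by (rule vector_fields_add[OF frame_sum_field vector_fields_scale[OF _ carroll_field]])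
    (intro vector_fields_smooth[OF anchor_field] eval2_smooth pairing_smooth assms frame clock)+

text \<open>Apply \<open>P\<^sup>#(\<alpha>)\<close> to \<open>\<beta>(Z) = \<Sum> \<beta>(e i) g(e i, Z) + \<beta>(\<kappa>) \<tau>(Z)\<close>: the terms in which
  \<open>\<beta>(e i)\<close> and \<open>\<beta>(\<kappa>)\<close> are differentiated make up \<open>(D\<^sub>\<alpha>\<beta>)(Z)\<close>, the others \<open>\<beta>(D\<^sub>\<alpha>Z)\<close>.\<close>

lemma pairing_field_connection:
  assumes \<alpha>: "\<alpha> \<in> one_forms A" and \<beta>: "\<beta> \<in> one_forms A" and Z: "Z \<in> vector_fields A"
  shows "pairing \<beta> (field_connection \<alpha> Z) =
    act_on (anchor A P \<alpha>) (pairing \<beta> Z) - pairing (frame_connection \<alpha> \<beta>) Z"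
proof
  fix p
  let ?X = "anchor A P \<alpha> p"
  note \<beta>p = one_forms_cotangent[OF \<beta>] and Xp = anchor_tangent[OF \<alpha>, of p] and Zp = vector_fields_tangent[OF Z]
  have *: "?X (\<lambda>q. pairing \<beta> Y q * f q) = \<beta> p (Y p) * ?X f + ?X (pairing \<beta> Y) * f p"
    if "Y \<in> vector_fields A" "f \<in> smooth_functions A" for Y f
    using tangent_vector_mult[OF Xp pairing_smooth[OF \<beta> that(1)] that(2)] by (simp add: pairing_def)
  have "pairing \<beta> Z = (\<lambda>q. (\<Sum>i\<in>I q. pairing \<beta> (e i) q * eval2 g (e i) Z q) + pairing \<beta> \<kappa> q * pairing \<tau> Z q)"
    using cotangent_pairing_expansion[OF \<beta>p Zp] by (simp add: pairing_def eval2_def)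
  moreover have "?X (\<lambda>q. (\<Sum>i\<in>I q. pairing \<beta> (e i) q * eval2 g (e i) Z q) + pairing \<beta> \<kappa> q * pairing \<tau> Z q) =
      (\<Sum>i\<in>I p. ?X (\<lambda>q. pairing \<beta> (e i) q * eval2 g (e i) Z q)) + ?X (\<lambda>q. pairing \<beta> \<kappa> q * pairing \<tau> Z q)"
  proof -
    have sm: "(\<lambda>q. pairing \<beta> (e i) q * eval2 g (e i) Z q) \<in> smooth_functions A" for i
      by (intro smooth_functions_mult pairing_smooth eval2_smooth \<beta> Z frame)
    have zero: "pairing \<beta> (e i) q * eval2 g (e i) Z q = 0" if "e i q = 0" for i q
      by (simp add: eval2_def that symmetric_tensor_0(1)[OF metric Zp])
    have sm': "(\<lambda>q. pairing \<beta> \<kappa> q * pairing \<tau> Z q) \<in> smooth_functions A"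
      by (intro smooth_functions_mult pairing_smooth \<beta> Z carroll_field clock)
    have "?X (\<lambda>q. \<Sum>i\<in>I q. pairing \<beta> (e i) q * eval2 g (e i) Z q) =
        (\<Sum>i\<in>I p. ?X (\<lambda>q. pairing \<beta> (e i) q * eval2 g (e i) Z q))"
      by (rule tangent_vector_frame_sum[OF Xp], rule sm, rule zero)
    moreover have "(\<lambda>q. \<Sum>i\<in>I q. pairing \<beta> (e i) q * eval2 g (e i) Z q) \<in> smooth_functions A"
      by (rule frame_sum_smooth, rule sm, rule zero)
    ultimately show ?thesis
      using tangent_vector_add[OF Xp _ sm'] by simp
  qed
  ultimately have "?X (pairing \<beta> Z) =
      (\<Sum>i\<in>I p. ?X (\<lambda>q. pairing \<beta> (e i) q * eval2 g (e i) Z q)) + ?X (\<lambda>q. pairing \<beta> \<kappa> q * pairing \<tau> Z q)"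
    by simp
  also have "\<dots> = (\<Sum>i\<in>I p. \<beta> p (e i p) * ?X (eval2 g (e i) Z)) + \<beta> p (\<kappa> p) * ?X (pairing \<tau> Z)
      + frame_connection \<alpha> \<beta> p (Z p)"
    unfolding frame_connection_apply[OF Zp] *[OF frame eval2_smooth[OF frame Z]]
      *[OF carroll_field pairing_smooth[OF clock Z]]
    by (simp add: sum.distrib eval2_def pairing_def)
  also have "(\<Sum>i\<in>I p. \<beta> p (e i p) * ?X (eval2 g (e i) Z)) + \<beta> p (\<kappa> p) * ?X (pairing \<tau> Z) =
      \<beta> p (field_connection \<alpha> Z p)"
    unfolding field_connection_def
    by (simp only: cotangent_linear(1)[OF \<beta>p] cotangent_linear(2)[OF \<beta>p] cotangent_sum[OF \<beta>p]
        tangent_space_sum tangent_space_scale frame_tangent carroll_field_tangent mult.commute)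
  finally show "pairing \<beta> (field_connection \<alpha> Z) p =
      (act_on (anchor A P \<alpha>) (pairing \<beta> Z) - pairing (frame_connection \<alpha> \<beta>) Z) p"
    by (simp add: pairing_def act_on_def)
qed

lemma frame_connection_on_vfield:
  assumes \<alpha>: "\<alpha> \<in> one_forms A" and Z: "Z \<in> vector_fields A"
  shows "vaisman_on_vfield A P frame_connection \<alpha> Z = field_connection \<alpha> Z"
  unfolding vaisman_on_vfield_def
proof (rule the_equality)
  show "field_connection \<alpha> Z \<in> vector_fields A \<and> (\<forall>\<beta>\<in>one_forms A. pairing \<beta> (field_connection \<alpha> Z) =
      act_on (anchor A P \<alpha>) (pairing \<beta> Z) - pairing (frame_connection \<alpha> \<beta>) Z)"
    using field_connection_field[OF assms] pairing_field_connection[OF \<alpha> _ Z] by blast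
  fix Y assume Y: "Y \<in> vector_fields A \<and> (\<forall>\<beta>\<in>one_forms A. pairing \<beta> Y =
      act_on (anchor A P \<alpha>) (pairing \<beta> Z) - pairing (frame_connection \<alpha> \<beta>) Z)"
  show "Y = field_connection \<alpha> Z"
  proof
    fix p
    show "Y p = field_connection \<alpha> Z p"
    proof (rule one_forms_separate)
      show "Y p \<in> tangent_space A p" "field_connection \<alpha> Z p \<in> tangent_space A p"
        using Y field_connection_field[OF assms] vector_fields_tangent by blast+
      show "\<beta> p (Y p) = \<beta> p (field_connection \<alpha> Z p)" if "\<beta> \<in> one_forms A" for \<beta>
      proof -
        have "pairing \<beta> Y = pairing \<beta> (field_connection \<alpha> Z)"
          using Y pairing_field_connection[OF \<alpha> that Z] that by simp
        then show ?thesis unfolding pairing_def by (rule fun_cong)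
      qed
    qed
  qed
qed

lemma metric_field_connection:
  assumes \<alpha>: "\<alpha> \<in> one_forms A" and v: "v \<in> tangent_space A p"
  shows "g p (field_connection \<alpha> Z p) v = (\<Sum>i\<in>I p. anchor A P \<alpha> p (eval2 g (e i) Z) * g p (e i p) v)"
proof -
  note t = tangent_space_scale[OF frame_tangent] tangent_space_scale[OF carroll_field_tangent]
  show ?thesis
    unfolding field_connection_def symmetric_tensor_add(1)[OF metric tangent_space_sum[OF t(1)] t(2) v]
      symmetric_tensor_sum(2)[OF metric v t(1)] symmetric_tensor_scale(1)[OF metric frame_tangent v]
      symmetric_tensor_scale(1)[OF metric carroll_field_tangent v] metric_carroll_field[OF v]
    by simp
qed

lemma metric_expansion:
  assumes u: "u \<in> tangent_space A p" and v: "v \<in> tangent_space A p"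
  shows "g p u v = (\<Sum>i\<in>I p. g p (e i p) u * g p (e i p) v)"
proof -
  note t = tangent_space_scale[OF frame_tangent] tangent_space_scale[OF carroll_field_tangent]
  have "g p u v = g p ((\<Sum>i\<in>I p. scale (g p (e i p) u) (e i p)) + scale (\<tau> p u) (\<kappa> p)) v"
    by (rule arg_cong[where f = "\<lambda>u. g p u v", OF frame_expansion[OF u, symmetric]])
  also have "\<dots> = (\<Sum>i\<in>I p. g p (e i p) u * g p (e i p) v)"
    unfolding symmetric_tensor_add(1)[OF metric tangent_space_sum[OF t(1)] t(2) v]
      symmetric_tensor_sum(2)[OF metric v t(1)] symmetric_tensor_scale(1)[OF metric frame_tangent v]
      symmetric_tensor_scale(1)[OF metric carroll_field_tangent v] metric_carroll_field[OF v]
    by simp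
  finally show ?thesis .
qed

text \<open>Differentiate \<open>g(Y, Z) = \<Sum> g(e i, Y) g(e i, Z)\<close>. The product rule splits this into
  \<open>g(D\<^sub>\<alpha>Y, Z)\<close> and \<open>g(Y, D\<^sub>\<alpha>Z)\<close>, whose components along \<open>\<kappa>\<close> are invisible to \<open>g\<close>.\<close>

lemma frame_connection_metric: "metric_compatible A P g frame_connection"
  unfolding metric_compatible_def
proof (intro ballI)
  fix \<alpha> Y Z assume \<alpha>: "\<alpha> \<in> one_forms A" and Y: "Y \<in> vector_fields A" and Z: "Z \<in> vector_fields A"
  show "vaisman_on_metric A P frame_connection \<alpha> g Y Z = 0"
  proof
    fix p
    let ?X = "anchor A P \<alpha> p" and ?DY = "field_connection \<alpha> Y" and ?DZ = "field_connection \<alpha> Z"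
    note Xp = anchor_tangent[OF \<alpha>, of p] and Yp = vector_fields_tangent[OF Y] and Zp = vector_fields_tangent[OF Z]
    have sm: "(\<lambda>q. eval2 g (e i) Y q * eval2 g (e i) Z q) \<in> smooth_functions A" for i
      by (intro smooth_functions_mult eval2_smooth Y Z frame)
    have zero: "eval2 g (e i) Y q * eval2 g (e i) Z q = 0" if "e i q = 0" for i q
      by (simp add: eval2_def that symmetric_tensor_0(1)[OF metric Zp])
    have "eval2 g Y Z = (\<lambda>q. \<Sum>i\<in>I q. eval2 g (e i) Y q * eval2 g (e i) Z q)"
      using metric_expansion[OF Yp Zp] by (simp add: eval2_def)
    moreover have "?X (\<lambda>q. \<Sum>i\<in>I q. eval2 g (e i) Y q * eval2 g (e i) Z q) =
        (\<Sum>i\<in>I p. ?X (\<lambda>q. eval2 g (e i) Y q * eval2 g (e i) Z q))"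
      by (rule tangent_vector_frame_sum[OF Xp], rule sm, rule zero)
    ultimately have "?X (eval2 g Y Z) = (\<Sum>i\<in>I p. ?X (\<lambda>q. eval2 g (e i) Y q * eval2 g (e i) Z q))"
      by simp
    also have "\<dots> = (\<Sum>i\<in>I p. g p (e i p) (Y p) * ?X (eval2 g (e i) Z) + ?X (eval2 g (e i) Y) * g p (e i p) (Z p))"
      unfolding tangent_vector_mult[OF Xp eval2_smooth[OF frame Y] eval2_smooth[OF frame Z]]
      by (simp add: eval2_def)
    also have "\<dots> = g p (?DY p) (Z p) + g p (?DZ p) (Y p)"
      unfolding metric_field_connection[OF \<alpha> Zp] metric_field_connection[OF \<alpha> Yp]
      by (simp add: sum.distrib mult.commute)
    also have "g p (?DZ p) (Y p) = g p (Y p) (?DZ p)"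
      by (rule symmetric_tensor_commute[OF metric vector_fields_tangent[OF field_connection_field[OF \<alpha> Z]] Yp])
    finally show "vaisman_on_metric A P frame_connection \<alpha> g Y Z p = 0 p"
      unfolding vaisman_on_metric_def frame_connection_on_vfield[OF \<alpha> Y] frame_connection_on_vfield[OF \<alpha> Z]
      by (simp add: act_on_def eval2_def[of g ?DY Z] eval2_def[of g Y ?DZ])
  qed
qed

end

theorem theorem2p3:
  fixes A :: "('m::{t2_space,second_countable_topology}, 'e::euclidean_space) atlas"
    and B :: "('b::{t2_space,second_countable_topology}, 'f::real_normed_vector) atlas"
    and \<pi> :: "'m \<Rightarrow> 'b"
    and act :: "real \<Rightarrow> 'm \<Rightarrow> 'm"
    and g :: "'m \<Rightarrow> 'm tvec \<Rightarrow> 'm tvec \<Rightarrow> real"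
    and \<tau> :: "'m form"
    and P :: "'m \<Rightarrow> 'm covec \<Rightarrow> 'm covec \<Rightarrow> real"
  assumes "carrollian_poisson_bundle A B \<pi> act g \<tau> P"
  shows "\<exists>D. vaisman_connection A P D \<and> metric_compatible A P g D \<and> clock_compatible A \<tau> D"
proof -
  interpret carrollian_poisson_bundle A B \<pi> act g \<tau> P by fact
  obtain I :: "'m \<Rightarrow> (nat \<times> 'e) set" and e :: "nat \<times> 'e \<Rightarrow> 'm vfield"
    where "\<And>i. e i \<in> vector_fields A" "\<And>i p. \<tau> p (e i p) = 0" "\<And>p. finite (I p)"
    "\<And>p. \<exists>N. open N \<and> p \<in> N \<and> (\<forall>q\<in>N. \<forall>i. i \<notin> I p \<longrightarrow> e i q = 0)"
    "\<And>p v. v \<in> tangent_space A p \<Longrightarrow>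
      (\<Sum>i\<in>I p. scale (g p (e i p) v) (e i p)) + scale (\<tau> p v) (\<kappa> p) = v"
    by (rule carroll_frame) auto
  then interpret carrollian_frame A B \<pi> act g \<tau> P I e
    using poisson by unfold_locales (auto simp: poisson_structure_def)
  show ?thesis
    using frame_connection_vaisman frame_connection_metric frame_connection_clock by blast
qed

end
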